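(* Assume $\mathbb{E}[\|X_0\|_{\mathcal{L}^2_{-1}}^2]<\infty$. For $\beta>-1$ let $$\mathcal{R}_{\beta,\nu}=\frac{\int_0^1\mathbb{E}\big[\|X_t\|_{\mathcal{L}^2_\beta}^2\big]\,\mathrm{d}t}{\sqrt{\int_0^1\mathbb{E}\big[\|X_t\|_{\mathcal{L}^2_{2\beta+1}}^2\big]\,\mathrm{d}t}}.$$ Then, for $\alpha>0$ and $\nu\in(0,1)$, $$\mathcal{R}_{\beta,\nu}=\frac{\sum_{l_1,l_2\ge1}f_{l_1,l_2}(2(\nu\lambda_{l_1,l_2}-\theta_0):\alpha,\sigma^2,X_0)\,\mu_{l_1,l_2}^{-\alpha(\beta+1)}}{\sqrt{\sum_{l_1,l_2\ge1}f_{l_1,l_2}(2(\nu\lambda_{l_1,l_2}-\theta_0):\alpha,\sigma^2,X_0)\,\mu_{l_1,l_2}^{-2\alpha(\beta+1)}}},$$ where $f_{l_1,l_2}(x:\alpha,\sigma^2,X_0)=\mu_{l_1,l_2}^\alpha\,\mathbb{E}[\langle X_0,e_{l_1,l_2}\rangle^2]f_1(x)+\sigma^2f_2(x)$ with $$f_1(x)=\begin{cases}\frac{1-e^{-x}}{x},&x\ne0,\\1,&x=0,\end{cases}\qquad f_2(x)=\begin{cases}\frac{x-1+e^{-x}}{x^2},&x\neq0,\\\frac12,&x=0,\end{cases}$$ and the function $\beta\mapsto\mathcal{R}_{\beta,\nu}$ is decreasing on $(-1,\frac1\alpha-1]$.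
   Context: Setting. Let $\mathbb{T}=[0,1]$, $D=(0,1)^2$; $\alpha>0$, $\kappa,\eta\in\mathbb{R}$ and $\nu\in(0,1)$ are fixed. For $l_1,l_2\in\mathbb{N}=\{1,2,\dots\}$ put $\mu_{l_1,l_2}=\pi^2(l_1^2+l_2^2)$, $\lambda_{l_1,l_2}=\mu_{l_1,l_2}+\frac{\kappa^2+\eta^2}{4}$, $e_{l_1,l_2}(y,z)=2\sin(\pi l_1y)\sin(\pi l_2z)e^{-(\kappa y+\eta z)/2}$. Let $\mathcal{H}=L^2(D)$ with inner product $\langle u,v\rangle=\iint_Du(x,y)v(x,y)e^{\kappa x+\eta y}\,\mathrm{d}x\,\mathrm{d}y$; $\{e_{l_1,l_2}\}$ is a complete orthonormal system of $\mathcal{H}$. The operator $-\mathcal{A}=\partial_y^2+\partial_z^2+\kappa\partial_y+\eta\partial_z$ with Dirichlet boundary condition satisfies $\mathcal{A}e_{l_1,l_2}=\lambda_{l_1,l_2}e_{l_1,l_2}$, and $S_t=e^{-t\mathcal{A}}$. For $\beta\in\mathbb{R}$, $\mathcal{L}^2_\beta$ is the space of $u=\sum u_{l_1,l_2}e_{l_1,l_2}$ with $\|u\|_{\mathcal{L}^2_\beta}^2=\sum_{l_1,l_2\ge1}\mu_{l_1,l_2}^{-\alpha\beta}u_{l_1,l_2}^2<\infty$. On a stochastic basis with usual conditions let $\{w_{l_1,l_2}\}$ be independent standard real Brownian motions and $W^Q_t=\sum_{l_1,l_2\ge1}\mu_{l_1,l_2}^{-\alpha/2}w_{l_1,l_2}(t)e_{l_1,l_2}$.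 The process $X$ is the mild solution on $\mathbb{T}$ of $\mathrm{d}X_t=(-\nu\mathcal{A}+\theta_0)X_t\,\mathrm{d}t+\sigma\,\mathrm{d}W^Q_t$, $(\theta_0,\sigma)\in\mathbb{R}\times(0,\infty)$, with Dirichlet boundary condition and initial value $X_0$, an $L^2(D)$-valued random variable independent of $W^Q$; that is, $X_t=S_{\nu t}X_0+\theta_0\int_0^tS_{\nu(t-s)}X_s\,\mathrm{d}s+\sigma\int_0^tS_{\nu(t-s)}\,\mathrm{d}W^Q_s$. *)

theory Defs
  imports "HOL-Probability.Probability"
begin

text \<open>
  \<open>L\<^sup>2(D)\<close> for the open unit square \<open>D\<close>, as equivalence classes of square integrable functions
  modulo equality almost everywhere, with its unweighted inner product.
\<close>

definition D_measure :: "(real \<times> real) measure" where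
  "D_measure = restrict_space lborel ({0<..<1} \<times> {0<..<1})"

definition sq_integrable :: "(real \<times> real \<Rightarrow> real) \<Rightarrow> bool" where
  "sq_integrable f \<longleftrightarrow> f \<in> borel_measurable D_measure \<and> integrable D_measure (\<lambda>p. (f p)\<^sup>2)"

definition l2_rel :: "(real \<times> real \<Rightarrow> real) \<Rightarrow> (real \<times> real \<Rightarrow> real) \<Rightarrow> bool" where
  "l2_rel f g \<longleftrightarrow> sq_integrable f \<and> sq_integrable g \<and> (AE p in D_measure. f p = g p)"

quotient_type L2D = "real \<times> real \<Rightarrow> real" / partial: l2_rel
proof (rule part_equivpI)
  show "\<exists>f. l2_rel f f"
    by (rule exI[of _ "\<lambda>_. 0"]) (simp add: l2_rel_def sq_integrable_def)
  show "symp l2_rel"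
    by (auto intro!: sympI simp: l2_rel_def elim: eventually_mono)
  show "transp l2_rel"
    by (auto intro!: transpI simp: l2_rel_def elim!: eventually_rev_mp)
qed

lemma space_D_measure: "space D_measure = {0<..<1} \<times> {0<..<1}"
  by (simp add: D_measure_def space_restrict_space)

lemma D_measure_square: "{0<..<1} \<times> {0<..<1} = box (0, 0) (1::real, 1::real)"
  by (auto simp: box_def Basis_prod_def)

lemma finite_measure_D: "finite_measure D_measure"
proof
  have "{0<..<1} \<times> {0<..<1} \<in> sets (lborel :: (real \<times> real) measure)"
    unfolding D_measure_square by simp
  then have "emeasure D_measure (space D_measure) = emeasure lborel (box (0, 0) (1::real, 1::real))"
    unfolding space_D_measure
    by (simp add: D_measure_def emeasure_restrict_space D_measure_square)
  also have "\<dots> < \<infinity>" by (rule emeasure_lborel_box_finite)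
  finally show "emeasure D_measure (space D_measure) \<noteq> \<infinity>" by simp
qed

interpretation D: finite_measure D_measure by (rule finite_measure_D)

lemma sq_integrable_mult:
  assumes f: "sq_integrable f" and g: "sq_integrable g"
  shows "integrable D_measure (\<lambda>p. f p * g p)"
proof (rule Bochner_Integration.integrable_bound[where f = "\<lambda>p. (f p)\<^sup>2 + (g p)\<^sup>2"])
  have "\<bar>a * b\<bar> \<le> \<bar>a\<^sup>2 + b\<^sup>2\<bar>" for a b :: real
    using sum_squares_bound[of "\<bar>a\<bar>" "\<bar>b\<bar>"] mult_nonneg_nonneg[OF abs_ge_zero[of a] abs_ge_zero[of b]]
    unfolding power2_abs abs_mult by linarith
  then show "AE p in D_measure. norm (f p * g p) \<le> norm ((f p)\<^sup>2 + (g p)\<^sup>2)"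
    by simp
qed (use f g in \<open>auto simp: sq_integrable_def\<close>)

lemma sq_integrable_mult_bounded:
  assumes f: "sq_integrable f" and b: "b \<in> borel_measurable D_measure" "\<And>p. p \<in> space D_measure \<Longrightarrow> \<bar>b p\<bar> \<le> K"
  shows "sq_integrable (\<lambda>p. b p * f p)"
proof -
  have "integrable D_measure (\<lambda>p. (b p * f p)\<^sup>2)"
  proof (rule Bochner_Integration.integrable_bound[where f = "\<lambda>p. K\<^sup>2 * (f p)\<^sup>2"])
    show "AE p in D_measure. norm ((b p * f p)\<^sup>2) \<le> norm (K\<^sup>2 * (f p)\<^sup>2)"
    proof (rule AE_I2)
      fix p assume "p \<in> space D_measure"
      then have "(b p)\<^sup>2 \<le> K\<^sup>2"
        using b(2) by (metis abs_le_square_iff abs_le_D1 abs_ge_self order.trans)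
      then show "norm ((b p * f p)\<^sup>2) \<le> norm (K\<^sup>2 * (f p)\<^sup>2)"
        by (simp add: power_mult_distrib mult_right_mono)
    qed
  qed (use f b in \<open>auto simp: sq_integrable_def\<close>)
  then show ?thesis using f b by (auto simp: sq_integrable_def)
qed

lemma sq_integrable_bounded:
  assumes b: "b \<in> borel_measurable D_measure" "\<And>p. p \<in> space D_measure \<Longrightarrow> \<bar>b p\<bar> \<le> K"
  shows "sq_integrable b"
  using sq_integrable_mult_bounded[of "\<lambda>_. 1" b K] b by (simp add: sq_integrable_def)

lemma sq_integrable_add:
  assumes f: "sq_integrable f" and g: "sq_integrable g"
  shows "sq_integrable (\<lambda>p. f p + g p)"
proof -
  have "integrable D_measure (\<lambda>p. (f p)\<^sup>2 + (g p)\<^sup>2 + 2 * (f p * g p))"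
    using f g sq_integrable_mult[OF f g] by (auto simp: sq_integrable_def)
  also have "(\<lambda>p. (f p)\<^sup>2 + (g p)\<^sup>2 + 2 * (f p * g p)) = (\<lambda>p. (f p + g p)\<^sup>2)"
    by (auto simp: power2_eq_square algebra_simps)
  finally show ?thesis using f g by (auto simp: sq_integrable_def)
qed

lemma sq_integrable_scale: "sq_integrable f \<Longrightarrow> sq_integrable (\<lambda>p. c * f p)"
  by (auto simp: sq_integrable_def power_mult_distrib)

lemma sq_integrable_diff:
  assumes f: "sq_integrable f" and g: "sq_integrable g"
  shows "sq_integrable (\<lambda>p. f p - g p)"
  using sq_integrable_add[OF f sq_integrable_scale[OF g, of "-1"]] by simp

instantiation L2D :: real_inner
begin

lift_definition zero_L2D :: L2D is "\<lambda>_. 0"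
  by (simp add: l2_rel_def sq_integrable_def)

lift_definition plus_L2D :: "L2D \<Rightarrow> L2D \<Rightarrow> L2D" is "\<lambda>f g p. f p + g p"
  by (auto simp: l2_rel_def sq_integrable_add)

lift_definition minus_L2D :: "L2D \<Rightarrow> L2D \<Rightarrow> L2D" is "\<lambda>f g p. f p - g p"
  by (auto simp: l2_rel_def sq_integrable_diff)

lift_definition uminus_L2D :: "L2D \<Rightarrow> L2D" is "\<lambda>f p. - f p"
  using sq_integrable_scale[of _ "-1"] by (auto simp: l2_rel_def)

lift_definition scaleR_L2D :: "real \<Rightarrow> L2D \<Rightarrow> L2D" is "\<lambda>c f p. c * f p"
  by (auto simp: l2_rel_def sq_integrable_scale)

lift_definition inner_L2D :: "L2D \<Rightarrow> L2D \<Rightarrow> real" is "\<lambda>f g. LINT p|D_measure. f p * g p"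
  by (auto simp: l2_rel_def sq_integrable_def intro!: integral_cong_AE)

definition norm_L2D :: "L2D \<Rightarrow> real" where "norm_L2D u = sqrt (inner u u)"
definition sgn_L2D :: "L2D \<Rightarrow> L2D" where "sgn_L2D u = inverse (norm u) *\<^sub>R u"
definition dist_L2D :: "L2D \<Rightarrow> L2D \<Rightarrow> real" where "dist_L2D u v = norm (u - v)"
definition uniformity_L2D :: "(L2D \<times> L2D) filter" where
  "uniformity_L2D = (INF e\<in>{0<..}. principal {(x, y). dist x y < e})"
definition open_L2D :: "L2D set \<Rightarrow> bool" where
  "open_L2D U = (\<forall>x\<in>U. \<forall>\<^sub>F (x', y) in uniformity. x' = x \<longrightarrow> y \<in> U)"

instance
proof
  fix u v w :: L2D and a b :: real
  show "u + v + w = u + (v + w)" by transfer (auto simp: l2_rel_def sq_integrable_add ac_simps)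
  show "u + v = v + u" by transfer (auto simp: l2_rel_def sq_integrable_add ac_simps)
  show "0 + u = u" by transfer (auto simp: l2_rel_def)
  show "- u + u = 0" by transfer (auto simp: l2_rel_def sq_integrable_def)
  show "u - v = u + - v" by transfer (auto simp: l2_rel_def sq_integrable_diff)
  show "a *\<^sub>R (u + v) = a *\<^sub>R u + a *\<^sub>R v"
    by transfer (auto simp: l2_rel_def sq_integrable_add sq_integrable_scale distrib_left)
  show "(a + b) *\<^sub>R u = a *\<^sub>R u + b *\<^sub>R u"
    using sq_integrable_scale sq_integrable_add
    by transfer (auto simp: l2_rel_def sq_integrable_add sq_integrable_scale distrib_right[abs_def])
  show "a *\<^sub>R b *\<^sub>R u = (a * b) *\<^sub>R u"
    by transfer (auto simp: l2_rel_def sq_integrable_scale ac_simps)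
  show "1 *\<^sub>R u = u" by transfer (auto simp: l2_rel_def)
  show "sgn u = inverse (norm u) *\<^sub>R u" by (simp add: sgn_L2D_def)
  show "dist u v = norm (u - v)" by (rule dist_L2D_def)
  show "uniformity = (INF e\<in>{0<..}. principal {(x :: L2D, y). dist x y < e})"
    by (rule uniformity_L2D_def)
  show "inner u v = inner v u" by transfer (simp add: mult.commute)
  show "inner (u + v) w = inner u w + inner v w"
    by transfer (auto simp: l2_rel_def distrib_right sq_integrable_mult)
  show "inner (a *\<^sub>R u) v = a * inner u v"
    by transfer (auto simp: mult.assoc)
  show "0 \<le> inner u u" by transfer simp
  show "norm u = sqrt (inner u u)" by (rule norm_L2D_def)
  show "(inner u u = 0) = (u = 0)"
  proof transfer
    fix f assume f: "l2_rel f f"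
    have "((LINT p|D_measure. f p * f p) = 0) = (AE p in D_measure. f p * f p = 0)"
      using f by (intro integral_nonneg_eq_0_iff_AE) (auto simp: l2_rel_def sq_integrable_mult)
    also have "\<dots> = l2_rel f (\<lambda>_. 0)"
      using f by (auto simp: l2_rel_def sq_integrable_def)
    finally show "((LINT p|D_measure. f p * f p) = 0) = l2_rel f (\<lambda>_. 0)" .
  qed
next
  fix U :: "L2D set"
  show "open U = (\<forall>x\<in>U. \<forall>\<^sub>F (x', y) in uniformity. x' = x \<longrightarrow> y \<in> U)"
    by (rule open_L2D_def)
qed

end


lemma L2D_abs_cases:
  obtains f where "sq_integrable f" "u = abs_L2D f"
  using Quotient_abs_rep[OF Quotient_L2D, of u] Quotient_rep_reflp[OF Quotient_L2D, of u]
  by (metis l2_rel_def)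

lemma L2D_minus_abs:
  assumes "sq_integrable f" "sq_integrable g"
  shows "abs_L2D f - abs_L2D g = abs_L2D (\<lambda>p. f p - g p)"
  using assms by (intro minus_L2D.abs_eq) (auto simp: l2_rel_def)

lemma L2D_norm_abs:
  assumes "sq_integrable f"
  shows "ennreal ((norm (abs_L2D f))\<^sup>2) = (\<integral>\<^sup>+p. ennreal ((f p)\<^sup>2) \<partial>D_measure)"
proof -
  have "inner (abs_L2D f) (abs_L2D f) = (LINT p|D_measure. f p * f p)"
    using assms by (intro inner_L2D.abs_eq) (auto simp: l2_rel_def)
  then have "(norm (abs_L2D f))\<^sup>2 = (LINT p|D_measure. (f p)\<^sup>2)"
    by (simp add: power2_norm_eq_inner power2_eq_square[symmetric])
  then show ?thesis
    using assms by (subst nn_integral_eq_integral) (auto simp: sq_integrable_def)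
qed

lemma Cauchy_L2D_convergent:
  fixes U :: "nat \<Rightarrow> L2D"
  assumes U: "Cauchy U"
  shows "convergent U"
proof -
  have "\<exists>n. \<forall>m\<ge>n. norm (U m - U n) < (1/2) ^ k" for k
    using U[unfolded Cauchy_altdef2, rule_format, of "(1/2) ^ k"] by (auto simp: dist_norm)
  then obtain N where N: "\<And>k m. m \<ge> N k \<Longrightarrow> norm (U m - U (N k)) < (1/2) ^ k" by metis
  define r where "r k = Max (N ` {..k}) + k" for k
  have rN: "r k \<ge> N k" for k unfolding r_def by (intro trans_le_add1 Max_ge) auto
  have "Max (N ` {..k}) \<le> Max (N ` {..Suc k})" for k by (rule Max_mono) auto
  then have r: "strict_mono r"
    unfolding strict_mono_Suc_iff r_def by (simp add: add_mono le_imp_less_Suc)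
  have close: "norm (U m - U (r k)) < 2 * (1/2) ^ k" if "m \<ge> r k" for m k
  proof -
    have "norm (U m - U (r k)) \<le> norm (U m - U (N k)) + norm (U (r k) - U (N k))"
      by norm
    moreover have "norm (U m - U (N k)) < (1/2) ^ k" "norm (U (r k) - U (N k)) < (1/2) ^ k"
      using N[of k m] N[of k "r k"] rN[of k] that by auto
    ultimately show ?thesis by simp
  qed
  have "\<exists>f. sq_integrable f \<and> U (r k) = abs_L2D f" for k
    using L2D_abs_cases[of "U (r k)"] by blast
  then obtain f where f: "\<And>k. sq_integrable (f k)" and Uf: "\<And>k. U (r k) = abs_L2D (f k)" by metis
  have [measurable]: "f k \<in> borel_measurable D_measure" for k
    using f by (simp add: sq_integrable_def)
  have dist_f: "(\<integral>\<^sup>+p. ennreal ((f j p - f k p)\<^sup>2) \<partial>D_measure) \<le> ennreal (4 * (1/4) ^ k)" if "k \<le> j" for j k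
  proof -
    have "(\<integral>\<^sup>+p. ennreal ((f j p - f k p)\<^sup>2) \<partial>D_measure) = ennreal ((norm (U (r j) - U (r k)))\<^sup>2)"
      unfolding Uf L2D_minus_abs[OF f f] by (rule L2D_norm_abs[symmetric]) (intro sq_integrable_diff f)
    also have "\<dots> \<le> ennreal ((2 * (1/2) ^ k)\<^sup>2)"
      using close[of k "r j"] strict_mono_less_eq[OF r, of k j] that
      by (intro ennreal_leI power_mono) auto
    also have "(2 * (1/2) ^ k)\<^sup>2 = 4 * (1/4 :: real) ^ k"
      by (simp add: power_mult_distrib power_mult[symmetric] mult.commute[of k] power_divide)
        (simp add: power_mult)
    finally show ?thesis .
  qed
  define K where "K = measure D_measure (space D_measure)"
  have L1: "(\<integral>\<^sup>+p. ennreal \<bar>f (Suc k) p - f k p\<bar> \<partial>D_measure) \<le> ennreal ((4 + K) * (1/2) ^ k)" for k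
  proof -
    have "(\<integral>\<^sup>+p. ennreal \<bar>f (Suc k) p - f k p\<bar> \<partial>D_measure)
       \<le> (\<integral>\<^sup>+p. ennreal (2 ^ k) * ennreal ((f (Suc k) p - f k p)\<^sup>2) + ennreal ((1/2) ^ k) \<partial>D_measure)"
    proof (intro nn_integral_mono)
      have pr: "2 * d \<le> P * d\<^sup>2 + R"
        if "P * (2 * d * R) \<le> P * (d\<^sup>2 + R\<^sup>2)" "P * R = 1" for P R d :: real
      proof -
        have "P * (2 * d * R) = 2 * d * (P * R)" "P * (d\<^sup>2 + R\<^sup>2) = P * d\<^sup>2 + (P * R) * R"
          by (auto simp: algebra_simps power2_eq_square)
        then show ?thesis using that by (metis mult.right_neutral mult_1)
      qed
      fix p
      define d where "d = \<bar>f (Suc k) p - f k p\<bar>"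
      have "2 * d * (1/2) ^ k \<le> d\<^sup>2 + ((1/2) ^ k)\<^sup>2" by (rule sum_squares_bound)
      then have "2 ^ k * (2 * d * (1/2) ^ k) \<le> 2 ^ k * (d\<^sup>2 + ((1/2) ^ k)\<^sup>2)"
        by (intro mult_left_mono) auto
      moreover have "2 ^ k * (1/2) ^ k = (1::real)" by (simp add: power_mult_distrib[symmetric])
      ultimately have "2 * d \<le> 2 ^ k * d\<^sup>2 + (1/2) ^ k"
        using pr[where P = "2 ^ k" and R = "(1/2) ^ k" and d = d] by blast
      moreover have "0 \<le> d" by (simp add: d_def)
      ultimately have "d \<le> 2 ^ k * d\<^sup>2 + (1/2) ^ k" by linarith
      then show "ennreal \<bar>f (Suc k) p - f k p\<bar>
        \<le> ennreal (2 ^ k) * ennreal ((f (Suc k) p - f k p)\<^sup>2) + ennreal ((1/2) ^ k)"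
        by (simp add: d_def ennreal_mult[symmetric] ennreal_plus[symmetric] ennreal_leI del: ennreal_plus)
    qed
    also have "\<dots> = ennreal (2 ^ k) * (\<integral>\<^sup>+p. ennreal ((f (Suc k) p - f k p)\<^sup>2) \<partial>D_measure)
        + ennreal ((1/2) ^ k) * emeasure D_measure (space D_measure)"
      by (simp add: nn_integral_add nn_integral_cmult)
    also have "\<dots> \<le> ennreal (2 ^ k) * ennreal (4 * (1/4) ^ k) + ennreal ((1/2) ^ k) * ennreal K"
      using dist_f[of k "Suc k"] by (intro add_mono mult_left_mono) (auto simp: K_def D.emeasure_eq_measure)
    also have "\<dots> = ennreal (2 ^ k * (4 * (1/4) ^ k) + (1/2) ^ k * K)"
      by (simp add: ennreal_mult[symmetric] K_def ennreal_plus[symmetric] del: ennreal_plus)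
    also have "2 ^ k * (4 * (1/4) ^ k) + (1/2) ^ k * K = (4 + K) * (1/2 :: real) ^ k"
    proof -
      have "2 ^ k * (1/4) ^ k = (1/2 :: real) ^ k" by (simp add: power_mult_distrib[symmetric])
      then show ?thesis by (simp add: algebra_simps)
    qed
    finally show ?thesis .
  qed
  have "(\<integral>\<^sup>+p. (\<Sum>k. ennreal \<bar>f (Suc k) p - f k p\<bar>) \<partial>D_measure)
      = (\<Sum>k. \<integral>\<^sup>+p. ennreal \<bar>f (Suc k) p - f k p\<bar> \<partial>D_measure)"
    by (rule nn_integral_suminf) auto
  also have "\<dots> \<le> (\<Sum>k. ennreal ((4 + K) * (1/2) ^ k))"
    by (intro suminf_le L1) auto
  also have "\<dots> < \<infinity>"
    by (subst suminf_ennreal2) (auto simp: K_def intro!: summable_mult)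
  finally have "AE p in D_measure. (\<Sum>k. ennreal \<bar>f (Suc k) p - f k p\<bar>) \<noteq> \<infinity>"
    by (intro nn_integral_PInf_AE) auto
  then have conv: "AE p in D_measure. (\<lambda>k. f k p) \<longlonglongrightarrow> lim (\<lambda>k. f k p)"
  proof eventually_elim
    case (elim p)
    then have "summable (\<lambda>k. \<bar>f (Suc k) p - f k p\<bar>)"
      by (intro summable_suminf_not_top) auto
    then have "convergent (\<lambda>n. \<Sum>k<n. f (Suc k) p - f k p)"
      using summable_rabs_cancel summable_iff_convergent by blast
    then have "convergent (\<lambda>n. f n p)"
      unfolding sum_lessThan_telescope[of "\<lambda>k. f k p"]
      using convergent_diff_const_right_iff[of "\<lambda>n. f n p" "f 0 p"] by blast
    then show ?case by (simp add: convergent_LIMSEQ_iff)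
  qed
  define F where "F p = lim (\<lambda>k. f k p)" for p
  have F_meas [measurable]: "F \<in> borel_measurable D_measure"
    unfolding F_def by (rule borel_measurable_lim_metric) simp
  have Fatou: "(\<integral>\<^sup>+p. ennreal ((F p - f k p)\<^sup>2) \<partial>D_measure) \<le> ennreal (4 * (1/4) ^ k)" for k
  proof -
    have "(\<integral>\<^sup>+p. ennreal ((F p - f k p)\<^sup>2) \<partial>D_measure)
        = (\<integral>\<^sup>+p. liminf (\<lambda>j. ennreal ((f j p - f k p)\<^sup>2)) \<partial>D_measure)"
    proof (rule nn_integral_cong_AE, use conv in eventually_elim)
      case (elim p)
      have "(\<lambda>j. ennreal ((f j p - f k p)\<^sup>2)) \<longlonglongrightarrow> ennreal ((F p - f k p)\<^sup>2)"
        unfolding F_def by (intro tendsto_ennrealI tendsto_intros elim)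
      then show ?case
        by (intro lim_imp_Liminf[symmetric] trivial_limit_sequentially)
    qed
    also have "\<dots> \<le> liminf (\<lambda>j. \<integral>\<^sup>+p. ennreal ((f j p - f k p)\<^sup>2) \<partial>D_measure)"
      by (rule nn_integral_liminf) auto
    also have "\<dots> \<le> limsup (\<lambda>j. \<integral>\<^sup>+p. ennreal ((f j p - f k p)\<^sup>2) \<partial>D_measure)"
      by (rule Liminf_le_Limsup) simp
    also have "\<dots> \<le> ennreal (4 * (1/4) ^ k)"
      by (rule Limsup_bounded, rule eventually_mono[OF eventually_ge_at_top[of k]], rule dist_f)
    finally show ?thesis .
  qed
  have Ff: "sq_integrable (\<lambda>p. F p - f k p)" for k
    unfolding sq_integrable_def
    using Fatou[of k] by (auto intro!: integrableI_bounded simp: le_less_trans)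
  have F: "sq_integrable F"
    using sq_integrable_add[OF Ff[of 0] f[of 0]] by simp
  have "dist (U (r k)) (abs_L2D F) \<le> 2 * (1/2) ^ k" for k
  proof -
    have "ennreal ((norm (abs_L2D F - U (r k)))\<^sup>2) \<le> ennreal (4 * (1/4) ^ k)"
      unfolding Uf L2D_minus_abs[OF F f] L2D_norm_abs[OF Ff] by (rule Fatou)
    then have "(norm (abs_L2D F - U (r k)))\<^sup>2 \<le> 4 * (1/4) ^ k" by simp
    also have "4 * (1/4) ^ k = (2 * (1/2 :: real) ^ k)\<^sup>2"
      by (simp add: power_mult_distrib power_mult[symmetric] mult.commute[of k] power_divide)
        (simp add: power_mult)
    finally show ?thesis
      by (subst dist_commute) (auto simp: dist_norm intro: power2_le_imp_le)
  qed
  note bound = this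
  have lim0: "(\<lambda>k. 2 * (1/2 :: real) ^ k) \<longlonglongrightarrow> 0"
    by (intro tendsto_mult_right_zero LIMSEQ_power_zero) simp
  have "(\<lambda>k. dist (U (r k)) (abs_L2D F)) \<longlonglongrightarrow> 0"
    by (rule real_tendsto_sandwich[OF _ _ tendsto_const lim0]) (simp_all add: bound)
  then have "(U \<circ> r) \<longlonglongrightarrow> abs_L2D F"
    by (simp add: tendsto_dist_iff[of _ "abs_L2D F"])
  then have "U \<longlonglongrightarrow> abs_L2D F"
    using Cauchy_converges_subseq[OF U r] by blast
  then show ?thesis by (auto simp: convergent_def)
qed

instance L2D :: banach
  by standard (rule Cauchy_L2D_convergent)

definition pi_boxes :: "(real \<times> real) set set" where
  "pi_boxes = (\<Inter>) ` {F. finite F \<and> F \<subseteq> (SOME B. countable B \<and> topological_basis B)}"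

lemma pi_boxes:
  shows countable_pi_boxes: "countable pi_boxes"
    and Int_stable_pi_boxes: "Int_stable pi_boxes"
    and sets_borel_pi_boxes: "sets borel = sigma_sets UNIV pi_boxes"
proof -
  define B where "B = (SOME B :: (real \<times> real) set set. countable B \<and> topological_basis B)"
  have "\<exists>B :: (real \<times> real) set set. countable B \<and> topological_basis B"
    by (rule ex_countable_basis)
  then have B: "countable B" "topological_basis B"
    unfolding B_def by (metis (mono_tags, lifting) someI_ex)+
  have eq: "pi_boxes = (\<Inter>) ` {F. finite F \<and> F \<subseteq> B}"
    by (simp add: pi_boxes_def B_def)
  show "countable pi_boxes"
    unfolding eq by (intro countable_image countable_Collect_finite_subset B)
  show "Int_stable pi_boxes"
  proof (rule Int_stableI)
    fix a b assume "a \<in> pi_boxes" "b \<in> pi_boxes"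
    then obtain F G where "finite F" "F \<subseteq> B" "a = \<Inter>F" "finite G" "G \<subseteq> B" "b = \<Inter>G"
      unfolding eq by blast
    then have "a \<inter> b = \<Inter>(F \<union> G)" "finite (F \<union> G)" "F \<union> G \<subseteq> B" by auto
    then show "a \<inter> b \<in> pi_boxes" unfolding eq by blast
  qed
  have sub: "B \<subseteq> pi_boxes" unfolding eq by (force intro: image_eqI[of _ _ "{b}" for b])
  have op: "pi_boxes \<subseteq> {S. open S}"
    unfolding eq using topological_basis_open[OF B(2)] by (auto intro!: open_Inter)
  have "sets borel = sigma_sets UNIV B"
    unfolding borel_eq_countable_basis[OF B] by (rule sets_measure_of) simp
  moreover have "sigma_sets UNIV B \<subseteq> sigma_sets UNIV pi_boxes"
    using sub by (rule sigma_sets_subseteq)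
  moreover have "sigma_sets UNIV pi_boxes \<subseteq> sets borel"
    unfolding borel_def using op by (auto intro!: sigma_sets_subseteq)
  ultimately show "sets borel = sigma_sets UNIV pi_boxes" by auto
qed

lemma sets_D_measure: "A \<in> sets D_measure \<longleftrightarrow> (\<exists>B\<in>sets borel. A = B \<inter> ({0<..<1} \<times> {0<..<1}))"
  by (auto simp: D_measure_def sets_restrict_space)

lemma borel_measurable_D_measure: "f \<in> borel_measurable borel \<Longrightarrow> f \<in> borel_measurable D_measure"
  unfolding D_measure_def by (intro measurable_restrict_space1) simp

definition L2D_ind :: "(real \<times> real) set \<Rightarrow> L2D" where
  "L2D_ind A = abs_L2D (indicator A)"

lemma sq_integrable_indicator: "A \<in> sets borel \<Longrightarrow> sq_integrable (indicator A)"
  by (rule sq_integrable_bounded[where K = 1])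
    (auto intro!: borel_measurable_D_measure simp: indicator_def)

lemma L2D_plus_abs:
  assumes "sq_integrable f" "sq_integrable g"
  shows "abs_L2D f + abs_L2D g = abs_L2D (\<lambda>p. f p + g p)"
  using assms by (intro plus_L2D.abs_eq) (auto simp: l2_rel_def)

lemma L2D_scaleR_abs:
  assumes "sq_integrable f"
  shows "c *\<^sub>R abs_L2D f = abs_L2D (\<lambda>p. c * f p)"
  using assms by (intro scaleR_L2D.abs_eq) (auto simp: l2_rel_def)

lemma abs_L2D_dominated:
  assumes f: "sq_integrable f" and s: "\<And>i. sq_integrable (s i)"
    and lim: "\<And>p. p \<in> space D_measure \<Longrightarrow> (\<lambda>i. s i p) \<longlonglongrightarrow> f p"
    and bound: "\<And>i p. p \<in> space D_measure \<Longrightarrow> \<bar>s i p\<bar> \<le> 2 * \<bar>f p\<bar>"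
  shows "(\<lambda>i. abs_L2D (s i)) \<longlonglongrightarrow> abs_L2D f"
proof -
  have [measurable]: "f \<in> borel_measurable D_measure" "s i \<in> borel_measurable D_measure" for i
    using f s by (auto simp: sq_integrable_def)
  have sq: "(norm (abs_L2D (s i) - abs_L2D f))\<^sup>2 = (LINT p|D_measure. (s i p - f p)\<^sup>2)" for i
  proof -
    have "ennreal ((norm (abs_L2D (s i) - abs_L2D f))\<^sup>2) = ennreal (LINT p|D_measure. (s i p - f p)\<^sup>2)"
      unfolding L2D_minus_abs[OF s f] L2D_norm_abs[OF sq_integrable_diff[OF s f]]
      using sq_integrable_diff[OF s[of i] f]
      by (intro nn_integral_eq_integral) (auto simp: sq_integrable_def)
    then show ?thesis by (subst (asm) ennreal_inj) auto
  qed
  have "(\<lambda>i. LINT p|D_measure. (s i p - f p)\<^sup>2) \<longlonglongrightarrow> (LINT p|D_measure. 0)"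
  proof (rule integral_dominated_convergence[where w = "\<lambda>p. 9 * (f p)\<^sup>2"])
    show "integrable D_measure (\<lambda>p. 9 * (f p)\<^sup>2)" using f by (simp add: sq_integrable_def)
    show "AE p in D_measure. (\<lambda>i. (s i p - f p)\<^sup>2) \<longlonglongrightarrow> 0"
    proof (rule AE_I2)
      fix p assume "p \<in> space D_measure"
      from tendsto_power[OF tendsto_diff[OF lim[OF this] tendsto_const[of "f p"]], of 2]
      show "(\<lambda>i. (s i p - f p)\<^sup>2) \<longlonglongrightarrow> 0" by simp
    qed
    show "AE p in D_measure. norm ((s i p - f p)\<^sup>2) \<le> 9 * (f p)\<^sup>2" for i
    proof (rule AE_I2)
      fix p assume "p \<in> space D_measure"
      then have "\<bar>s i p - f p\<bar> \<le> 3 * \<bar>f p\<bar>" using bound[of p i] by linarith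
      then have "\<bar>s i p - f p\<bar>\<^sup>2 \<le> (3 * \<bar>f p\<bar>)\<^sup>2" by (intro power_mono) auto
      then show "norm ((s i p - f p)\<^sup>2) \<le> 9 * (f p)\<^sup>2" by (simp add: power_mult_distrib)
    qed
  qed auto
  then have "(\<lambda>i. sqrt ((norm (abs_L2D (s i) - abs_L2D f))\<^sup>2)) \<longlonglongrightarrow> sqrt 0"
    unfolding sq by (intro tendsto_real_sqrt) simp
  then show ?thesis
    by (simp add: tendsto_norm_zero_iff LIM_zero_iff)
qed

definition L2D_simple :: "L2D set" where
  "L2D_simple = (\<lambda>xs. \<Sum>(q, A)\<leftarrow>xs. q *\<^sub>R L2D_ind A) ` lists (\<rat> \<times> pi_boxes)"

lemma countable_L2D_simple: "countable L2D_simple"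
  unfolding L2D_simple_def
  by (intro countable_image countable_lists countable_SIGMA countable_rat countable_pi_boxes)

lemma L2D_simple_add: "u \<in> L2D_simple \<Longrightarrow> v \<in> L2D_simple \<Longrightarrow> u + v \<in> L2D_simple"
  unfolding L2D_simple_def
  apply (elim imageE)
  subgoal for xs ys
    by (rule image_eqI[of _ _ "xs @ ys"]) auto
  done

lemma L2D_simple_scale: "u \<in> L2D_simple \<Longrightarrow> q \<in> \<rat> \<Longrightarrow> q *\<^sub>R u \<in> L2D_simple"
  unfolding L2D_simple_def
proof (elim imageE)
  fix xs assume q: "q \<in> \<rat>" and u: "u = (\<Sum>(r, A)\<leftarrow>xs. r *\<^sub>R L2D_ind A)" and xs: "xs \<in> lists (\<rat> \<times> pi_boxes)"
  have "q *\<^sub>R (\<Sum>(r, A)\<leftarrow>xs. r *\<^sub>R L2D_ind A) = (\<Sum>(r, A)\<leftarrow>map (\<lambda>(r, A). (q * r, A)) xs. r *\<^sub>R L2D_ind A)"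
    by (induction xs) (auto simp: scaleR_add_right)
  moreover have "map (\<lambda>(r, A). (q * r, A)) xs \<in> lists (\<rat> \<times> pi_boxes)"
    using xs q by (induction xs) auto
  ultimately show "q *\<^sub>R u \<in> (\<lambda>xs. \<Sum>(q, A)\<leftarrow>xs. q *\<^sub>R L2D_ind A) ` lists (\<rat> \<times> pi_boxes)"
    using u by blast
qed

lemma closure_L2D_simple_add:
  assumes "u \<in> closure L2D_simple" "v \<in> closure L2D_simple"
  shows "u + v \<in> closure L2D_simple"
proof -
  from assms obtain a b where "\<And>n. a n \<in> L2D_simple" "a \<longlonglongrightarrow> u" "\<And>n. b n \<in> L2D_simple" "b \<longlonglongrightarrow> v"
    unfolding closure_sequential by blast
  then show ?thesis
    unfolding closure_sequential
    by (intro exI[of _ "\<lambda>n. a n + b n"] conjI allI L2D_simple_add tendsto_add)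
qed

lemma closure_L2D_simple_scale:
  assumes "u \<in> closure L2D_simple"
  shows "c *\<^sub>R u \<in> closure L2D_simple"
proof -
  from assms obtain a where "\<And>n. a n \<in> L2D_simple" "a \<longlonglongrightarrow> u"
    unfolding closure_sequential by blast
  moreover have "c \<in> closure \<rat>"
    unfolding closure_approachable dist_real_def by (metis rational_approximation)
  then obtain q where "\<And>n. q n \<in> \<rat>" "q \<longlonglongrightarrow> c"
    unfolding closure_sequential by blast
  ultimately show ?thesis
    unfolding closure_sequential
    by (intro exI[of _ "\<lambda>n. q n *\<^sub>R a n"] conjI allI L2D_simple_scale tendsto_scaleR)
qed

lemma L2D_ind_closure:
  assumes "A \<in> sets borel"
  shows "L2D_ind A \<in> closure L2D_simple"
proof -
  have basic: "L2D_ind A \<in> closure L2D_simple" if "A \<in> pi_boxes" for A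
  proof -
    have "L2D_ind A \<in> L2D_simple"
      unfolding L2D_simple_def using that by (intro image_eqI[of _ _ "[(1, A)]"]) auto
    then show ?thesis using closure_subset by blast
  qed
  have univ: "UNIV \<in> pi_boxes"
    unfolding pi_boxes_def by (rule image_eqI[of _ _ "{}"]) auto
  have borel: "A \<in> sets borel" if "A \<in> sigma_sets UNIV pi_boxes" for A
    using that sets_borel_pi_boxes by simp
  have Pow: "pi_boxes \<subseteq> Pow UNIV" by simp
  from assms have "A \<in> sigma_sets UNIV pi_boxes" by (simp add: sets_borel_pi_boxes)
  from Int_stable_pi_boxes Pow this show ?thesis
  proof (induction rule: sigma_sets_induct_disjoint)
    case (basic A) then show ?case by (rule \<open>\<And>A. A \<in> pi_boxes \<Longrightarrow> L2D_ind A \<in> closure L2D_simple\<close>)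
  next
    case empty
    have "0 *\<^sub>R L2D_ind UNIV \<in> closure L2D_simple" by (intro closure_L2D_simple_scale basic univ)
    moreover have "0 *\<^sub>R L2D_ind UNIV = L2D_ind {}"
      unfolding L2D_ind_def by (simp add: zero_L2D_def indicator_def[abs_def])
    ultimately show ?case by simp
  next
    case (compl A)
    have "L2D_ind UNIV + (-1) *\<^sub>R L2D_ind A \<in> closure L2D_simple"
      by (intro closure_L2D_simple_add closure_L2D_simple_scale basic univ compl)
    moreover have "L2D_ind UNIV + (-1) *\<^sub>R L2D_ind A = L2D_ind (UNIV - A)"
    proof -
      have "indicator UNIV p - indicator A p = (indicator (UNIV - A) p :: real)" for p
        by (simp add: indicator_def)
      then show ?thesis
        using L2D_minus_abs[OF sq_integrable_indicator sq_integrable_indicator, of UNIV A] borel[OF compl(1)]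
        unfolding L2D_ind_def by simp
    qed
    ultimately show ?case by simp
  next
    case (union A)
    then have [measurable]: "A i \<in> sets borel" for i using borel by auto
    have "L2D_ind (\<Union>i<n. A i) \<in> closure L2D_simple" for n
    proof (induction n)
      case 0
      have "0 *\<^sub>R L2D_ind UNIV \<in> closure L2D_simple" by (intro closure_L2D_simple_scale basic univ)
      moreover have "0 *\<^sub>R L2D_ind UNIV = L2D_ind {}"
        unfolding L2D_ind_def by (simp add: zero_L2D_def indicator_def[abs_def])
      ultimately show ?case by simp
    next
      case (Suc n)
      have disj: "(\<Union>i<n. A i) \<inter> A n = {}"
        using union(1) unfolding disjoint_family_on_def by (fastforce dest: less_imp_neq)
      have "(\<Union>i<Suc n. A i) = (\<Union>i<n. A i) \<union> A n" by (auto simp: less_Suc_eq)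
      then have "L2D_ind (\<Union>i<Suc n. A i) = L2D_ind (\<Union>i<n. A i) + L2D_ind (A n)"
      proof -
        have "indicator (\<Union>i<n. A i) p + indicator (A n) p = (indicator ((\<Union>i<n. A i) \<union> A n) p :: real)" for p
          using disj by (auto simp: indicator_def)
        then show ?thesis
          using L2D_plus_abs[OF sq_integrable_indicator sq_integrable_indicator, of "\<Union>i<n. A i" "A n"]
          unfolding L2D_ind_def \<open>(\<Union>i<Suc n. A i) = _\<close> by (simp only:) simp
      qed
      then show ?case using Suc union(3) by (simp add: closure_L2D_simple_add)
    qed
    moreover have "(\<lambda>n. L2D_ind (\<Union>i<n. A i)) \<longlonglongrightarrow> L2D_ind (\<Union>i. A i)"
      unfolding L2D_ind_def
    proof (rule abs_L2D_dominated)
      show "(\<lambda>n. indicator (\<Union>i<n. A i) p :: real) \<longlonglongrightarrow> indicator (\<Union>i. A i) p" for p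
        by (rule LIMSEQ_indicator_UN)
    qed (auto simp: sq_integrable_indicator indicator_def)
    ultimately show ?case
      by (rule closed_sequentially[OF closed_closure])
  qed
qed

lemma closure_L2D_simple: "closure L2D_simple = UNIV"
proof -
  have "u \<in> closure L2D_simple" for u
  proof -
    obtain f where f: "sq_integrable f" and u: "u = abs_L2D f" by (rule L2D_abs_cases)
    then have [measurable]: "f \<in> borel_measurable D_measure" by (simp add: sq_integrable_def)
    have ind: "abs_L2D (indicator A) \<in> closure L2D_simple" if "A \<in> sets D_measure" for A
    proof -
      from that obtain B where B: "B \<in> sets borel" and A: "A = B \<inter> ({0<..<1} \<times> {0<..<1})"
        by (auto simp: sets_D_measure)
      have "A \<in> sets borel" unfolding A D_measure_square using B by auto
      then show ?thesis using L2D_ind_closure unfolding L2D_ind_def by blast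
    qed
    have indm: "sq_integrable (indicator A)" if "A \<in> sets D_measure" for A
      using that by (intro sq_integrable_bounded[where K = 1]) (auto simp: indicator_def)
    from borel_measurable_implies_sequence_metric[OF \<open>f \<in> borel_measurable D_measure\<close>, of 0] obtain s where
      s: "\<And>i. simple_function D_measure (s i)"
        "\<And>p. p \<in> space D_measure \<Longrightarrow> (\<lambda>i. s i p) \<longlonglongrightarrow> f p"
        "\<And>i p. p \<in> space D_measure \<Longrightarrow> dist (s i p) 0 \<le> 2 * dist (f p) 0"
      by blast
    have fin: "finite (s i ` space D_measure)" for i
      using s(1) by (simp add: simple_function_def)
    have pre: "s i -` {y} \<inter> space D_measure \<in> sets D_measure" for i y
      using s(1)[of i] by (rule simple_functionD)
    define t where "t i p = (\<Sum>y\<in>s i ` space D_measure. y * indicator (s i -` {y} \<inter> space D_measure) p)" for i p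
    have ts: "t i p = s i p" if "p \<in> space D_measure" for i p
    proof -
      have "t i p = (\<Sum>y\<in>s i ` space D_measure. if y = s i p then y else 0)"
        unfolding t_def using that by (intro sum.cong) (auto simp: indicator_def)
      also have "\<dots> = s i p" using that fin by simp
      finally show ?thesis .
    qed
    have fin_sum: "sq_integrable (\<lambda>p. \<Sum>y\<in>Y. y * indicator (A y) p) \<and>
        abs_L2D (\<lambda>p. \<Sum>y\<in>Y. y * indicator (A y) p) \<in> closure L2D_simple"
      if "finite Y" "\<And>y. A y \<in> sets D_measure" for Y :: "real set" and A
      using that(1)
    proof induction
      case empty
      have "0 *\<^sub>R abs_L2D (indicator {}) \<in> closure L2D_simple"
        by (intro closure_L2D_simple_scale ind) simp
      then show ?case by (simp add: zero_L2D_def sq_integrable_def)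
    next
      case (insert y Y)
      let ?g = "\<lambda>p. y * indicator (A y) p"
      let ?h = "\<lambda>p. \<Sum>y\<in>Y. y * indicator (A y) p"
      have g: "sq_integrable ?g" by (intro sq_integrable_scale indm that)
      have "abs_L2D ?g + abs_L2D ?h \<in> closure L2D_simple"
        using insert.IH closure_L2D_simple_scale[OF ind[OF that(2)], of y y]
        by (intro closure_L2D_simple_add) (simp_all only: L2D_scaleR_abs[OF indm[OF that(2)]])
      moreover have "(\<lambda>p. \<Sum>z\<in>insert y Y. z * indicator (A z) p) = (\<lambda>p. ?g p + ?h p)"
        by (intro ext sum.insert insert.hyps)
      ultimately show ?case
        using sq_integrable_add[OF g conjunct1[OF insert.IH]] L2D_plus_abs[OF g conjunct1[OF insert.IH]]
        by (simp only:)
    qed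
    have t: "sq_integrable (t i)" "abs_L2D (t i) \<in> closure L2D_simple" for i
      using fin_sum[OF fin pre] unfolding t_def[abs_def] by auto
    have "(\<lambda>i. abs_L2D (t i)) \<longlonglongrightarrow> abs_L2D f"
    proof (rule abs_L2D_dominated[OF f t(1)])
      show "(\<lambda>i. t i p) \<longlonglongrightarrow> f p" "\<bar>t i p\<bar> \<le> 2 * \<bar>f p\<bar>" if "p \<in> space D_measure" for i p
        using s(2,3)[OF that] ts[OF that] by simp_all
    qed
    then show ?thesis
      unfolding u by (rule closed_sequentially[OF closed_closure t(2)])
  qed
  then show ?thesis by blast
qed

instance L2D :: second_countable_topology
proof
  define B where "B = (\<lambda>(u, n). ball u (1 / Suc n)) ` (L2D_simple \<times> (UNIV :: nat set))"
  have "countable B"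
    unfolding B_def by (intro countable_image countable_SIGMA countable_L2D_simple) auto
  moreover have "topological_basis B"
  proof (rule topological_basisI)
    show "open b" if "b \<in> B" for b using that by (auto simp: B_def)
  next
    fix U and x :: L2D assume "open U" "x \<in> U"
    then obtain e where e: "e > 0" "ball x e \<subseteq> U" by (meson open_contains_ball)
    obtain n where n: "1 / real (Suc n) < e / 2"
      using e(1) nat_approx_posE[of "e/2"] by (metis half_gt_zero)
    have "x \<in> closure L2D_simple" by (simp add: closure_L2D_simple)
    moreover have "0 < 1 / real (Suc n)" by simp
    ultimately obtain u where u: "u \<in> L2D_simple" "dist u x < 1 / Suc n"
      unfolding closure_approachable by blast
    have "ball u (1 / Suc n) \<subseteq> U"
    proof (rule order_trans[OF _ e(2)], rule subsetI)
      fix y assume "y \<in> ball u (1 / Suc n)"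
      then have "dist x y < 1 / Suc n + 1 / Suc n"
        using u(2) dist_triangle[of x y u] by (simp add: dist_commute)
      then show "y \<in> ball x e" using n by simp
    qed
    moreover have "x \<in> ball u (1 / Suc n)" using u(2) by simp
    moreover have "ball u (1 / Suc n) \<in> B"
      unfolding B_def using u(1) by (intro image_eqI[of _ _ "(u, n)"]) simp_all
    ultimately show "\<exists>B'\<in>B. x \<in> B' \<and> B' \<subseteq> U" by (intro bexI[of _ "ball u (1 / Suc n)"] conjI)
  qed
  ultimately show "\<exists>B :: L2D set set. countable B \<and> open = generate_topology B"
    using topological_basis_imp_subbasis[of B] by (intro exI[of _ B] conjI)
qed

text \<open>
  The weight is bounded above and away from zero on the unit square, so the weighted inner product
  \<open>H_inner \<kappa> \<eta>\<close> induces a norm equivalent to the norm of \<^typ>\<open>L2D\<close>. Hence \<^typ>\<open>L2D\<close> carries the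
  topology of \<open>\<H>\<close>, and convergence, Borel sets and Bochner integrals are those of \<open>\<H>\<close>; only the
  coordinates depend on which inner product is used.
\<close>

lift_definition H_inner :: "real \<Rightarrow> real \<Rightarrow> L2D \<Rightarrow> L2D \<Rightarrow> real" is
  "\<lambda>\<kappa> \<eta> f g. LINT p|D_measure. f p * g p * exp (\<kappa> * fst p + \<eta> * snd p)"
proof -
  fix \<kappa> \<eta> :: real and f f' g g' assume "l2_rel f f'" "l2_rel g g'"
  moreover have "(\<lambda>p. exp (\<kappa> * fst p + \<eta> * snd p)) \<in> borel_measurable D_measure"
    by (intro borel_measurable_D_measure borel_measurable_continuous_onI continuous_intros)
  ultimately show "(LINT p|D_measure. f p * g p * exp (\<kappa> * fst p + \<eta> * snd p))
      = (LINT p|D_measure. f' p * g' p * exp (\<kappa> * fst p + \<eta> * snd p))"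
    by (auto simp: l2_rel_def sq_integrable_def intro!: integral_cong_AE)
qed

definition modes :: "(nat \<times> nat) set" where
  "modes = {1..} \<times> {1..}"

definition mu :: "nat \<times> nat \<Rightarrow> real" where
  "mu l = pi\<^sup>2 * ((real (fst l))\<^sup>2 + (real (snd l))\<^sup>2)"

definition lam :: "real \<Rightarrow> real \<Rightarrow> nat \<times> nat \<Rightarrow> real" where
  "lam \<kappa> \<eta> l = mu l + (\<kappa>\<^sup>2 + \<eta>\<^sup>2) / 4"

definition e_fun :: "real \<Rightarrow> real \<Rightarrow> nat \<times> nat \<Rightarrow> real \<times> real \<Rightarrow> real" where
  "e_fun \<kappa> \<eta> l = (\<lambda>(y, z). 2 * sin (pi * real (fst l) * y) * sin (pi * real (snd l) * z)
     * exp (- (\<kappa> * y + \<eta> * z) / 2))"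

lift_definition e_vec :: "real \<Rightarrow> real \<Rightarrow> nat \<times> nat \<Rightarrow> L2D" is e_fun
proof -
  fix \<kappa> \<eta> :: real and l :: "nat \<times> nat"
  have "sq_integrable (e_fun \<kappa> \<eta> l)"
  proof (rule sq_integrable_bounded)
    show "e_fun \<kappa> \<eta> l \<in> borel_measurable D_measure"
      unfolding e_fun_def case_prod_beta
      by (intro borel_measurable_D_measure borel_measurable_continuous_onI continuous_intros) auto
    fix p assume "p \<in> space D_measure"
    then obtain y z where p: "p = (y, z)" and yz: "0 < y" "y < 1" "0 < z" "z < 1"
      by (auto simp: space_D_measure)
    have "\<bar>\<kappa> * y\<bar> \<le> \<bar>\<kappa>\<bar> * 1" "\<bar>\<eta> * z\<bar> \<le> \<bar>\<eta>\<bar> * 1"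
      using yz unfolding abs_mult by (intro mult_left_mono; simp)+
    then have "exp (- (\<kappa> * y + \<eta> * z) / 2) \<le> exp (\<bar>\<kappa>\<bar> + \<bar>\<eta>\<bar>)" by simp
    moreover have "\<bar>sin (pi * real (fst l) * y)\<bar> * \<bar>sin (pi * real (snd l) * z)\<bar> \<le> 1 * 1"
      by (intro mult_mono abs_sin_le_one) auto
    ultimately have "(\<bar>sin (pi * real (fst l) * y)\<bar> * \<bar>sin (pi * real (snd l) * z)\<bar>)
        * exp (- (\<kappa> * y + \<eta> * z) / 2) \<le> (1 * 1) * exp (\<bar>\<kappa>\<bar> + \<bar>\<eta>\<bar>)"
      by (intro mult_mono) auto
    then show "\<bar>e_fun \<kappa> \<eta> l p\<bar> \<le> 2 * exp (\<bar>\<kappa>\<bar> + \<bar>\<eta>\<bar>)"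
      by (simp add: p e_fun_def abs_mult)
  qed
  then show "l2_rel (e_fun \<kappa> \<eta> l) (e_fun \<kappa> \<eta> l)" by (simp add: l2_rel_def)
qed

lemma exp_weight_deriv:
  "((\<lambda>y. exp (- (\<kappa> * y + \<eta> * z) / 2)) has_real_derivative - \<kappa> / 2 * exp (- (\<kappa> * y + \<eta> * z) / 2)) (at y)"
  "((\<lambda>z. exp (- (\<kappa> * y + \<eta> * z) / 2)) has_real_derivative - \<eta> / 2 * exp (- (\<kappa> * y + \<eta> * z) / 2)) (at z)"
  by (rule derivative_eq_intros refl | simp)+

lemma sin_weight_deriv:
  fixes E :: "real \<Rightarrow> real"
  assumes "(E has_real_derivative - k / 2 * E s) (at s)"
  shows "((\<lambda>s. c * sin (a * s) * d * E s) has_real_derivative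
      c * d * E s * (a * cos (a * s) - k / 2 * sin (a * s))) (at s)"
    and "((\<lambda>s. c * d * E s * (a * cos (a * s) - k / 2 * sin (a * s))) has_real_derivative
      c * d * E s * (- (a * a) * sin (a * s) - k * (a * cos (a * s)) + k * k / 4 * sin (a * s))) (at s)"
  by (auto intro!: derivative_eq_intros assms simp: field_simps)

lemma e_fun_deriv1:
  "((\<lambda>y. e_fun \<kappa> \<eta> l (y, z)) has_real_derivative
     2 * sin (pi * real (snd l) * z) * exp (- (\<kappa> * y + \<eta> * z) / 2)
       * (pi * real (fst l) * cos (pi * real (fst l) * y) - \<kappa> / 2 * sin (pi * real (fst l) * y))) (at y)"
  unfolding e_fun_def prod.case by (rule sin_weight_deriv(1)) (rule exp_weight_deriv)

lemma e_fun_deriv2: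
  "((\<lambda>z. e_fun \<kappa> \<eta> l (y, z)) has_real_derivative
     2 * sin (pi * real (fst l) * y) * exp (- (\<kappa> * y + \<eta> * z) / 2)
       * (pi * real (snd l) * cos (pi * real (snd l) * z) - \<eta> / 2 * sin (pi * real (snd l) * z))) (at z)"
  using sin_weight_deriv(1)[OF exp_weight_deriv(2), of "2 * sin (pi * real (fst l) * y)" "pi * real (snd l)" 1]
  unfolding e_fun_def prod.case by simp

text \<open>
  The eigenvalue relation \<open>\<A> e\<^sub>l = \<lambda>\<^sub>l e\<^sub>l\<close>, with \<open>-\<A> = \<partial>\<^sub>y\<^sup>2 + \<partial>\<^sub>z\<^sup>2 + \<kappa> \<partial>\<^sub>y + \<eta> \<partial>\<^sub>z\<close>, and the Dirichlet
  boundary condition.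
\<close>

lemma e_fun_eigenfunction:
  "deriv (deriv (\<lambda>s. e_fun \<kappa> \<eta> l (s, z))) y + deriv (deriv (\<lambda>s. e_fun \<kappa> \<eta> l (y, s))) z
     + \<kappa> * deriv (\<lambda>s. e_fun \<kappa> \<eta> l (s, z)) y + \<eta> * deriv (\<lambda>s. e_fun \<kappa> \<eta> l (y, s)) z
   = - (lam \<kappa> \<eta> l * e_fun \<kappa> \<eta> l (y, z))"
proof -
  let ?a = "pi * real (fst l)" and ?b = "pi * real (snd l)"
  let ?E = "exp (- (\<kappa> * y + \<eta> * z) / 2)"
  have d1: "deriv (\<lambda>s. e_fun \<kappa> \<eta> l (s, z)) = (\<lambda>y. 2 * sin (?b * z) * exp (- (\<kappa> * y + \<eta> * z) / 2)
      * (?a * cos (?a * y) - \<kappa> / 2 * sin (?a * y)))"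
    by (rule ext, rule DERIV_imp_deriv, rule e_fun_deriv1)
  have d2: "deriv (\<lambda>s. e_fun \<kappa> \<eta> l (y, s)) = (\<lambda>z. 2 * sin (?a * y) * exp (- (\<kappa> * y + \<eta> * z) / 2)
      * (?b * cos (?b * z) - \<eta> / 2 * sin (?b * z)))"
    by (rule ext, rule DERIV_imp_deriv, rule e_fun_deriv2)
  have "deriv (deriv (\<lambda>s. e_fun \<kappa> \<eta> l (s, z))) y = 2 * sin (?b * z) * ?E
      * (- (?a * ?a) * sin (?a * y) - \<kappa> * (?a * cos (?a * y)) + \<kappa> * \<kappa> / 4 * sin (?a * y))"
    unfolding d1 by (rule DERIV_imp_deriv, rule sin_weight_deriv(2)) (rule exp_weight_deriv)
  moreover have "deriv (deriv (\<lambda>s. e_fun \<kappa> \<eta> l (y, s))) z = 2 * sin (?a * y) * ?E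
      * (- (?b * ?b) * sin (?b * z) - \<eta> * (?b * cos (?b * z)) + \<eta> * \<eta> / 4 * sin (?b * z))"
    unfolding d2 by (rule DERIV_imp_deriv, rule sin_weight_deriv(2)) (rule exp_weight_deriv)
  moreover have "e_fun \<kappa> \<eta> l (y, z) = 2 * sin (?a * y) * sin (?b * z) * ?E" by (simp add: e_fun_def)
  moreover have "lam \<kappa> \<eta> l = ?a * ?a + ?b * ?b + (\<kappa> * \<kappa> + \<eta> * \<eta>) / 4"
    by (simp add: lam_def mu_def power2_eq_square algebra_simps)
  moreover have "2 * sb * E * (- (a * a) * sa - \<kappa> * (a * ca) + \<kappa> * \<kappa> / 4 * sa)
      + 2 * sa * E * (- (b * b) * sb - \<eta> * (b * cb) + \<eta> * \<eta> / 4 * sb)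
      + \<kappa> * (2 * sb * E * (a * ca - \<kappa> / 2 * sa)) + \<eta> * (2 * sa * E * (b * cb - \<eta> / 2 * sb))
      = - ((a * a + b * b + (\<kappa> * \<kappa> + \<eta> * \<eta>) / 4) * (2 * sa * sb * E))" for a b sa ca sb cb E :: real
    by (simp add: field_simps)
  ultimately show ?thesis
    by (simp only: d1 d2)
qed

lemma e_fun_boundary:
  "e_fun \<kappa> \<eta> l (0, z) = 0" "e_fun \<kappa> \<eta> l (1, z) = 0" "e_fun \<kappa> \<eta> l (y, 0) = 0" "e_fun \<kappa> \<eta> l (y, 1) = 0"
  by (simp_all add: e_fun_def mult.commute[of pi])

text \<open>
  \<open>e\<^bsup>-t\<A>\<^esup>\<close> through the eigensystem \<open>\<A> e\<^sub>l = \<lambda>\<^sub>l e\<^sub>l\<close>; the series converges in \<open>\<H>\<close> for \<open>t \<ge> 0\<close>.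
\<close>

definition dirichlet_semigroup :: "real \<Rightarrow> real \<Rightarrow> real \<Rightarrow> L2D \<Rightarrow> L2D" where
  "dirichlet_semigroup \<kappa> \<eta> t u =
     (\<Sum>\<^sub>\<infinity>l\<in>modes. (exp (- t * lam \<kappa> \<eta> l) * H_inner \<kappa> \<eta> u (e_vec \<kappa> \<eta> l)) *\<^sub>R e_vec \<kappa> \<eta> l)"

text \<open>The squared \<open>\<L>\<^sup>2\<^sub>\<beta>\<close>-norm of an element of \<open>\<H>\<close>; it is \<open>\<infinity>\<close> off \<open>\<L>\<^sup>2\<^sub>\<beta>\<close>.\<close>

definition L2_norm_sq :: "real \<Rightarrow> real \<Rightarrow> real \<Rightarrow> real \<Rightarrow> L2D \<Rightarrow> ennreal" where
  "L2_norm_sq \<kappa> \<eta> \<alpha> \<beta> u =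
     (\<Sum>\<^sub>\<infinity>l\<in>modes. ennreal (mu l powr (- \<alpha> * \<beta>) * (H_inner \<kappa> \<eta> u (e_vec \<kappa> \<eta> l))\<^sup>2))"

definition stochastic_basis :: "'w measure \<Rightarrow> (real \<Rightarrow> 'w measure) \<Rightarrow> bool" where
  "stochastic_basis M F \<longleftrightarrow> prob_space M
     \<and> (\<forall>t\<ge>0. subalgebra M (F t))
     \<and> (\<forall>s t. 0 \<le> s \<and> s \<le> t \<longrightarrow> sets (F s) \<subseteq> sets (F t))
     \<and> (\<forall>t\<ge>0. sets (F t) = (\<Inter>s\<in>{t<..}. sets (F s)))
     \<and> (\<forall>N\<in>null_sets M. \<forall>A\<subseteq>N. A \<in> sets (F 0))"

definition brownian_motion :: "'w measure \<Rightarrow> (real \<Rightarrow> 'w measure) \<Rightarrow> (real \<Rightarrow> 'w \<Rightarrow> real) \<Rightarrow> bool" where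
  "brownian_motion M F w \<longleftrightarrow>
     (\<forall>t\<ge>0. w t \<in> borel_measurable (F t))
     \<and> (AE \<omega> in M. w 0 \<omega> = 0)
     \<and> (AE \<omega> in M. continuous_on {0..} (\<lambda>t. w t \<omega>))
     \<and> (\<forall>s t. 0 \<le> s \<and> s < t \<longrightarrow>
          distributed M lborel (\<lambda>\<omega>. w t \<omega> - w s \<omega>) (normal_density 0 (sqrt (t - s)))
          \<and> prob_space.indep_set M (sets (F s))
               (sets (vimage_algebra (space M) (\<lambda>\<omega>. w t \<omega> - w s \<omega>) borel)))"

text \<open>
  Wiener integral of a deterministic function \<open>\<phi> \<in> L\<^sup>2([0,t])\<close> with values in a Banach space: the
  mean square limit of the integrals of step functions approximating \<open>\<phi>\<close>. A list of triples
  \<open>(a, b, c)\<close> stands for the step function \<open>\<Sum> c 1\<^bsub>(a,b]\<^esub>\<close>.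
\<close>

definition step_fun :: "(real \<times> real \<times> 'b::real_normed_vector) list \<Rightarrow> real \<Rightarrow> 'b" where
  "step_fun ps s = (\<Sum>(a, b, c)\<leftarrow>ps. indicat_real {a<..b} s *\<^sub>R c)"

definition step_integral ::
  "(real \<Rightarrow> 'w \<Rightarrow> real) \<Rightarrow> (real \<times> real \<times> 'b::real_normed_vector) list \<Rightarrow> 'w \<Rightarrow> 'b" where
  "step_integral w ps \<omega> = (\<Sum>(a, b, c)\<leftarrow>ps. (w b \<omega> - w a \<omega>) *\<^sub>R c)"

definition has_wiener_integral :: "'w measure \<Rightarrow> (real \<Rightarrow> 'w \<Rightarrow> real) \<Rightarrow> real
    \<Rightarrow> (real \<Rightarrow> 'b::{banach, second_countable_topology}) \<Rightarrow> ('w \<Rightarrow> 'b) \<Rightarrow> bool" where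
  "has_wiener_integral M w t \<phi> I \<longleftrightarrow>
     \<phi> \<in> borel_measurable (restrict_space lborel {0..t}) \<and> I \<in> borel_measurable M \<and>
     (\<exists>ps :: nat \<Rightarrow> (real \<times> real \<times> 'b) list.
        (\<forall>n. \<forall>(a, b, c)\<in>set (ps n). 0 \<le> a \<and> a \<le> b \<and> b \<le> t) \<and>
        (\<lambda>n. \<integral>\<^sup>+s\<in>{0..t}. ennreal ((norm (\<phi> s - step_fun (ps n) s))\<^sup>2) \<partial>lborel) \<longlonglongrightarrow> 0 \<and>
        (\<lambda>n. \<integral>\<^sup>+\<omega>. ennreal ((norm (I \<omega> - step_integral w (ps n) \<omega>))\<^sup>2) \<partial>M) \<longlonglongrightarrow> 0)"

text \<open>
  \<open>Z = \<integral>\<^sub>0\<^sup>t \<Phi>(s) dW\<^sup>Q\<^sub>s\<close> for a deterministic operator-valued \<open>\<Phi>\<close> and the formal series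
  \<open>W\<^sup>Q\<^sub>t = \<Sum>\<^sub>l \<mu>\<^sub>l\<^bsup>-\<alpha>/2\<^esup> w\<^sub>l(t) e\<^sub>l\<close>, which need not converge in \<open>\<H>\<close> itself: the integral is
  \<open>\<Sum>\<^sub>l \<mu>\<^sub>l\<^bsup>-\<alpha>/2\<^esup> \<integral>\<^sub>0\<^sup>t \<Phi>(s) e\<^sub>l dw\<^sub>l(s)\<close>, convergent in \<open>L\<^sup>2(\<Omega>; \<H>)\<close>.
\<close>

definition has_WQ_integral :: "'w measure \<Rightarrow> real \<Rightarrow> real \<Rightarrow> real \<Rightarrow> (nat \<times> nat \<Rightarrow> real \<Rightarrow> 'w \<Rightarrow> real)
    \<Rightarrow> real \<Rightarrow> (real \<Rightarrow> L2D \<Rightarrow> L2D) \<Rightarrow> ('w \<Rightarrow> L2D) \<Rightarrow> bool" where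
  "has_WQ_integral M \<kappa> \<eta> \<alpha> w t \<Phi> Z \<longleftrightarrow> Z \<in> borel_measurable M \<and>
     (\<exists>J. (\<forall>l\<in>modes. has_wiener_integral M (w l) t (\<lambda>s. \<Phi> s (e_vec \<kappa> \<eta> l)) (J l)) \<and>
        ((\<lambda>L. \<integral>\<^sup>+\<omega>. ennreal ((norm (Z \<omega> - (\<Sum>l\<in>L. mu l powr (- \<alpha> / 2) *\<^sub>R J l \<omega>)))\<^sup>2) \<partial>M)
           \<longlongrightarrow> 0) (finite_subsets_at_top modes))"

text \<open>
  The drift integral is a Bochner integral in \<open>\<H>\<close>; since the Bochner integral of a non-integrable
  function is \<open>0\<close> by convention, its existence is part of the equation.
\<close>

definition mild_solution :: "'w measure \<Rightarrow> (real \<Rightarrow> 'w measure) \<Rightarrow> (nat \<times> nat \<Rightarrow> real \<Rightarrow> 'w \<Rightarrow> real)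
    \<Rightarrow> real \<Rightarrow> real \<Rightarrow> real \<Rightarrow> real \<Rightarrow> real \<Rightarrow> real \<Rightarrow> (real \<Rightarrow> 'w \<Rightarrow> L2D) \<Rightarrow> bool" where
  "mild_solution M F w \<kappa> \<eta> \<alpha> \<nu> \<theta>\<^sub>0 \<sigma> X \<longleftrightarrow>
     (\<forall>t\<in>{0..1}. X t \<in> borel_measurable (F t)) \<and>
     (\<lambda>(t, \<omega>). X t \<omega>) \<in> borel_measurable (restrict_space borel {0..1} \<Otimes>\<^sub>M M) \<and>
     (\<forall>t\<in>{0..1}. \<exists>Z. has_WQ_integral M \<kappa> \<eta> \<alpha> w t (\<lambda>s. dirichlet_semigroup \<kappa> \<eta> (\<nu> * (t - s))) Z \<and>
        (AE \<omega> in M.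
           set_integrable lborel {0..t} (\<lambda>s. dirichlet_semigroup \<kappa> \<eta> (\<nu> * (t - s)) (X s \<omega>)) \<and>
           X t \<omega> = dirichlet_semigroup \<kappa> \<eta> (\<nu> * t) (X 0 \<omega>)
             + \<theta>\<^sub>0 *\<^sub>R (LINT s:{0..t}|lborel. dirichlet_semigroup \<kappa> \<eta> (\<nu> * (t - s)) (X s \<omega>))
             + \<sigma> *\<^sub>R Z \<omega>))"

definition mean_L2_norm_sq ::
  "'w measure \<Rightarrow> real \<Rightarrow> real \<Rightarrow> real \<Rightarrow> (real \<Rightarrow> 'w \<Rightarrow> L2D) \<Rightarrow> real \<Rightarrow> ennreal" where
  "mean_L2_norm_sq M \<kappa> \<eta> \<alpha> X \<beta> =
     (\<integral>\<^sup>+t\<in>{0..1}. (\<integral>\<^sup>+\<omega>. L2_norm_sq \<kappa> \<eta> \<alpha> \<beta> (X t \<omega>) \<partial>M) \<partial>lborel)"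

definition R_ratio :: "'w measure \<Rightarrow> real \<Rightarrow> real \<Rightarrow> real \<Rightarrow> (real \<Rightarrow> 'w \<Rightarrow> L2D) \<Rightarrow> real \<Rightarrow> real" where
  "R_ratio M \<kappa> \<eta> \<alpha> X \<beta> = enn2real (mean_L2_norm_sq M \<kappa> \<eta> \<alpha> X \<beta>)
     / sqrt (enn2real (mean_L2_norm_sq M \<kappa> \<eta> \<alpha> X (2 * \<beta> + 1)))"

definition f1 :: "real \<Rightarrow> real" where
  "f1 x = (if x = 0 then 1 else (1 - exp (- x)) / x)"

definition f2 :: "real \<Rightarrow> real" where
  "f2 x = (if x = 0 then 1 / 2 else (x - 1 + exp (- x)) / x\<^sup>2)"

definition f_mode :: "'w measure \<Rightarrow> real \<Rightarrow> real \<Rightarrow> real \<Rightarrow> real \<Rightarrow> ('w \<Rightarrow> L2D) \<Rightarrow> nat \<times> nat \<Rightarrow> real \<Rightarrow> real" where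
  "f_mode M \<kappa> \<eta> \<alpha> \<sigma> X\<^sub>0 l x =
     mu l powr \<alpha> * (LINT \<omega>|M. (H_inner \<kappa> \<eta> (X\<^sub>0 \<omega>) (e_vec \<kappa> \<eta> l))\<^sup>2) * f1 x + \<sigma>\<^sup>2 * f2 x"

end

(*
  In the eigenbasis the mild equation decouples: the coordinate x = <X, e_l> solves
    x(t) = e^(-at) x(0) + theta_0 int_0^t e^(-a(t-s)) x(s) ds + y(t),   a = nu lambda_l,
  where y is sigma mu_l^(-alpha/2) times the Wiener integral of s -> e^(-a(t-s)). Solving this Volterra
  equation path by path (with the resolvent kernel, b = theta_0 - a) expresses x linearly in x(0) and y,
  so E[x(t)^2] only needs the Ito isometry, E[x(0) y(s)] = 0 and Fubini. Integrating over t and summing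
  over l gives int E|X_t|_beta^2 dt = S(beta + 1) with S(s) = sum_l f_l mu_l^(-alpha s), hence
  R(beta) = S(beta + 1) / sqrt (S(2 (beta + 1))). By weighted AM-GM (Hoelder's inequality) S is strictly
  log-convex, which forces R to decrease strictly.
*)
theory Submission
  imports Defs
begin

section \<open>The eigensystem in the weighted space\<close>

text \<open>The mild equation holds at each fixed time outside a null set that depends on that time,
  whereas the Volterra equation has to be inverted along whole paths. Therefore \<open>y\<close> is
  defined path by path as the residual of the coordinate equation. Inversion then becomes an
  identity on every integrable path, and \<open>y\<close> is compared with Wiener integrals only at
  fixed times, inside expectations. No moment bound at positive times is presupposed: square
  integrability of x(t) comes out of its representation by x(0) and y. The sums S(s) converge for
  every s > 0 because \<open>f2 x\<close> decays like 1/x, hence like 1/mu, and the sum of mu^(-p)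
  over the two-dimensional lattice converges for p > 1. This is where beta > -1 enters. The factor
  mu^alpha in \<open>f_mode\<close> brings the initial part and the noise part, whose covariance
  carries mu^(-alpha), to a common power of mu. Strictness of the log-convexity comes from two modes
  with different eigenvalues.\<close>

lemma weight_measurable [measurable]:
  "(\<lambda>p. exp (\<kappa> * fst p + \<eta> * snd p)) \<in> borel_measurable D_measure" for \<kappa> \<eta> :: real
  by (intro borel_measurable_D_measure borel_measurable_continuous_onI continuous_intros)

lemma weight_bounded:
  assumes "p \<in> space D_measure"
  shows "\<bar>exp (\<kappa> * fst p + \<eta> * snd p)\<bar> \<le> exp (\<bar>\<kappa>\<bar> + \<bar>\<eta>\<bar>)"
proof -
  have "\<bar>\<kappa> * fst p\<bar> \<le> \<bar>\<kappa>\<bar> * 1" "\<bar>\<eta> * snd p\<bar> \<le> \<bar>\<eta>\<bar> * 1"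
    using assms unfolding abs_mult by (intro mult_left_mono; auto simp: space_D_measure)+
  then show ?thesis by simp
qed

lemma sq_integrable_weight:
  "sq_integrable f \<Longrightarrow> sq_integrable (\<lambda>p. exp (\<kappa> * fst p + \<eta> * snd p) * f p)"
  by (rule sq_integrable_mult_bounded[OF _ weight_measurable weight_bounded])

text \<open>As an operator on \<open>L2D\<close> the weight can be split into halves: with halved
  parameters it moves the weighted space onto the unweighted one, whose inner product is that of the
  type.\<close>

lift_definition weighted :: "real \<Rightarrow> real \<Rightarrow> L2D \<Rightarrow> L2D" is
  "\<lambda>\<kappa> \<eta> f p. exp (\<kappa> * fst p + \<eta> * snd p) * f p"
  by (auto simp: l2_rel_def sq_integrable_weight)

lemma weighted_abs:
  "sq_integrable f \<Longrightarrow> weighted \<kappa> \<eta> (abs_L2D f) = abs_L2D (\<lambda>p. exp (\<kappa> * fst p + \<eta> * snd p) * f p)"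
  by (intro weighted.abs_eq) (auto simp: l2_rel_def)

lemma inner_abs:
  "sq_integrable f \<Longrightarrow> sq_integrable g \<Longrightarrow> inner (abs_L2D f) (abs_L2D g) = (LINT p|D_measure. f p * g p)"
  by (intro inner_L2D.abs_eq) (auto simp: l2_rel_def)

lemma bounded_linear_weighted: "bounded_linear (weighted \<kappa> \<eta>)"
proof (rule bounded_linear_intro[where K = "exp (\<bar>\<kappa>\<bar> + \<bar>\<eta>\<bar>)"])
  fix u v :: L2D and c :: real
  obtain f g where fg: "sq_integrable f" "u = abs_L2D f" "sq_integrable g" "v = abs_L2D g"
    by (metis L2D_abs_cases)
  show "weighted \<kappa> \<eta> (u + v) = weighted \<kappa> \<eta> u + weighted \<kappa> \<eta> v"
    using fg by (simp add: L2D_plus_abs weighted_abs sq_integrable_add sq_integrable_weight distrib_left)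
  show "weighted \<kappa> \<eta> (c *\<^sub>R u) = c *\<^sub>R weighted \<kappa> \<eta> u"
    using fg by (simp add: L2D_scaleR_abs weighted_abs sq_integrable_scale sq_integrable_weight mult.left_commute)
  let ?K = "exp (\<bar>\<kappa>\<bar> + \<bar>\<eta>\<bar>)"
  have "(norm (weighted \<kappa> \<eta> u))\<^sup>2 = (LINT p|D_measure. (exp (\<kappa> * fst p + \<eta> * snd p) * f p)\<^sup>2)"
    using fg unfolding power2_norm_eq_inner by (simp add: weighted_abs inner_abs sq_integrable_weight power2_eq_square)
  also have "\<dots> \<le> (LINT p|D_measure. ?K\<^sup>2 * (f p)\<^sup>2)"
  proof (rule integral_mono)
    show "integrable D_measure (\<lambda>p. (exp (\<kappa> * fst p + \<eta> * snd p) * f p)\<^sup>2)"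
      using sq_integrable_weight[OF fg(1)] by (simp add: sq_integrable_def)
    show "integrable D_measure (\<lambda>p. ?K\<^sup>2 * (f p)\<^sup>2)"
      using fg(1) by (simp add: sq_integrable_def)
    show "(exp (\<kappa> * fst p + \<eta> * snd p) * f p)\<^sup>2 \<le> ?K\<^sup>2 * (f p)\<^sup>2" if "p \<in> space D_measure" for p
      unfolding power_mult_distrib
      using weight_bounded[OF that, of \<kappa> \<eta>] by (intro mult_right_mono power_mono) auto
  qed
  also have "\<dots> = (norm u * ?K)\<^sup>2"
    using fg unfolding power_mult_distrib power2_norm_eq_inner by (simp add: inner_abs power2_eq_square)
  finally show "norm (weighted \<kappa> \<eta> u) \<le> norm u * ?K"
    by (rule power2_le_imp_le) simp
qed

text \<open>Convergence proved in the unweighted picture is carried back to the weighted one by this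
  inverse.\<close>

lemma weighted_inverse: "weighted (- \<kappa>) (- \<eta>) (weighted \<kappa> \<eta> u) = u"
proof -
  obtain f where f: "sq_integrable f" "u = abs_L2D f" by (rule L2D_abs_cases)
  have *: "exp (- \<kappa> * fst p + - \<eta> * snd p) * (exp (\<kappa> * fst p + \<eta> * snd p) * f p) = f p" for p
    by (simp add: mult.assoc[symmetric] exp_add[symmetric])
  show ?thesis
    unfolding f(2) weighted_abs[OF f(1)] weighted_abs[OF sq_integrable_weight[OF f(1)]] * ..
qed

text \<open>The map \<open>u \<mapsto> e\<^bsup>(\<kappa>y+\<eta>z)/2\<^esup> u\<close> is an isometry of \<open>\<H>\<close> onto the unweighted \<open>L\<^sup>2(D)\<close>.\<close>

lemma H_inner_weighted:
  "H_inner \<kappa> \<eta> u v = inner (weighted (\<kappa> / 2) (\<eta> / 2) u) (weighted (\<kappa> / 2) (\<eta> / 2) v)"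
proof -
  obtain f g where fg: "sq_integrable f" "u = abs_L2D f" "sq_integrable g" "v = abs_L2D g"
    by (metis L2D_abs_cases)
  have W: "exp (\<kappa> / 2 * fst p + \<eta> / 2 * snd p) * exp (\<kappa> / 2 * fst p + \<eta> / 2 * snd p)
      = exp (\<kappa> * fst p + \<eta> * snd p)" for p :: "real \<times> real"
    by (simp add: exp_add[symmetric])
  have *: "exp (\<kappa> / 2 * fst p + \<eta> / 2 * snd p) * f p * (exp (\<kappa> / 2 * fst p + \<eta> / 2 * snd p) * g p)
      = f p * g p * exp (\<kappa> * fst p + \<eta> * snd p)" for p :: "real \<times> real"
    unfolding W[symmetric] by (simp only: mult_ac)
  have "H_inner \<kappa> \<eta> u v = (LINT p|D_measure. f p * g p * exp (\<kappa> * fst p + \<eta> * snd p))"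
    using fg by (simp, intro H_inner.abs_eq) (auto simp: l2_rel_def)
  then show ?thesis
    unfolding fg(2,4) weighted_abs[OF fg(1)] weighted_abs[OF fg(3)]
      inner_abs[OF sq_integrable_weight[OF fg(1)] sq_integrable_weight[OF fg(3)]] * .
qed

text \<open>Continuity in the unweighted norm of \<open>L2D\<close> is what lets a coordinate
  functional pass through series, Bochner integrals and mean square limits.\<close>

lemma bounded_linear_H_inner: "bounded_linear (\<lambda>u. H_inner \<kappa> \<eta> u v)"
  unfolding H_inner_weighted
  by (rule bounded_linear_compose[OF bounded_linear_inner_left bounded_linear_weighted])

section \<open>Orthonormality of the sine products\<close>

lemma integral_sin_sin:
  assumes "0 < m" "0 < n"
  shows "(LINT y:{0<..<1}|lborel. 2 * sin (pi * real m * y) * sin (pi * real n * y)) = (if m = n then 1 else 0)"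
    (is "(LINT y:_|_. ?f y) = _")
proof -
  have eq: "?f y = cos (pi * (real m - real n) * y) - cos (pi * (real m + real n) * y)" for y
    by (simp add: algebra_simps cos_add cos_diff)
  \<comment> \<open>The integrand is a difference of two cosines. For m = n the first of them is the
    constant 1, so its antiderivative degenerates to y.\<close>
  define G where "G y = (if m = n then y else sin (pi * (real m - real n) * y) / (pi * (real m - real n)))
     - sin (pi * (real m + real n) * y) / (pi * (real m + real n))" for y
  have mn: "pi * (real m + real n) \<noteq> 0" using assms by simp
  have "(G has_real_derivative cos (pi * (real m - real n) * y) - cos (pi * (real m + real n) * y)) (at y)" for y
  proof (cases "m = n")
    case True
    then have "G = (\<lambda>y. y - sin (pi * (real m + real n) * y) / (pi * (real m + real n)))"
      by (auto simp: G_def)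
    then show ?thesis using mn True assms by (auto intro!: derivative_eq_intros simp: field_simps)
  next
    case False
    then have "G = (\<lambda>y. sin (pi * (real m - real n) * y) / (pi * (real m - real n))
        - sin (pi * (real m + real n) * y) / (pi * (real m + real n)))"
      by (auto simp: G_def)
    moreover have "pi * (real m - real n) \<noteq> 0" using False by simp
    ultimately show ?thesis using mn
      by (auto intro!: derivative_eq_intros simp del: mult_eq_0_iff)
  qed
  then have "(LBINT y=ereal 0..ereal 1. cos (pi * (real m - real n) * y) - cos (pi * (real m + real n) * y)) = G 1 - G 0"
    by (intro interval_integral_FTC_finite continuous_intros)
      (auto simp: has_real_derivative_iff_has_vector_derivative[symmetric] intro: DERIV_subset)
  moreover have "sin (pi * (real m - real n) * 1) = 0"
    using sin_integer_2pi[of "int m - int n"] sin_zero_iff_int2[of "pi * (real m - real n)"]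
    by (metis mult.commute mult_1 of_int_diff of_int_of_nat_eq)
  moreover have "sin (pi * (real m + real n) * 1) = 0"
    by (metis mult.commute mult_1 of_nat_add sin_npi)
  ultimately show ?thesis
    by (simp add: interval_lebesgue_integral_def eq G_def einterval_def greaterThanLessThan_def greaterThan_def lessThan_def Int_def)
qed

text \<open>The exponential factors cancel here: these are the plain sine products, an orthonormal
  system for \<open>inner\<close>.\<close>

definition b_vec :: "real \<Rightarrow> real \<Rightarrow> nat \<times> nat \<Rightarrow> L2D" where
  "b_vec \<kappa> \<eta> l = weighted (\<kappa> / 2) (\<eta> / 2) (e_vec \<kappa> \<eta> l)"

lemma set_integrable_sin_sin: "set_integrable lborel {0<..<1::real} (\<lambda>y. 2 * sin (a * y) * sin (b * y))"
proof (rule set_integrable_subset)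
  show "set_integrable lborel {0..1} (\<lambda>y. 2 * sin (a * y) * sin (b * y))"
    by (intro borel_integrable_atLeastAtMost' continuous_intros)
qed auto

lemma b_vec_orthonormal:
  assumes "l \<in> modes" "k \<in> modes"
  shows "inner (b_vec \<kappa> \<eta> l) (b_vec \<kappa> \<eta> k) = (if l = k then 1 else 0)"
proof -
  have e: "sq_integrable (e_fun \<kappa> \<eta> l)" for l
    using e_vec.rsp unfolding rel_fun_def l2_rel_def by blast
  have ev: "e_vec \<kappa> \<eta> l = abs_L2D (e_fun \<kappa> \<eta> l)" for l by (rule e_vec.abs_eq)
  \<comment> \<open>The prefactors 2 of the two eigenfunctions multiply to 4, which is shared out as
    one factor 2 for each variable. The integral over the square then splits into two normalised
    one-dimensional ones.\<close>
  define g where "g m n y = 2 * sin (pi * real m * y) * sin (pi * real n * y)" for m n :: nat and y :: real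
  have "inner (b_vec \<kappa> \<eta> l) (b_vec \<kappa> \<eta> k)
      = (LINT p|D_measure. g (fst l) (fst k) (fst p) * g (snd l) (snd k) (snd p))"
    unfolding b_vec_def ev weighted_abs[OF e] inner_abs[OF sq_integrable_weight[OF e] sq_integrable_weight[OF e]]
  proof (rule Bochner_Integration.integral_cong[OF refl])
    fix p :: "real \<times> real"
    have "exp (\<kappa> / 2 * fst p + \<eta> / 2 * snd p) * exp (- (\<kappa> * fst p + \<eta> * snd p) / 2) = 1"
      by (simp add: exp_add[symmetric] field_simps)
    then have r: "exp (\<kappa> / 2 * fst p + \<eta> / 2 * snd p) * e_fun \<kappa> \<eta> l p
       = 2 * sin (pi * real (fst l) * fst p) * sin (pi * real (snd l) * snd p)" for l
      unfolding e_fun_def case_prod_beta by (subst mult.left_commute) simp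
    show "exp (\<kappa> / 2 * fst p + \<eta> / 2 * snd p) * e_fun \<kappa> \<eta> l p * (exp (\<kappa> / 2 * fst p + \<eta> / 2 * snd p) * e_fun \<kappa> \<eta> k p)
      = g (fst l) (fst k) (fst p) * g (snd l) (snd k) (snd p)"
      unfolding r g_def by (simp only: ac_simps)
  qed
  also have "\<dots> = (LINT p:({0<..<1}\<times>{0<..<1})|lborel. g (fst l) (fst k) (fst p) * g (snd l) (snd k) (snd p))"
    unfolding D_measure_def set_lebesgue_integral_def
    by (subst integral_restrict_space) (auto simp: D_measure_square)
  also have "\<dots> = (LINT p|(lborel \<Otimes>\<^sub>M lborel). (indicator {0<..<1} (fst p) *\<^sub>R g (fst l) (fst k) (fst p))
        * (indicator {0<..<1} (snd p) *\<^sub>R g (snd l) (snd k) (snd p)))"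
    unfolding set_lebesgue_integral_def lborel_prod
    by (rule Bochner_Integration.integral_cong) (auto simp: indicator_def)
  also have "\<dots> = (LINT y:{0<..<1}|lborel. g (fst l) (fst k) y) * (LINT z:{0<..<1}|lborel. g (snd l) (snd k) z)"
  proof -
    define I where "I m n y = indicator {0<..<1} y *\<^sub>R g m n y" for m n y
    have i: "integrable lborel (I m n)" for m n
      using set_integrable_sin_sin unfolding I_def g_def set_integrable_def by simp
    then have [measurable]: "I m n \<in> borel_measurable borel" for m n
      using borel_measurable_integrable by fastforce
    have "integrable (lborel \<Otimes>\<^sub>M lborel) (\<lambda>p. I (fst l) (fst k) (fst p) * I (snd l) (snd k) (snd p))"
      by (intro lborel_pair.Fubini_integrable)
        (simp_all add: abs_mult i integrable_abs)
    from lborel_pair.integral_fst'[OF this]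
    show ?thesis
      by (simp add: set_lebesgue_integral_def I_def)
  qed
  also have "\<dots> = (if l = k then 1 else 0)"
  proof -
    have "0 < fst l" "0 < fst k" "0 < snd l" "0 < snd k" using assms by (auto simp: modes_def)
    then show ?thesis by (simp add: g_def integral_sin_sin prod_eq_iff)
  qed
  finally show ?thesis .
qed

lemma H_inner_e_vec: "l \<in> modes \<Longrightarrow> k \<in> modes \<Longrightarrow> H_inner \<kappa> \<eta> (e_vec \<kappa> \<eta> l) (e_vec \<kappa> \<eta> k) = (if l = k then 1 else 0)"
  using b_vec_orthonormal[of l k \<kappa> \<eta>] by (simp add: H_inner_weighted b_vec_def)

section \<open>Series along orthonormal systems\<close>

lemma orthonormal_norm_sum:
  fixes b :: "'i \<Rightarrow> 'a::real_inner"
  assumes "finite F" and "\<And>i j. i \<in> F \<Longrightarrow> j \<in> F \<Longrightarrow> inner (b i) (b j) = (if i = j then 1 else 0)"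
  shows "(norm (\<Sum>i\<in>F. c i *\<^sub>R b i))\<^sup>2 = (\<Sum>i\<in>F. (c i)\<^sup>2)"
proof -
  have "(norm (\<Sum>i\<in>F. c i *\<^sub>R b i))\<^sup>2 = (\<Sum>i\<in>F. \<Sum>j\<in>F. c j * (c i * inner (b j) (b i)))"
    by (simp add: power2_norm_eq_inner inner_sum_left inner_sum_right sum_distrib_left mult.left_commute)
  also have "\<dots> = (\<Sum>i\<in>F. \<Sum>j\<in>F. if j = i then (c i)\<^sup>2 else 0)"
    using assms(2) by (intro sum.cong refl) (auto simp: power2_eq_square)
  finally show ?thesis using assms(1) by simp
qed

text \<open>Riesz-Fischer: the squared norm of a finite block of the series is the block sum of
  squared coefficients, so the net of finite partial sums is Cauchy and completeness gives the
  limit.\<close>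

lemma orthonormal_summable:
  fixes b :: "'i \<Rightarrow> 'a::{real_inner, banach}"
  assumes on: "\<And>i j. i \<in> A \<Longrightarrow> j \<in> A \<Longrightarrow> inner (b i) (b j) = (if i = j then 1 else 0)"
    and c: "(\<lambda>i. (c i)\<^sup>2) summable_on A"
  shows "(\<lambda>i. c i *\<^sub>R b i) summable_on A"
proof -
  let ?f = "\<lambda>i. c i *\<^sub>R b i"
  from c obtain L where lim: "(sum (\<lambda>i. (c i)\<^sup>2) \<longlongrightarrow> L) (finite_subsets_at_top A)"
    unfolding summable_on_def has_sum_def by blast
  have "\<exists>P. eventually P (finite_subsets_at_top A) \<and>
      (\<forall>F F'. P F \<and> P F' \<longrightarrow> dist (sum ?f F) (sum ?f F') < e)" if "0 < e" for e
  proof -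
    \<comment> \<open>Two coefficient sums that are both d-close to the limit differ by less than 2d
      = e^2/8, which is below (e/2)^2.\<close>
    define d where "d = e\<^sup>2 / 16"
    define P where "P F \<longleftrightarrow> finite F \<and> F \<subseteq> A \<and> dist (\<Sum>i\<in>F. (c i)\<^sup>2) L < d" for F
    have d: "0 < d" using that by (simp add: d_def)
    have ev_P: "eventually P (finite_subsets_at_top A)"
      using lim d unfolding P_def[abs_def] tendsto_iff
      by (auto simp: eventually_conj_iff eventually_finite_subsets_at_top_weakI)
    have "dist (sum ?f F1) (sum ?f F2) < e" if F12: "P F1" "P F2" for F1 F2
    proof -
      from ev_P obtain F' where F': "finite F'" "F' \<subseteq> A"
        and P: "\<And>F. finite F \<and> F \<supseteq> F' \<and> F \<subseteq> A \<Longrightarrow> P F"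
        by (auto simp: eventually_finite_subsets_at_top)
      \<comment> \<open>F1 and F2 need not be nested, so both are compared with a common superset
        that still satisfies P.\<close>
      define F where "F = F' \<union> F1 \<union> F2"
      have F: "finite F" "F \<subseteq> A" using F' F12 by (auto simp: F_def P_def)
      have PF: "P F" by (rule P) (use F in \<open>auto simp: F_def\<close>)
      have close: "dist (sum ?f F) (sum ?f G) < e / 2" if G: "G \<subseteq> F" "P G" for G
      proof -
        have "(dist (sum ?f F) (sum ?f G))\<^sup>2 = (norm (sum ?f (F - G)))\<^sup>2"
          unfolding dist_norm using F(1) G(1) by (subst sum_diff) auto
        also have "\<dots> = (\<Sum>i\<in>F-G. (c i)\<^sup>2)"
          using F on by (intro orthonormal_norm_sum) (auto simp: subset_iff)
        also have "\<dots> = (\<Sum>i\<in>F. (c i)\<^sup>2) - (\<Sum>i\<in>G. (c i)\<^sup>2)"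
          using F(1) G(1) by (subst sum_diff) auto
        also have "\<dots> < 2 * d"
          using PF G(2) unfolding P_def dist_real_def by linarith
        also have "\<dots> < (e / 2)\<^sup>2" using \<open>0 < e\<close> by (simp add: d_def power_divide)
        finally show ?thesis by (rule power2_less_imp_less) (use \<open>0 < e\<close> in simp)
      qed
      have "dist (sum ?f F1) (sum ?f F2) \<le> dist (sum ?f F) (sum ?f F1) + dist (sum ?f F) (sum ?f F2)"
        by (rule dist_triangle3)
      also have "\<dots> < e"
      proof -
        have "F1 \<subseteq> F" "F2 \<subseteq> F" by (auto simp: F_def)
        then show ?thesis using close[of F1] close[of F2] F12 by linarith
      qed
      finally show ?thesis .
    qed
    then show ?thesis using ev_P by blast
  qed
  then have "cauchy_filter (filtermap (sum ?f) (finite_subsets_at_top A))"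
    by (simp add: cauchy_filter_metric_filtermap)
  moreover have "uniform_space_class.complete (UNIV :: 'a set)"
    by (meson Cauchy_convergent UNIV_I complete_def convergent_def)
  ultimately obtain L' where "(sum ?f \<longlongrightarrow> L') (finite_subsets_at_top A)"
    using complete_uniform[where S=UNIV] by (force simp: filterlim_def)
  then show ?thesis unfolding summable_on_def has_sum_def by blast
qed

text \<open>Bessel's inequality, from the nonnegative squared norm of u minus its projection p onto
  the span of a finite part of the system.\<close>

lemma bessel_summable:
  fixes b :: "'i \<Rightarrow> 'a::real_inner"
  assumes on: "\<And>i j. i \<in> A \<Longrightarrow> j \<in> A \<Longrightarrow> inner (b i) (b j) = (if i = j then 1 else 0)"
  shows "(\<lambda>i. (inner u (b i))\<^sup>2) summable_on A"
proof (rule nonneg_bdd_above_summable_on)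
  have "(\<Sum>i\<in>F. (inner u (b i))\<^sup>2) \<le> (norm u)\<^sup>2" if F: "finite F" "F \<subseteq> A" for F
  proof -
    define p where "p = (\<Sum>i\<in>F. inner u (b i) *\<^sub>R b i)"
    have on': "inner (b i) (b j) = (if i = j then 1 else 0)" if "i \<in> F" "j \<in> F" for i j
      using on that F by blast
    have "(norm p)\<^sup>2 = (\<Sum>i\<in>F. (inner u (b i))\<^sup>2)"
      unfolding p_def by (rule orthonormal_norm_sum[OF F(1) on'])
    moreover have "inner u p = (\<Sum>i\<in>F. (inner u (b i))\<^sup>2)"
      by (simp add: p_def inner_sum_right power2_eq_square)
    moreover have "0 \<le> (norm (u - p))\<^sup>2" by simp
    ultimately show ?thesis
      by (simp add: power2_norm_eq_inner inner_diff_left inner_diff_right inner_commute)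
  qed
  then show "bdd_above (sum (\<lambda>i. (inner u (b i))\<^sup>2) ` {F. F \<subseteq> A \<and> finite F})"
    by (auto intro!: bdd_aboveI)
qed simp

lemma mu_pos: "l \<in> modes \<Longrightarrow> 0 < mu l"
  by (auto simp: modes_def mu_def intro!: mult_pos_pos add_pos_pos)

lemma lam_pos: "l \<in> modes \<Longrightarrow> 0 < lam \<kappa> \<eta> l"
  using mu_pos[of l] by (simp add: lam_def add_pos_nonneg)

text \<open>Since \<open>infsum\<close> is 0 on families that are not summable, convergence of the
  defining series comes first: for t \<ge> 0 all exponential factors are at most 1, so Bessel's
  inequality suffices. The continuous functional then passes through the sum and orthonormality
  keeps one term.\<close>

lemma H_inner_dirichlet_semigroup:
  assumes t: "0 \<le> t" and k: "k \<in> modes"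
  shows "H_inner \<kappa> \<eta> (dirichlet_semigroup \<kappa> \<eta> t u) (e_vec \<kappa> \<eta> k)
    = exp (- t * lam \<kappa> \<eta> k) * H_inner \<kappa> \<eta> u (e_vec \<kappa> \<eta> k)"
proof -
  define c where "c l = exp (- t * lam \<kappa> \<eta> l) * H_inner \<kappa> \<eta> u (e_vec \<kappa> \<eta> l)" for l
  have "(\<lambda>l. (H_inner \<kappa> \<eta> u (e_vec \<kappa> \<eta> l))\<^sup>2) summable_on modes"
    using bessel_summable[of modes "b_vec \<kappa> \<eta>"] b_vec_orthonormal
    by (simp add: H_inner_weighted b_vec_def)
  then have "(\<lambda>l. (c l)\<^sup>2) summable_on modes"
  proof (rule summable_on_comparison_test)
    fix l assume "l \<in> modes"
    then have "exp (- t * lam \<kappa> \<eta> l) \<le> 1" using t lam_pos[of l \<kappa> \<eta>] by simp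
    then have "(exp (- t * lam \<kappa> \<eta> l))\<^sup>2 \<le> 1" by (intro power_le_one) auto
    then show "(c l)\<^sup>2 \<le> (H_inner \<kappa> \<eta> u (e_vec \<kappa> \<eta> l))\<^sup>2"
      unfolding c_def power_mult_distrib by (intro mult_left_le_one_le) auto
  qed simp
  then have "(\<lambda>l. c l *\<^sub>R b_vec \<kappa> \<eta> l) summable_on modes"
    by (intro orthonormal_summable b_vec_orthonormal)
  \<comment> \<open>The series converges for the images \<open>b_vec\<close>; the inverse
    multiplication operator returns it to \<open>e_vec\<close>.\<close>
  then have "(\<lambda>l. weighted (- (\<kappa> / 2)) (- (\<eta> / 2)) (c l *\<^sub>R b_vec \<kappa> \<eta> l)) summable_on modes"
    by (rule summable_on_bounded_linear[OF bounded_linear_weighted])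
  then have "(\<lambda>l. c l *\<^sub>R e_vec \<kappa> \<eta> l) summable_on modes"
    unfolding b_vec_def linear_cmul[OF bounded_linear.linear[OF bounded_linear_weighted]] weighted_inverse .
  then have "H_inner \<kappa> \<eta> (dirichlet_semigroup \<kappa> \<eta> t u) (e_vec \<kappa> \<eta> k)
      = (\<Sum>\<^sub>\<infinity>l\<in>modes. H_inner \<kappa> \<eta> (c l *\<^sub>R e_vec \<kappa> \<eta> l) (e_vec \<kappa> \<eta> k))"
    using infsum_bounded_linear_strong[OF _ bounded_linear_H_inner, where f = "\<lambda>l. c l *\<^sub>R e_vec \<kappa> \<eta> l"]
      summable_on_bounded_linear[OF bounded_linear_H_inner, where f = "\<lambda>l. c l *\<^sub>R e_vec \<kappa> \<eta> l"]
    unfolding dirichlet_semigroup_def c_def by simp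
  also have "\<dots> = (\<Sum>\<^sub>\<infinity>l\<in>modes. if l = k then c k else 0)"
    using k by (intro infsum_cong)
      (auto simp: linear_cmul[OF bounded_linear.linear[OF bounded_linear_H_inner]] H_inner_e_vec)
  also have "\<dots> = (\<Sum>\<^sub>\<infinity>l\<in>{k}. c k)"
    using k by (intro infsum_cong_neutral) auto
  finally show ?thesis by (simp add: c_def)
qed

section \<open>Wiener integrals of deterministic functions\<close>

definition L2fun :: "'a measure \<Rightarrow> ('a \<Rightarrow> real) set" where
  "L2fun M = {f \<in> borel_measurable M. integrable M (\<lambda>x. (f x)\<^sup>2)}"

lemma L2fun_measurable [measurable_dest]: "f \<in> L2fun M \<Longrightarrow> f \<in> borel_measurable M"
  by (simp add: L2fun_def)

lemma L2fun_square: "f \<in> L2fun M \<Longrightarrow> integrable M (\<lambda>x. (f x)\<^sup>2)"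
  by (simp add: L2fun_def)

lemma L2fun_mult:
  assumes "f \<in> L2fun M" "g \<in> L2fun M"
  shows "integrable M (\<lambda>x. f x * g x)"
proof (rule Bochner_Integration.integrable_bound[where f = "\<lambda>x. (f x)\<^sup>2 + (g x)\<^sup>2"])
  have "\<bar>a * b\<bar> \<le> \<bar>a\<^sup>2 + b\<^sup>2\<bar>" for a b :: real
    using sum_squares_bound[of "\<bar>a\<bar>" "\<bar>b\<bar>"] mult_nonneg_nonneg[OF abs_ge_zero[of a] abs_ge_zero[of b]]
    unfolding power2_abs abs_mult by linarith
  then show "AE x in M. norm (f x * g x) \<le> norm ((f x)\<^sup>2 + (g x)\<^sup>2)" by simp
qed (use assms in \<open>auto simp: L2fun_def\<close>)

lemma L2fun_add:
  assumes "f \<in> L2fun M" "g \<in> L2fun M"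
  shows "(\<lambda>x. f x + g x) \<in> L2fun M"
proof -
  have "integrable M (\<lambda>x. (f x)\<^sup>2 + (g x)\<^sup>2 + 2 * (f x * g x))"
    using assms L2fun_mult[OF assms] by (auto simp: L2fun_def)
  also have "(\<lambda>x. (f x)\<^sup>2 + (g x)\<^sup>2 + 2 * (f x * g x)) = (\<lambda>x. (f x + g x)\<^sup>2)"
    by (auto simp: power2_eq_square algebra_simps)
  finally show ?thesis using assms by (auto simp: L2fun_def)
qed

lemma L2fun_cmult: "f \<in> L2fun M \<Longrightarrow> (\<lambda>x. c * f x) \<in> L2fun M"
  by (auto simp: L2fun_def power_mult_distrib)

lemma L2fun_diff:
  assumes "f \<in> L2fun M" "g \<in> L2fun M"
  shows "(\<lambda>x. f x - g x) \<in> L2fun M"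
  using L2fun_add[OF assms(1) L2fun_cmult[OF assms(2), of "-1"]] by simp

lemma L2fun_zero: "(\<lambda>x. 0) \<in> L2fun M"
  by (simp add: L2fun_def)

lemma L2fun_cong_AE:
  assumes "AE x in M. f x = g x" "g \<in> L2fun M" "f \<in> borel_measurable M"
  shows "f \<in> L2fun M"
proof -
  have "integrable M (\<lambda>x. (f x)\<^sup>2) = integrable M (\<lambda>x. (g x)\<^sup>2)"
    using assms by (intro integrable_cong_AE) (auto simp: L2fun_def)
  then show ?thesis using assms by (simp add: L2fun_def)
qed

lemma L2fun_iff_nn_integral:
  "f \<in> L2fun M \<longleftrightarrow> f \<in> borel_measurable M \<and> (\<integral>\<^sup>+x. ennreal ((f x)\<^sup>2) \<partial>M) < \<infinity>"
  by (auto simp: L2fun_def integrable_iff_bounded)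

lemma (in finite_measure) L2fun_integrable: "f \<in> L2fun M \<Longrightarrow> integrable M f"
  using L2fun_mult[of f M "\<lambda>_. 1"] by (simp add: L2fun_def)

lemma Cauchy_Schwarz_integral:
  assumes f: "f \<in> L2fun M" and g: "g \<in> L2fun M"
  shows "\<bar>LINT x|M. f x * g x\<bar> \<le> sqrt (LINT x|M. (f x)\<^sup>2) * sqrt (LINT x|M. (g x)\<^sup>2)"
proof -
  note [measurable] = L2fun_measurable[OF f] L2fun_measurable[OF g]
  have "\<bar>LINT x|M. f x * g x\<bar> \<le> (LINT x|M. \<bar>f x * g x\<bar>)"
    by (rule integral_abs_bound)
  also have "\<dots> \<le> sqrt ((LINT x|M. (f x)\<^sup>2) * (LINT x|M. (g x)\<^sup>2))"
  proof (rule real_le_rsqrt)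
    have i: "integrable M (\<lambda>x. \<bar>f x * g x\<bar>)" by (intro integrable_abs L2fun_mult f g)
    have "ennreal ((LINT x|M. \<bar>f x * g x\<bar>)\<^sup>2) = (\<integral>\<^sup>+x. ennreal \<bar>f x\<bar> * ennreal \<bar>g x\<bar> \<partial>M)\<^sup>2"
      using i by (simp add: nn_integral_eq_integral ennreal_mult[symmetric] abs_mult ennreal_power)
    also have "\<dots> \<le> (\<integral>\<^sup>+x. ennreal \<bar>f x\<bar> ^ 2 \<partial>M) * (\<integral>\<^sup>+x. ennreal \<bar>g x\<bar> ^ 2 \<partial>M)"
      by (rule Cauchy_Schwarz_nn_integral) auto
    also have "\<dots> = ennreal ((LINT x|M. (f x)\<^sup>2) * (LINT x|M. (g x)\<^sup>2))"
      using L2fun_square[OF f] L2fun_square[OF g]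
      by (simp add: nn_integral_eq_integral ennreal_mult ennreal_power)
    finally show "(LINT x|M. \<bar>f x * g x\<bar>)\<^sup>2 \<le> (LINT x|M. (f x)\<^sup>2) * (LINT x|M. (g x)\<^sup>2)"
      by (subst (asm) ennreal_le_iff) auto
  qed
  finally show ?thesis by (simp add: real_sqrt_mult)
qed

text \<open>A single approximant at squared distance below 1 already places f in
  \<open>L2fun M\<close>; afterwards all the ennreal integrals are finite and can be read as real
  ones.\<close>

lemma L2_limit:
  assumes fn: "\<And>n. fn n \<in> L2fun M" and f: "f \<in> borel_measurable M"
    and lim: "(\<lambda>n. \<integral>\<^sup>+x. ennreal ((f x - fn n x)\<^sup>2) \<partial>M) \<longlonglongrightarrow> 0"
  shows "f \<in> L2fun M" and "(\<lambda>n. LINT x|M. (f x - fn n x)\<^sup>2) \<longlonglongrightarrow> 0"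
proof -
  note [measurable] = f L2fun_measurable[OF fn]
  have "\<forall>\<^sub>F n in sequentially. (\<integral>\<^sup>+x. ennreal ((f x - fn n x)\<^sup>2) \<partial>M) < 1"
    using lim by (rule order_tendstoD) simp
  then obtain n where "(\<integral>\<^sup>+x. ennreal ((f x - fn n x)\<^sup>2) \<partial>M) < 1"
    by (auto simp: eventually_sequentially)
  then have "(\<lambda>x. f x - fn n x) \<in> L2fun M"
    unfolding L2fun_iff_nn_integral using order.strict_trans by fastforce
  from L2fun_add[OF this fn[of n]] show L: "f \<in> L2fun M" by simp
  have "(\<integral>\<^sup>+x. ennreal ((f x - fn n x)\<^sup>2) \<partial>M) = ennreal (LINT x|M. (f x - fn n x)\<^sup>2)" for n
    by (intro nn_integral_eq_integral L2fun_square L2fun_diff L fn) auto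
  then show "(\<lambda>n. LINT x|M. (f x - fn n x)\<^sup>2) \<longlonglongrightarrow> 0"
    using lim by (simp add: ennreal_tendsto_0_iff)
qed

text \<open>Continuity of the inner product in mean square. Every identity for step functions is
  passed to its limit by this lemma.\<close>

lemma L2_limit_inner:
  assumes fn: "\<And>n. fn n \<in> L2fun M" and f: "f \<in> borel_measurable M"
    and f_lim: "(\<lambda>n. \<integral>\<^sup>+x. ennreal ((f x - fn n x)\<^sup>2) \<partial>M) \<longlonglongrightarrow> 0"
    and gn: "\<And>n. gn n \<in> L2fun M" and g: "g \<in> borel_measurable M"
    and g_lim: "(\<lambda>n. \<integral>\<^sup>+x. ennreal ((g x - gn n x)\<^sup>2) \<partial>M) \<longlonglongrightarrow> 0"
  shows "(\<lambda>n. LINT x|M. fn n x * gn n x) \<longlonglongrightarrow> (LINT x|M. f x * g x)"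
proof -
  note f' = L2_limit[OF fn f f_lim] and g' = L2_limit[OF gn g g_lim]
  let ?F = "\<lambda>n. sqrt (LINT x|M. (f x - fn n x)\<^sup>2)" and ?G = "\<lambda>n. sqrt (LINT x|M. (g x - gn n x)\<^sup>2)"
  have "(\<lambda>n. (LINT x|M. fn n x * gn n x) - (LINT x|M. f x * g x)) \<longlonglongrightarrow> 0"
  proof (rule Lim_null_comparison)
    have F: "?F \<longlonglongrightarrow> 0" and G: "?G \<longlonglongrightarrow> 0"
      using tendsto_real_sqrt[OF f'(2)] tendsto_real_sqrt[OF g'(2)] by simp_all
    have "(\<lambda>n. ?F n * ?G n + ?F n * sqrt (LINT x|M. (g x)\<^sup>2) + sqrt (LINT x|M. (f x)\<^sup>2) * ?G n)
      \<longlonglongrightarrow> 0 * 0 + 0 * sqrt (LINT x|M. (g x)\<^sup>2) + sqrt (LINT x|M. (f x)\<^sup>2) * 0"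
      by (intro tendsto_intros F G)
    then show "(\<lambda>n. ?F n * ?G n + ?F n * sqrt (LINT x|M. (g x)\<^sup>2) + sqrt (LINT x|M. (f x)\<^sup>2) * ?G n) \<longlonglongrightarrow> 0"
      by simp
    show "\<forall>\<^sub>F n in sequentially. norm ((LINT x|M. fn n x * gn n x) - (LINT x|M. f x * g x))
       \<le> ?F n * ?G n + ?F n * sqrt (LINT x|M. (g x)\<^sup>2) + sqrt (LINT x|M. (f x)\<^sup>2) * ?G n"
    proof (intro always_eventually allI)
      fix n
      let ?f = "\<lambda>x. f x - fn n x" and ?g = "\<lambda>x. g x - gn n x"
      have d: "?f \<in> L2fun M" "?g \<in> L2fun M" by (intro L2fun_diff f' g' fn gn)+
      have "(LINT x|M. fn n x * gn n x) - (LINT x|M. f x * g x)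
        = (LINT x|M. fn n x * gn n x - f x * g x)"
        by (intro Bochner_Integration.integral_diff[symmetric] L2fun_mult fn gn f' g')
      \<comment> \<open>Each of the three products contains a difference that tends to 0, so
        Cauchy-Schwarz bounds all of them by null sequences.\<close>
      also have "\<dots> = (LINT x|M. ?f x * ?g x - ?f x * g x - f x * ?g x)"
        by (intro Bochner_Integration.integral_cong) (auto simp: algebra_simps)
      also have "\<dots> = (LINT x|M. ?f x * ?g x) - (LINT x|M. ?f x * g x) - (LINT x|M. f x * ?g x)"
        by (simp add: L2fun_mult d f'(1) g'(1))
      finally show "norm ((LINT x|M. fn n x * gn n x) - (LINT x|M. f x * g x))
       \<le> ?F n * ?G n + ?F n * sqrt (LINT x|M. (g x)\<^sup>2) + sqrt (LINT x|M. (f x)\<^sup>2) * ?G n"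
        using Cauchy_Schwarz_integral[OF d] Cauchy_Schwarz_integral[OF d(1) g'(1)]
          Cauchy_Schwarz_integral[OF f'(1) d(2)]
        unfolding real_norm_def by linarith
    qed
  qed
  then show ?thesis by (rule LIM_zero_cancel)
qed

lemma step_fun_L2: "step_fun ps \<in> L2fun lborel" for ps :: "(real \<times> real \<times> real) list"
proof (induction ps)
  case Nil
  show ?case by (simp add: step_fun_def[abs_def] L2fun_zero)
next
  case (Cons p ps)
  obtain a b c where p: "p = (a, b, c)" by (cases p)
  have "integrable lborel (\<lambda>x. (indicat_real {a<..b} x)\<^sup>2)"
    by (cases "a \<le> b") (simp_all add: power2_eq_square flip: indicator_inter_arith)
  then have "(\<lambda>x. indicat_real {a<..b} x) \<in> L2fun lborel"
    by (simp add: L2fun_def)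
  from L2fun_add[OF L2fun_cmult[OF this, of c] Cons]
  show ?case by (simp add: step_fun_def[abs_def] p mult.commute)
qed

section \<open>Moments of Brownian increments\<close>

lemma stochastic_basisD:
  assumes basis: "stochastic_basis M F"
  shows "prob_space M" and "0 \<le> t \<Longrightarrow> subalgebra M (F t)"
    and "0 \<le> s \<Longrightarrow> s \<le> t \<Longrightarrow> sets (F s) \<subseteq> sets (F t)"
proof -
  note conjs = basis[unfolded stochastic_basis_def]
  show "prob_space M" by (rule conjs[THEN conjunct1])
  show "0 \<le> t \<Longrightarrow> subalgebra M (F t)"
    by (rule conjs[THEN conjunct2, THEN conjunct1, rule_format])
  show "0 \<le> s \<Longrightarrow> s \<le> t \<Longrightarrow> sets (F s) \<subseteq> sets (F t)"
    using conjs[THEN conjunct2, THEN conjunct2, THEN conjunct1] by blast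
qed

lemma has_wiener_integral_measurable:
  assumes "has_wiener_integral M w t \<phi> I"
  shows "I \<in> borel_measurable M"
  by (rule assms[unfolded has_wiener_integral_def, THEN conjunct2, THEN conjunct1])

context
  fixes M :: "'w measure" and F :: "real \<Rightarrow> 'w measure" and w :: "real \<Rightarrow> 'w \<Rightarrow> real"
  assumes basis: "stochastic_basis M F" and bm: "brownian_motion M F w"
begin

interpretation prob_space M by (rule stochastic_basisD(1)[OF basis])

lemma brownian_motionD:
  shows "0 \<le> t \<Longrightarrow> w t \<in> borel_measurable (F t)"
    and "0 \<le> s \<Longrightarrow> s < t \<Longrightarrow> distributed M lborel (\<lambda>\<omega>. w t \<omega> - w s \<omega>) (normal_density 0 (sqrt (t - s)))"
    and "0 \<le> s \<Longrightarrow> s < t \<Longrightarrow> indep_set (sets (F s))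
      (sets (vimage_algebra (space M) (\<lambda>\<omega>. w t \<omega> - w s \<omega>) borel))"
proof -
  note conjs = bm[unfolded brownian_motion_def]
  show "0 \<le> t \<Longrightarrow> w t \<in> borel_measurable (F t)"
    by (rule conjs[THEN conjunct1, rule_format])
  note incr = conjs[THEN conjunct2, THEN conjunct2, THEN conjunct2, rule_format]
  show "0 \<le> s \<Longrightarrow> s < t \<Longrightarrow> distributed M lborel (\<lambda>\<omega>. w t \<omega> - w s \<omega>) (normal_density 0 (sqrt (t - s)))"
    by (rule incr[THEN conjunct1]) simp
  show "0 \<le> s \<Longrightarrow> s < t \<Longrightarrow> indep_set (sets (F s))
      (sets (vimage_algebra (space M) (\<lambda>\<omega>. w t \<omega> - w s \<omega>) borel))"
    by (rule incr[THEN conjunct2]) simp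
qed

lemma adapted_measurable:
  "0 \<le> s \<Longrightarrow> f \<in> borel_measurable (F s) \<Longrightarrow> f \<in> borel_measurable M" for f :: "'w \<Rightarrow> real"
  by (rule measurable_from_subalg[OF stochastic_basisD(2)[OF basis]])

lemma brownian_measurable: "0 \<le> s \<Longrightarrow> w s \<in> borel_measurable M"
  by (rule adapted_measurable[OF _ brownian_motionD(1)])

lemma adapted_mono:
  fixes f :: "'w \<Rightarrow> real"
  assumes "0 \<le> s" "s \<le> t" "f \<in> borel_measurable (F s)"
  shows "f \<in> borel_measurable (F t)"
proof -
  have "subalgebra (F t) (F s)"
    using stochastic_basisD(2)[OF basis, of s] stochastic_basisD(2)[OF basis, of t] stochastic_basisD(3)[OF basis, of s t] assms by (auto simp: subalgebra_def)
  then show ?thesis using assms measurable_from_subalg by blast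
qed

lemma brownian_increment_variance:
  assumes "0 \<le> s" "s \<le> t"
  shows "(\<lambda>\<omega>. w t \<omega> - w s \<omega>) \<in> L2fun M" and "expectation (\<lambda>\<omega>. (w t \<omega> - w s \<omega>)\<^sup>2) = t - s"
    and "expectation (\<lambda>\<omega>. w t \<omega> - w s \<omega>) = 0"
proof -
  let ?X = "\<lambda>\<omega>. w t \<omega> - w s \<omega>"
  have [measurable]: "?X \<in> borel_measurable M" using brownian_measurable assms by auto
  have "?X \<in> L2fun M \<and> expectation (\<lambda>\<omega>. (?X \<omega>)\<^sup>2) = t - s \<and> expectation ?X = 0"
  proof (cases "s = t")
    case True
    then show ?thesis by (simp add: L2fun_zero)
  next
    case False
    then have st: "s < t" using assms by simp
    then have D: "distributed M lborel ?X (normal_density 0 (sqrt (t - s)))"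
      by (rule brownian_motionD(2)[OF assms(1)])
    have e: "expectation ?X = 0" using st by (intro normal_distributed_expectation[OF _ D]) simp
    have v: "expectation (\<lambda>\<omega>. (?X \<omega>)\<^sup>2) = t - s"
      using normal_distributed_variance[OF _ D] st e by simp
    \<comment> \<open>The integral of a non-integrable function is 0 by convention, so the value t -
      s > 0 forces integrability.\<close>
    then have "integrable M (\<lambda>\<omega>. (?X \<omega>)\<^sup>2)"
      using st not_integrable_integral_eq by fastforce
    then show ?thesis using e v by (simp add: L2fun_def)
  qed
  then show "(\<lambda>\<omega>. w t \<omega> - w s \<omega>) \<in> L2fun M" "expectation (\<lambda>\<omega>. (w t \<omega> - w s \<omega>)\<^sup>2) = t - s"
    "expectation (\<lambda>\<omega>. w t \<omega> - w s \<omega>) = 0" by auto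
qed

text \<open>For s < t the increment is independent of F(s) and has mean zero, so the expectation of
  the product factors.\<close>

lemma brownian_increment_adapted:
  assumes s: "0 \<le> s" "s \<le> t" and f: "f \<in> borel_measurable (F s)" "f \<in> L2fun M"
  shows "expectation (\<lambda>\<omega>. f \<omega> * (w t \<omega> - w s \<omega>)) = 0"
proof (cases "s = t")
  case False
  let ?X = "\<lambda>\<omega>. w t \<omega> - w s \<omega>"
  note X = brownian_increment_variance[OF s]
  have ind: "indep_set (sets (F s)) (sets (vimage_algebra (space M) ?X borel))"
    using brownian_motionD(3)[of s t] False s by simp
  have sp: "space (F s) = space M" using stochastic_basisD(2)[OF basis s(1)] by (simp add: subalgebra_def)
  have "indep_var borel f borel ?X"
    unfolding indep_var_eq
  proof (intro conjI)
    \<comment> \<open>Independence is given for all of F(s); it passes to the smaller sigma-algebra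
      generated by f.\<close>
    have "sigma_sets (space M) {f -` A \<inter> space M |A. A \<in> sets borel} \<subseteq> sets (F s)"
      using measurable_sets[OF f(1)] unfolding sp
      by (intro sets.sigma_sets_subset[of _ "F s", unfolded sp]) auto
    then show "indep_set (sigma_sets (space M) {f -` A \<inter> space M |A. A \<in> sets borel})
      (sigma_sets (space M) {?X -` A \<inter> space M |A. A \<in> sets borel})"
      using ind unfolding sets_vimage_algebra indep_set_def
      by (elim indep_sets_mono_sets) (auto split: bool.split)
  qed (use f X(1) in \<open>auto dest: L2fun_measurable\<close>)
  from indep_var_lebesgue_integral[OF this L2fun_integrable[OF f(2)] L2fun_integrable[OF X(1)]]
  show ?thesis by (simp add: X(3))
qed simp

text \<open>For s \<le> t the later increment is split at s and the cross term vanishes by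
  \<open>brownian_increment_adapted\<close>. Subtracting \<open>w 0\<close>, which is 0 only almost
  surely, keeps everything in terms of increments.\<close>

lemma brownian_covariance:
  assumes "0 \<le> s" "0 \<le> t"
  shows "expectation (\<lambda>\<omega>. (w s \<omega> - w 0 \<omega>) * (w t \<omega> - w 0 \<omega>)) = min s t"
proof -
  have *: "expectation (\<lambda>\<omega>. (w s \<omega> - w 0 \<omega>) * (w t \<omega> - w 0 \<omega>)) = s" if "0 \<le> s" "s \<le> t" for s t
  proof -
    let ?X = "\<lambda>\<omega>. w s \<omega> - w 0 \<omega>" and ?Y = "\<lambda>\<omega>. w t \<omega> - w s \<omega>"
    have L: "?X \<in> L2fun M" "?Y \<in> L2fun M"
      using that by (auto intro: brownian_increment_variance)
    have Fs: "?X \<in> borel_measurable (F s)"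
      using that by (intro borel_measurable_diff brownian_motionD(1) adapted_mono[OF _ _ brownian_motionD(1)]) auto
    have "expectation (\<lambda>\<omega>. ?X \<omega> * (w t \<omega> - w 0 \<omega>)) = expectation (\<lambda>\<omega>. (?X \<omega>)\<^sup>2 + ?X \<omega> * ?Y \<omega>)"
      by (intro Bochner_Integration.integral_cong) (auto simp: power2_eq_square algebra_simps)
    also have "\<dots> = expectation (\<lambda>\<omega>. (?X \<omega>)\<^sup>2) + expectation (\<lambda>\<omega>. ?X \<omega> * ?Y \<omega>)"
      using L L2fun_square L2fun_mult by (intro Bochner_Integration.integral_add) blast+
    also have "\<dots> = s"
      using brownian_increment_variance(2)[of 0 s] brownian_increment_adapted[OF that Fs L(1)] that by simp
    finally show ?thesis .
  qed
  show ?thesis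
  proof (cases "s \<le> t")
    case True
    then show ?thesis using *[of s t] assms by simp
  next
    case False
    then show ?thesis using *[of t s] assms by (simp add: mult.commute)
  qed
qed

text \<open>Increments over arbitrary, possibly overlapping intervals: both are written through
  \<open>w 0\<close> and expanded with the covariance min s t.\<close>

lemma increment_isometry:
  assumes "0 \<le> a" "a \<le> b" "0 \<le> c" "c \<le> d"
  shows "expectation (\<lambda>\<omega>. (w b \<omega> - w a \<omega>) * (w d \<omega> - w c \<omega>))
    = (LINT s|lborel. indicat_real {a<..b} s * indicat_real {c<..d} s)"
proof -
  let ?w = "\<lambda>s \<omega>. w s \<omega> - w 0 \<omega>"
  have L: "integrable M (\<lambda>\<omega>. ?w s \<omega> * ?w t \<omega>)" if "0 \<le> s" "0 \<le> t" for s t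
    using that by (intro L2fun_mult brownian_increment_variance) auto
  have "expectation (\<lambda>\<omega>. (w b \<omega> - w a \<omega>) * (w d \<omega> - w c \<omega>))
    = expectation (\<lambda>\<omega>. ?w b \<omega> * ?w d \<omega> - ?w b \<omega> * ?w c \<omega> - ?w a \<omega> * ?w d \<omega> + ?w a \<omega> * ?w c \<omega>)"
    by (intro Bochner_Integration.integral_cong) (auto simp: algebra_simps)
  also have "\<dots> = min b d - min b c - min a d + min a c"
    using assms by (simp add: L brownian_covariance del: right_diff_distrib left_diff_distrib)
  \<comment> \<open>The alternating sum of minima is the length of the intersection of (a, b] and
    (c, d].\<close>
  also have "\<dots> = max 0 (min b d - max a c)"
    using assms by (auto simp: min_def max_def)
  also have "\<dots> = (LINT s|lborel. indicat_real {max a c<..min b d} s)"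
    by (cases "max a c \<le> min b d") (auto simp: max_def)
  also have "\<dots> = (LINT s|lborel. indicat_real {a<..b} s * indicat_real {c<..d} s)"
    by (intro Bochner_Integration.integral_cong) (auto simp: indicator_def)
  finally show ?thesis .
qed

section \<open>Ito isometry, from step functions to limits\<close>

abbreviation (input) nonneg_steps :: "(real \<times> real \<times> real) list \<Rightarrow> bool" where
  "nonneg_steps ps \<equiv> \<forall>(a, b, c)\<in>set ps. 0 \<le> a \<and> a \<le> b"

lemma step_integral_L2:
  "nonneg_steps ps \<Longrightarrow> step_integral w ps \<in> L2fun M"
proof (induction ps)
  case Nil
  show ?case by (simp add: step_integral_def[abs_def] L2fun_zero)
next
  case (Cons p ps)
  obtain a b c where p: "p = (a, b, c)" by (cases p)
  have "(\<lambda>x. w b x - w a x) \<in> L2fun M"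
    using Cons.prems by (auto simp: p intro: brownian_increment_variance)
  from L2fun_add[OF L2fun_cmult[OF this, of c] Cons.IH] Cons.prems
  show ?case by (simp add: step_integral_def[abs_def] p mult.commute)
qed

text \<open>Bilinearity in one argument. As \<open>increment_isometry\<close> covers overlapping
  intervals, induction over the list takes the place of a refinement into disjoint
  intervals.\<close>

lemma step_isometry1:
  assumes "nonneg_steps qs" "0 \<le> a" "a \<le> b"
  shows "expectation (\<lambda>\<omega>. (w b \<omega> - w a \<omega>) * step_integral w qs \<omega>)
    = (LINT s|lborel. indicat_real {a<..b} s * step_fun qs s)"
  using assms(1)
proof (induction qs)
  case Nil
  show ?case by (simp add: step_integral_def step_fun_def)
next
  case (Cons q qs)
  obtain c d k where q: "q = (c, d, k)" by (cases q)
  have cd: "0 \<le> c" "c \<le> d" and qs: "nonneg_steps qs" using Cons.prems by (auto simp: q)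
  note X = brownian_increment_variance(1)[OF assms(2,3)] and Y = brownian_increment_variance(1)[OF cd]
  have I: "(\<lambda>s. indicat_real {a<..b} s) \<in> L2fun lborel" for a b :: real
    using step_fun_L2[of "[(a, b, 1)]"] by (simp add: step_fun_def[abs_def])
  have "expectation (\<lambda>\<omega>. (w b \<omega> - w a \<omega>) * step_integral w (q # qs) \<omega>)
    = expectation (\<lambda>\<omega>. k * ((w b \<omega> - w a \<omega>) * (w d \<omega> - w c \<omega>)) + (w b \<omega> - w a \<omega>) * step_integral w qs \<omega>)"
    by (intro Bochner_Integration.integral_cong) (auto simp: q step_integral_def algebra_simps)
  also have "\<dots> = k * expectation (\<lambda>\<omega>. (w b \<omega> - w a \<omega>) * (w d \<omega> - w c \<omega>))
     + expectation (\<lambda>\<omega>. (w b \<omega> - w a \<omega>) * step_integral w qs \<omega>)"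
    using L2fun_mult[OF X Y] L2fun_mult[OF X step_integral_L2[OF qs]] by simp
  also have "\<dots> = (LINT s|lborel. k * (indicat_real {a<..b} s * indicat_real {c<..d} s) + indicat_real {a<..b} s * step_fun qs s)"
    using L2fun_mult[OF I[of a b] I[of c d]] L2fun_mult[OF I[of a b] step_fun_L2[of qs]]
    by (simp add: increment_isometry assms(2,3) cd Cons.IH[OF qs])
  also have "\<dots> = (LINT s|lborel. indicat_real {a<..b} s * step_fun (q # qs) s)"
    by (intro Bochner_Integration.integral_cong) (auto simp: q step_fun_def algebra_simps)
  finally show ?case .
qed

lemma step_isometry:
  assumes "nonneg_steps ps" "nonneg_steps qs"
  shows "expectation (\<lambda>\<omega>. step_integral w ps \<omega> * step_integral w qs \<omega>)
    = (LINT s|lborel. step_fun ps s * step_fun qs s)"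
  using assms(1)
proof (induction ps)
  case Nil
  show ?case by (simp add: step_integral_def step_fun_def)
next
  case (Cons p ps)
  obtain a b k where p: "p = (a, b, k)" by (cases p)
  have ab: "0 \<le> a" "a \<le> b" and ps: "nonneg_steps ps" using Cons.prems by (auto simp: p)
  note X = brownian_increment_variance(1)[OF ab] and Q = step_integral_L2[OF assms(2)]
  have I: "(\<lambda>s. indicat_real {a<..b} s) \<in> L2fun lborel" for a b :: real
    using step_fun_L2[of "[(a, b, 1)]"] by (simp add: step_fun_def[abs_def])
  have "expectation (\<lambda>\<omega>. step_integral w (p # ps) \<omega> * step_integral w qs \<omega>)
    = expectation (\<lambda>\<omega>. k * ((w b \<omega> - w a \<omega>) * step_integral w qs \<omega>) + step_integral w ps \<omega> * step_integral w qs \<omega>)"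
    by (intro Bochner_Integration.integral_cong) (auto simp: p step_integral_def algebra_simps)
  also have "\<dots> = k * expectation (\<lambda>\<omega>. (w b \<omega> - w a \<omega>) * step_integral w qs \<omega>)
     + expectation (\<lambda>\<omega>. step_integral w ps \<omega> * step_integral w qs \<omega>)"
    using L2fun_mult[OF X Q] L2fun_mult[OF step_integral_L2[OF ps] Q] by simp
  also have "\<dots> = (LINT s|lborel. k * (indicat_real {a<..b} s * step_fun qs s) + step_fun ps s * step_fun qs s)"
    using L2fun_mult[OF I[of a b] step_fun_L2[of qs]] L2fun_mult[OF step_fun_L2[of ps] step_fun_L2[of qs]]
    by (simp add: step_isometry1[OF assms(2) ab] Cons.IH[OF ps])
  also have "\<dots> = (LINT s|lborel. step_fun (p # ps) s * step_fun qs s)"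
    by (intro Bochner_Integration.integral_cong) (auto simp: p step_fun_def algebra_simps)
  finally show ?case .
qed

text \<open>An F(0)-measurable f is F(a)-measurable for the left end a of every step, hence
  orthogonal to each increment.\<close>

lemma step_integral_orthogonal_initial:
  assumes f: "f \<in> borel_measurable (F 0)" "f \<in> L2fun M" and "nonneg_steps ps"
  shows "expectation (\<lambda>\<omega>. f \<omega> * step_integral w ps \<omega>) = 0"
  using assms(3)
proof (induction ps)
  case Nil
  show ?case by (simp add: step_integral_def)
next
  case (Cons p ps)
  obtain a b k where p: "p = (a, b, k)" by (cases p)
  have ab: "0 \<le> a" "a \<le> b" and ps: "nonneg_steps ps" using Cons.prems by (auto simp: p)
  note X = brownian_increment_variance(1)[OF ab]
  have "expectation (\<lambda>\<omega>. f \<omega> * step_integral w (p # ps) \<omega>)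
    = expectation (\<lambda>\<omega>. k * (f \<omega> * (w b \<omega> - w a \<omega>)) + f \<omega> * step_integral w ps \<omega>)"
    by (intro Bochner_Integration.integral_cong) (auto simp: p step_integral_def algebra_simps)
  also have "\<dots> = k * expectation (\<lambda>\<omega>. f \<omega> * (w b \<omega> - w a \<omega>)) + expectation (\<lambda>\<omega>. f \<omega> * step_integral w ps \<omega>)"
    using L2fun_mult[OF f(2) X] L2fun_mult[OF f(2) step_integral_L2[OF ps]] by simp
  also have "\<dots> = 0"
    using brownian_increment_adapted[OF ab adapted_mono[OF order_refl ab(1) f(1)] f(2)] Cons.IH[OF ps] by simp
  finally show ?case .
qed

text \<open>Recasts the approximation on the whole real line, so that integrals with different upper
  limits t can be multiplied under one measure.\<close>

lemma wiener_integral_approx: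
  fixes \<phi> :: "real \<Rightarrow> real"
  assumes "has_wiener_integral M w t \<phi> I"
  shows "\<exists>ps. (\<forall>n. nonneg_steps (ps n))
    \<and> (\<lambda>n. \<integral>\<^sup>+s. ennreal ((indicator {0..t} s * \<phi> s - step_fun (ps n) s)\<^sup>2) \<partial>lborel) \<longlonglongrightarrow> 0
    \<and> (\<lambda>n. \<integral>\<^sup>+\<omega>. ennreal ((I \<omega> - step_integral w (ps n) \<omega>)\<^sup>2) \<partial>M) \<longlonglongrightarrow> 0"
proof -
  from assms have "\<exists>ps :: nat \<Rightarrow> (real \<times> real \<times> real) list.
        (\<forall>n. \<forall>(a, b, c)\<in>set (ps n). 0 \<le> a \<and> a \<le> b \<and> b \<le> t) \<and>
        (\<lambda>n. \<integral>\<^sup>+s\<in>{0..t}. ennreal ((norm (\<phi> s - step_fun (ps n) s))\<^sup>2) \<partial>lborel) \<longlonglongrightarrow> 0 \<and>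
        (\<lambda>n. \<integral>\<^sup>+\<omega>. ennreal ((norm (I \<omega> - step_integral w (ps n) \<omega>))\<^sup>2) \<partial>M) \<longlonglongrightarrow> 0"
    unfolding has_wiener_integral_def by (elim conjE)
  then obtain ps :: "nat \<Rightarrow> (real \<times> real \<times> real) list"
    where ps: "\<forall>n. \<forall>(a, b, c)\<in>set (ps n). 0 \<le> a \<and> a \<le> b \<and> b \<le> t"
    and lim: "(\<lambda>n. \<integral>\<^sup>+s\<in>{0..t}. ennreal ((norm (\<phi> s - step_fun (ps n) s))\<^sup>2) \<partial>lborel) \<longlonglongrightarrow> 0"
      "(\<lambda>n. \<integral>\<^sup>+\<omega>. ennreal ((norm (I \<omega> - step_integral w (ps n) \<omega>))\<^sup>2) \<partial>M) \<longlonglongrightarrow> 0"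
    by (elim exE conjE)
  \<comment> \<open>All intervals (a, b] of the list lie in {0..t}, so outside it the step functions
    vanish together with the truncated integrand.\<close>
  have zero: "step_fun qs s = 0" if "\<forall>(a, b, c)\<in>set qs. 0 \<le> a \<and> a \<le> b \<and> b \<le> t" "s \<notin> {0..t}"
    for qs :: "(real \<times> real \<times> real) list" and s
    using that by (induction qs) (auto simp: step_fun_def indicator_def)
  have "(\<integral>\<^sup>+s\<in>{0..t}. ennreal ((norm (\<phi> s - step_fun (ps n) s))\<^sup>2) \<partial>lborel)
    = (\<integral>\<^sup>+s. ennreal ((indicator {0..t} s * \<phi> s - step_fun (ps n) s)\<^sup>2) \<partial>lborel)" for n
    using zero[OF ps[THEN spec, of n]] by (intro nn_integral_cong) (auto simp: indicator_def)
  with lim have *: "(\<lambda>n. \<integral>\<^sup>+s. ennreal ((indicator {0..t} s * \<phi> s - step_fun (ps n) s)\<^sup>2) \<partial>lborel) \<longlonglongrightarrow> 0"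
    "(\<lambda>n. \<integral>\<^sup>+\<omega>. ennreal ((I \<omega> - step_integral w (ps n) \<omega>)\<^sup>2) \<partial>M) \<longlonglongrightarrow> 0"
    by simp_all
  have "nonneg_steps (ps n)" for n using ps[THEN spec, of n] by fast
  then show ?thesis using * by (intro exI[of _ ps] conjI allI)
qed

lemma wiener_integral_measurable:
  fixes \<phi> :: "real \<Rightarrow> real"
  assumes "has_wiener_integral M w t \<phi> I"
  shows "I \<in> borel_measurable M" and "(\<lambda>s. indicator {0..t} s * \<phi> s) \<in> borel_measurable lborel"
proof -
  show "I \<in> borel_measurable M" by (rule has_wiener_integral_measurable[OF assms])
  have "\<phi> \<in> borel_measurable (restrict_space lborel {0..t})"
    using assms by (simp add: has_wiener_integral_def)
  then show "(\<lambda>s. indicator {0..t} s * \<phi> s) \<in> borel_measurable lborel"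
    by (subst (asm) borel_measurable_restrict_space_iff) auto
qed

lemma wiener_integral_L2:
  fixes \<phi> :: "real \<Rightarrow> real"
  assumes I: "has_wiener_integral M w t \<phi> I"
  shows "I \<in> L2fun M"
proof -
  obtain ps where "\<forall>n. nonneg_steps (ps n)"
    and "(\<lambda>n. \<integral>\<^sup>+s. ennreal ((indicator {0..t} s * \<phi> s - step_fun (ps n) s)\<^sup>2) \<partial>lborel) \<longlonglongrightarrow> 0"
    and "(\<lambda>n. \<integral>\<^sup>+\<omega>. ennreal ((I \<omega> - step_integral w (ps n) \<omega>)\<^sup>2) \<partial>M) \<longlonglongrightarrow> 0"
    using wiener_integral_approx[OF I] by (elim exE conjE)
  note approx = this
  show "I \<in> L2fun M"
    by (rule L2_limit(1)[OF step_integral_L2[OF approx(1)[THEN spec]] wiener_integral_measurable(1)[OF I] approx(3)])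
qed

text \<open>The Ito isometry in bilinear form with two upper limits, as needed for the covariance of
  a stochastic convolution at two times. The identity for step functions is passed to the limit on
  both sides.\<close>

theorem wiener_isometry:
  fixes \<phi> \<psi> :: "real \<Rightarrow> real"
  assumes I: "has_wiener_integral M w t \<phi> I" and J: "has_wiener_integral M w s \<psi> J"
  shows "expectation (\<lambda>\<omega>. I \<omega> * J \<omega>)
    = (LINT r|lborel. (indicator {0..t} r * \<phi> r) * (indicator {0..s} r * \<psi> r))"
proof -
  obtain ps where ps: "\<forall>n. nonneg_steps (ps n)"
    and ps_fun: "(\<lambda>n. \<integral>\<^sup>+s. ennreal ((indicator {0..t} s * \<phi> s - step_fun (ps n) s)\<^sup>2) \<partial>lborel) \<longlonglongrightarrow> 0"
    and ps_int: "(\<lambda>n. \<integral>\<^sup>+\<omega>. ennreal ((I \<omega> - step_integral w (ps n) \<omega>)\<^sup>2) \<partial>M) \<longlonglongrightarrow> 0"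
    using wiener_integral_approx[OF I] by (elim exE conjE)
  obtain qs where qs: "\<forall>n. nonneg_steps (qs n)"
    and qs_fun: "(\<lambda>n. \<integral>\<^sup>+r. ennreal ((indicator {0..s} r * \<psi> r - step_fun (qs n) r)\<^sup>2) \<partial>lborel) \<longlonglongrightarrow> 0"
    and qs_int: "(\<lambda>n. \<integral>\<^sup>+\<omega>. ennreal ((J \<omega> - step_integral w (qs n) \<omega>)\<^sup>2) \<partial>M) \<longlonglongrightarrow> 0"
    using wiener_integral_approx[OF J] by (elim exE conjE)
  have "(\<lambda>n. expectation (\<lambda>\<omega>. step_integral w (ps n) \<omega> * step_integral w (qs n) \<omega>))
    \<longlonglongrightarrow> expectation (\<lambda>\<omega>. I \<omega> * J \<omega>)"
    by (intro L2_limit_inner step_integral_L2 ps[THEN spec] qs[THEN spec] ps_int qs_int wiener_integral_measurable[OF I] wiener_integral_measurable[OF J])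
  moreover have "(\<lambda>n. LINT r|lborel. step_fun (ps n) r * step_fun (qs n) r)
    \<longlonglongrightarrow> (LINT r|lborel. (indicator {0..t} r * \<phi> r) * (indicator {0..s} r * \<psi> r))"
    by (intro L2_limit_inner step_fun_L2 ps_fun qs_fun wiener_integral_measurable[OF I] wiener_integral_measurable[OF J])
  ultimately show ?thesis
    unfolding step_isometry[OF ps[THEN spec] qs[THEN spec]] by (rule LIMSEQ_unique)
qed

text \<open>Orthogonality survives the mean square limit; f itself is approximated by a constant
  sequence.\<close>

lemma wiener_integral_orthogonal_initial:
  fixes \<phi> :: "real \<Rightarrow> real"
  assumes I: "has_wiener_integral M w t \<phi> I" and f: "f \<in> borel_measurable (F 0)" "f \<in> L2fun M"
  shows "expectation (\<lambda>\<omega>. f \<omega> * I \<omega>) = 0"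
proof -
  obtain ps where ps: "\<forall>n. nonneg_steps (ps n)"
    and ps_int: "(\<lambda>n. \<integral>\<^sup>+\<omega>. ennreal ((I \<omega> - step_integral w (ps n) \<omega>)\<^sup>2) \<partial>M) \<longlonglongrightarrow> 0"
    using wiener_integral_approx[OF I] by (elim exE conjE)
  have "(\<lambda>n. expectation (\<lambda>\<omega>. f \<omega> * step_integral w (ps n) \<omega>)) \<longlonglongrightarrow> expectation (\<lambda>\<omega>. f \<omega> * I \<omega>)"
    by (intro L2_limit_inner step_integral_L2 ps[THEN spec] ps_int f L2fun_measurable[OF f(2)] wiener_integral_measurable[OF I]) simp
  then show ?thesis
    by (simp add: step_integral_orthogonal_initial[OF f ps[THEN spec]] LIMSEQ_const_iff)
qed

end

section \<open>Vector-valued Wiener integrals under bounded functionals\<close>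

lemma step_fun_measurable [measurable]: "step_fun ps \<in> borel_measurable borel"
  for ps :: "(real \<times> real \<times> 'b::{real_normed_vector, second_countable_topology}) list"
proof (induction ps)
  case Nil
  show ?case by (simp add: step_fun_def[abs_def])
next
  case (Cons p ps)
  obtain a b c where p: "p = (a, b, c)" by (cases p)
  have "step_fun (p # ps) = (\<lambda>s. indicat_real {a<..b} s *\<^sub>R c + step_fun ps s)"
    by (simp add: step_fun_def[abs_def] p)
  moreover have "(\<lambda>s. indicat_real {a<..b} s *\<^sub>R c) \<in> borel_measurable borel" by measurable
  ultimately show ?case using Cons by simp
qed

lemma step_integral_measurable:
  fixes ps :: "(real \<times> real \<times> 'b::{real_normed_vector, second_countable_topology}) list"
  assumes w: "\<And>s. 0 \<le> s \<Longrightarrow> w s \<in> borel_measurable M"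
    and "\<forall>(a, b, c)\<in>set ps. 0 \<le> a \<and> a \<le> b \<and> b \<le> t"
  shows "step_integral w ps \<in> borel_measurable M"
  using assms(2)
proof (induction ps)
  case Nil
  show ?case by (simp add: step_integral_def[abs_def])
next
  case (Cons p ps)
  obtain a b c where p: "p = (a, b, c)" by (cases p)
  have "step_integral w (p # ps) = (\<lambda>\<omega>. (w b \<omega> - w a \<omega>) *\<^sub>R c + step_integral w ps \<omega>)"
    by (simp add: step_integral_def[abs_def] p)
  moreover have "w a \<in> borel_measurable M" "w b \<in> borel_measurable M"
    using Cons.prems w by (auto simp: p)
  then have "(\<lambda>\<omega>. (w b \<omega> - w a \<omega>) *\<^sub>R c) \<in> borel_measurable M" by measurable
  moreover have "step_integral w ps \<in> borel_measurable M" using Cons by (simp add: p)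
  ultimately show ?case by simp
qed

text \<open>Applying f to the coefficients of the approximating step functions commutes with both
  the step function and its integral, and the errors grow at most by the factor K^2. This reduces
  integrals in \<open>L2D\<close> to scalar ones.\<close>

lemma has_wiener_integral_bounded_linear:
  fixes f :: "'b::{banach, second_countable_topology} \<Rightarrow> real"
  assumes f: "bounded_linear f" and I: "has_wiener_integral M w t \<phi> I"
    and w: "\<And>s. 0 \<le> s \<Longrightarrow> w s \<in> borel_measurable M"
  shows "has_wiener_integral M w t (\<lambda>s. f (\<phi> s)) (\<lambda>\<omega>. f (I \<omega>))"
proof -
  note f_add = linear_add[OF bounded_linear.linear[OF f]]
    and f_scale = linear_scale[OF bounded_linear.linear[OF f]]
    and f_zero = linear_0[OF bounded_linear.linear[OF f]]
    and f_diff = linear_diff[OF bounded_linear.linear[OF f]]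
  obtain K where K: "0 < K" "\<And>x. norm (f x) \<le> norm x * K" using bounded_linear.pos_bounded[OF f] by metis
  have "\<exists>ps :: nat \<Rightarrow> (real \<times> real \<times> 'b) list.
        (\<forall>n. \<forall>(a, b, c)\<in>set (ps n). 0 \<le> a \<and> a \<le> b \<and> b \<le> t) \<and>
        (\<lambda>n. \<integral>\<^sup>+s\<in>{0..t}. ennreal ((norm (\<phi> s - step_fun (ps n) s))\<^sup>2) \<partial>lborel) \<longlonglongrightarrow> 0 \<and>
        (\<lambda>n. \<integral>\<^sup>+\<omega>. ennreal ((norm (I \<omega> - step_integral w (ps n) \<omega>))\<^sup>2) \<partial>M) \<longlonglongrightarrow> 0"
    using I unfolding has_wiener_integral_def by (elim conjE)
  then obtain ps :: "nat \<Rightarrow> (real \<times> real \<times> 'b) list"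
    where ps: "\<forall>n. \<forall>(a, b, c)\<in>set (ps n). 0 \<le> a \<and> a \<le> b \<and> b \<le> t"
    and lim: "(\<lambda>n. \<integral>\<^sup>+s\<in>{0..t}. ennreal ((norm (\<phi> s - step_fun (ps n) s))\<^sup>2) \<partial>lborel) \<longlonglongrightarrow> 0"
      "(\<lambda>n. \<integral>\<^sup>+\<omega>. ennreal ((norm (I \<omega> - step_integral w (ps n) \<omega>))\<^sup>2) \<partial>M) \<longlonglongrightarrow> 0"
    by (elim exE conjE)
  have [measurable]: "\<phi> \<in> borel_measurable (restrict_space lborel {0..t})" "I \<in> borel_measurable M"
    using I by (auto simp: has_wiener_integral_def)
  have fm: "f \<in> borel_measurable borel"
    by (intro borel_measurable_continuous_onI linear_continuous_on f)
  define qs where "qs n = map (\<lambda>(a, b, c). (a, b, f c)) (ps n)" for n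
  have fs: "step_fun (map (\<lambda>(a, b, c). (a, b, f c)) xs) s = f (step_fun xs s)" for xs s
    by (induction xs) (auto simp: step_fun_def f_add f_scale f_zero)
  have fi: "step_integral w (map (\<lambda>(a, b, c). (a, b, f c)) xs) \<omega> = f (step_integral w xs \<omega>)" for xs \<omega>
    by (induction xs) (auto simp: step_integral_def f_add f_scale f_zero)
  have bd: "ennreal ((norm (f x - f y))\<^sup>2) \<le> ennreal (K\<^sup>2) * ennreal ((norm (x - y))\<^sup>2)" for x y
  proof -
    have "(norm (f (x - y)))\<^sup>2 \<le> (norm (x - y) * K)\<^sup>2" by (intro power_mono K) auto
    then show ?thesis
      by (simp add: f_diff ennreal_mult[symmetric] power_mult_distrib mult.commute)
  qed
  show ?thesis
    unfolding has_wiener_integral_def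
  proof (intro conjI exI[of _ qs] allI)
    show "(\<lambda>s. f (\<phi> s)) \<in> borel_measurable (restrict_space lborel {0..t})"
      "(\<lambda>\<omega>. f (I \<omega>)) \<in> borel_measurable M"
      by (rule measurable_compose[OF _ fm], measurable)+
    show "\<forall>(a, b, c)\<in>set (qs n). 0 \<le> a \<and> a \<le> b \<and> b \<le> t" for n
      using ps[THEN spec, of n] by (force simp: qs_def)
    let ?a = "\<lambda>n. \<integral>\<^sup>+s\<in>{0..t}. ennreal ((norm (\<phi> s - step_fun (ps n) s))\<^sup>2) \<partial>lborel"
    have lim': "(\<lambda>n. ennreal (K\<^sup>2) * a n) \<longlonglongrightarrow> 0" if "a \<longlonglongrightarrow> 0" for a :: "nat \<Rightarrow> ennreal"
      using ennreal_tendsto_cmult[OF _ that, of "ennreal (K\<^sup>2)"] by simp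
    have [measurable]: "step_integral w (ps n) \<in> borel_measurable M" for n
      by (rule step_integral_measurable[OF w ps[THEN spec, of n]])
    have cm: "(\<integral>\<^sup>+x. ennreal (K\<^sup>2) * g x \<partial>N) \<le> ennreal (K\<^sup>2) * (\<integral>\<^sup>+x. g x \<partial>N)"
      if "g \<in> borel_measurable N" for g :: "'z \<Rightarrow> ennreal" and N
      using that by (simp add: nn_integral_cmult)
    \<comment> \<open>The integrand is measurable only on {0..t}. Its truncation is Borel on the
      line and agrees with it wherever the indicator in the error integral is nonzero.\<close>
    have "(\<lambda>s. indicator {0..t} s *\<^sub>R \<phi> s) \<in> borel_measurable lborel"
      using \<open>\<phi> \<in> _\<close> by (subst (asm) borel_measurable_restrict_space_iff) auto
    then have [measurable]: "(\<lambda>s. indicator {0..t} s *\<^sub>R \<phi> s) \<in> borel_measurable borel" by simp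
    have "(\<lambda>s. ennreal ((norm (indicator {0..t} s *\<^sub>R \<phi> s - step_fun (ps n) s))\<^sup>2) * indicator {0..t} s)
        \<in> borel_measurable lborel" for n
      by measurable
    moreover have "(\<lambda>s. ennreal ((norm (indicator {0..t} s *\<^sub>R \<phi> s - step_fun (ps n) s))\<^sup>2) * indicator {0..t} s)
        = (\<lambda>s. ennreal ((norm (\<phi> s - step_fun (ps n) s))\<^sup>2) * indicator {0..t} s)" for n
      by (auto simp: indicator_def)
    ultimately have \<phi>_meas: "(\<lambda>s. ennreal ((norm (\<phi> s - step_fun (ps n) s))\<^sup>2) * indicator {0..t} s)
        \<in> borel_measurable lborel" for n
      by simp
    show "(\<lambda>n. \<integral>\<^sup>+s\<in>{0..t}. ennreal ((norm (f (\<phi> s) - step_fun (qs n) s))\<^sup>2) \<partial>lborel) \<longlonglongrightarrow> 0"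
    proof (rule tendsto_sandwich[OF _ _ tendsto_const lim'[OF lim(1)]])
      show "\<forall>\<^sub>F n in sequentially. (\<integral>\<^sup>+s\<in>{0..t}. ennreal ((norm (f (\<phi> s) - step_fun (qs n) s))\<^sup>2) \<partial>lborel)
         \<le> ennreal (K\<^sup>2) * ?a n"
        unfolding fs qs_def
        by (intro always_eventually allI order_trans[OF nn_integral_mono cm] \<phi>_meas)
           (use bd in \<open>auto simp: indicator_def\<close>)
    qed simp
    show "(\<lambda>n. \<integral>\<^sup>+\<omega>. ennreal ((norm (f (I \<omega>) - step_integral w (qs n) \<omega>))\<^sup>2) \<partial>M) \<longlonglongrightarrow> 0"
    proof (rule tendsto_sandwich[OF _ _ tendsto_const lim'[OF lim(2)]])
      show "\<forall>\<^sub>F n in sequentially. (\<integral>\<^sup>+\<omega>. ennreal ((norm (f (I \<omega>) - step_integral w (qs n) \<omega>))\<^sup>2) \<partial>M)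
         \<le> ennreal (K\<^sup>2) * (\<integral>\<^sup>+\<omega>. ennreal ((norm (I \<omega> - step_integral w (ps n) \<omega>))\<^sup>2) \<partial>M)"
        unfolding fi qs_def
        by (intro always_eventually allI order_trans[OF nn_integral_mono cm]) (use bd in auto)
    qed simp
  qed
qed

section \<open>Second moments of linear Volterra equations\<close>

text \<open>Time as a probability space: it serves as the parameter space of processes and later
  also as the sample space of a comparison process.\<close>

definition unit_interval :: "real measure" where
  "unit_interval = restrict_space lborel {0..1}"

lemma space_unit_interval [simp]: "space unit_interval = {0..1}"
  by (simp add: unit_interval_def space_restrict_space)

lemma prob_space_unit_interval: "prob_space unit_interval"
  by (rule prob_spaceI) (simp add: unit_interval_def emeasure_restrict_space space_restrict_space)

interpretation unit_interval: prob_space unit_interval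
  by (rule prob_space_unit_interval)

lemma integral_unit_interval:
  "(LINT s|unit_interval. f s) = (LINT s:{0..1}|lborel. f s)" for f :: "real \<Rightarrow> real"
  unfolding unit_interval_def set_lebesgue_integral_def by (subst integral_restrict_space) auto

lemma integrable_unit_interval:
  "integrable unit_interval f \<longleftrightarrow> set_integrable lborel {0..1} f" for f :: "real \<Rightarrow> real"
  unfolding unit_interval_def set_integrable_def by (subst integrable_restrict_space) auto

lemma measurable_ident_unit_interval [measurable]: "(\<lambda>x. x) \<in> borel_measurable unit_interval"
  unfolding unit_interval_def by (intro measurable_restrict_space1) simp

text \<open>The cutoff at s \<le> t encodes causality, so all Volterra integrals run over the fixed
  interval {0..1} and compositions of kernels are ordinary double integrals.\<close>

definition kern :: "real \<Rightarrow> real \<Rightarrow> real \<Rightarrow> real" where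
  "kern c t s = (if s \<le> t then exp (c * (t - s)) else 0)"

lemma kern_measurable [measurable (raw)]:
  assumes [measurable]: "f \<in> borel_measurable M" "g \<in> borel_measurable M"
  shows "(\<lambda>x. kern c (f x) (g x)) \<in> borel_measurable M"
  unfolding kern_def by measurable

lemma kern_bound:
  assumes "t \<in> {0..1}" "s \<in> {0..1}"
  shows "\<bar>kern c t s\<bar> \<le> exp \<bar>c\<bar>"
proof -
  have "\<bar>c\<bar> * \<bar>t - s\<bar> \<le> \<bar>c\<bar> * 1" using assms by (intro mult_left_mono) auto
  moreover have "c * (t - s) \<le> \<bar>c\<bar> * \<bar>t - s\<bar>"
    using abs_ge_self[of "c * (t - s)"] by (simp add: abs_mult)
  ultimately show ?thesis by (simp add: kern_def)
qed

text \<open>The fundamental theorem of calculus in the form suited to cut-off integrands: they need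
  to match a smooth g only on {r..t} and vanish on the rest of {0..1}.\<close>

lemma integral_kern_aux:
  assumes "0 \<le> r" "r \<le> t" "t \<le> 1"
    and "\<And>s. s \<in> {r..t} \<Longrightarrow> f s = g s" "\<And>s. s \<in> {0..1} \<Longrightarrow> s \<notin> {r..t} \<Longrightarrow> f s = 0"
    and "\<And>s. DERIV G s :> g s" "\<And>s. isCont g s"
  shows "(LINT s|unit_interval. f s) = G t - G r"
proof -
  have "(LINT s|unit_interval. f s) = (LINT s|lborel. g s * indicator {r..t} s)"
    unfolding integral_unit_interval set_lebesgue_integral_def
    using assms(1-5) by (intro Bochner_Integration.integral_cong) (auto simp: indicator_def)
  also have "\<dots> = G t - G r"
    by (rule integral_FTC_Icc_real) (use assms in auto)
  finally show ?thesis .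
qed

text \<open>
  For \<open>\<theta> = a + b\<close> this is the resolvent equation of the Volterra kernel \<open>\<theta> e\<^bsup>-a(t-s)\<^esup>\<close>: its resolvent is
  \<open>\<theta> e\<^bsup>b(t-s)\<^esup>\<close>.
\<close>

lemma kern_resolvent:
  assumes r: "r \<in> {0..1}" and t: "t \<in> {0..1}"
  shows "(a + b) * (LINT s|unit_interval. kern b t s * kern (- a) s r) = kern b t r - kern (- a) t r"
proof (cases "r \<le> t")
  case True
  have "(LINT s|unit_interval. (a + b) * (kern b t s * kern (- a) s r))
    = - exp (b * (t - t) - a * (t - r)) - (- exp (b * (t - r) - a * (r - r)))"
  proof (rule integral_kern_aux[where G = "\<lambda>s. - exp (b * (t - s) - a * (s - r))"
        and g = "\<lambda>s. (a + b) * exp (b * (t - s) - a * (s - r))"])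
    show "(a + b) * (kern b t s * kern (- a) s r) = (a + b) * exp (b * (t - s) - a * (s - r))" if "s \<in> {r..t}" for s
      using that by (simp add: kern_def exp_add[symmetric])
    show "(a + b) * (kern b t s * kern (- a) s r) = 0" if "s \<notin> {r..t}" for s
      using that by (auto simp: kern_def)
    show "((\<lambda>s. - exp (b * (t - s) - a * (s - r))) has_real_derivative (a + b) * exp (b * (t - s) - a * (s - r))) (at s)" for s
      by (auto intro!: derivative_eq_intros simp: algebra_simps)
  qed (use True r t in \<open>auto intro!: continuous_intros\<close>)
  then show ?thesis using True by (simp add: kern_def)
next
  case False
  then have "(LINT s|unit_interval. kern b t s * kern (- a) s r) = (LINT s|unit_interval. 0)"
    by (intro Bochner_Integration.integral_cong) (auto simp: kern_def)
  moreover have "kern b t r = 0" "kern (- a) t r = 0" using False by (auto simp: kern_def)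
  ultimately show ?thesis by simp
qed

lemma integrable_kern_mult:
  assumes x: "integrable unit_interval x" and t: "t \<in> {0..1}"
  shows "integrable unit_interval (\<lambda>s. kern c t s * x s)"
proof (rule Bochner_Integration.integrable_bound[where f = "\<lambda>s. exp \<bar>c\<bar> * x s"])
  note [measurable] = borel_measurable_integrable[OF x]
  show "(\<lambda>s. kern c t s * x s) \<in> borel_measurable unit_interval" by measurable
  show "AE s in unit_interval. norm (kern c t s * x s) \<le> norm (exp \<bar>c\<bar> * x s)"
    using kern_bound[OF t, of _ c] by (intro AE_I2) (auto simp: abs_mult intro!: mult_right_mono)
qed (use x in simp)

text \<open>A bounded kernel times an integrable path is integrable over the square, so the two
  integrals can be exchanged. The inner integral is then the composed kernel evaluated by
  \<open>kern_resolvent\<close>.\<close>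

lemma kern_comp_Fubini:
  assumes x: "integrable unit_interval x" and t: "t \<in> {0..1}"
  shows "(LINT s|unit_interval. kern b t s * (LINT r|unit_interval. kern c s r * x r))
    = (LINT r|unit_interval. (LINT s|unit_interval. kern b t s * kern c s r) * x r)"
    and "integrable unit_interval (\<lambda>s. LINT r|unit_interval. kern c s r * x r)"
proof -
  interpret P: pair_sigma_finite unit_interval unit_interval ..
  note [measurable] = borel_measurable_integrable[OF x]
  have bound: "integrable (unit_interval \<Otimes>\<^sub>M unit_interval) (\<lambda>(s, r). k s r * x r)"
    if [measurable]: "(\<lambda>(s, r). k s r) \<in> borel_measurable (unit_interval \<Otimes>\<^sub>M unit_interval)"
      and k: "\<And>s r. s \<in> {0..1} \<Longrightarrow> r \<in> {0..1} \<Longrightarrow> \<bar>k s r\<bar> \<le> K" for k K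
  proof (rule Bochner_Integration.integrable_bound[where f = "\<lambda>(s, r). K * x r"])
    show "integrable (unit_interval \<Otimes>\<^sub>M unit_interval) (\<lambda>(s, r). K * x r)"
      using x by (intro P.Fubini_integrable) (simp_all add: case_prod_beta)
    show "AE p in unit_interval \<Otimes>\<^sub>M unit_interval. norm (case p of (s, r) \<Rightarrow> k s r * x r) \<le> norm (case p of (s, r) \<Rightarrow> K * x r)"
    proof (rule AE_I2)
      fix p assume "p \<in> space (unit_interval \<Otimes>\<^sub>M unit_interval)"
      then have "fst p \<in> {0..1}" "snd p \<in> {0..1}" by (auto simp: space_pair_measure)
      from k[OF this] have "\<bar>k (fst p) (snd p)\<bar> \<le> \<bar>K\<bar>" by linarith
      then show "norm (case p of (s, r) \<Rightarrow> k s r * x r) \<le> norm (case p of (s, r) \<Rightarrow> K * x r)"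
        by (simp add: case_prod_beta abs_mult mult_right_mono)
    qed
  qed measurable
  have "integrable (unit_interval \<Otimes>\<^sub>M unit_interval) (\<lambda>(s, r). kern c s r * x r)"
    by (rule bound[where K = "exp \<bar>c\<bar>"]) (auto intro: kern_bound)
  from P.integrable_fst'[OF this]
  show "integrable unit_interval (\<lambda>s. LINT r|unit_interval. kern c s r * x r)" by simp
  have "integrable (unit_interval \<Otimes>\<^sub>M unit_interval) (\<lambda>(s, r). kern b t s * kern c s r * x r)"
  proof (rule bound[where K = "exp \<bar>b\<bar> * exp \<bar>c\<bar>"])
    show "\<bar>kern b t s * kern c s r\<bar> \<le> exp \<bar>b\<bar> * exp \<bar>c\<bar>" if "s \<in> {0..1}" "r \<in> {0..1}" for s r
      unfolding abs_mult using that t by (intro mult_mono kern_bound) auto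
  qed measurable
  from P.Fubini_integral[OF this]
  show "(LINT s|unit_interval. kern b t s * (LINT r|unit_interval. kern c s r * x r))
    = (LINT r|unit_interval. (LINT s|unit_interval. kern b t s * kern c s r) * x r)"
    by (simp add: mult.assoc flip: integral_mult_left_zero)
qed

text \<open>As \<open>y\<close> is the residual of the equation by definition, this is a
  deterministic identity for any integrable path. It follows by applying the resolvent kernel to y
  and simplifying each term with \<open>kern_resolvent\<close>.\<close>

theorem volterra_solution:
  fixes x :: "real \<Rightarrow> real" and a b x0 :: real
  assumes x: "integrable unit_interval x" and t: "t \<in> {0..1}"
  defines "y \<equiv> \<lambda>s. x s - exp (- a * s) * x0 - (a + b) * (LINT r|unit_interval. kern (- a) s r * x r)"
  shows "x t = exp (b * t) * x0 + (y t + (a + b) * (LINT s|unit_interval. kern b t s * y s))"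
proof -
  define A where "A s = (LINT r|unit_interval. kern (- a) s r * x r)" for s
  have A: "integrable unit_interval A"
    unfolding A_def by (rule kern_comp_Fubini[OF x t])
  have E: "integrable unit_interval (\<lambda>s. exp (- a * s) * x0)"
    unfolding integrable_unit_interval
    by (intro borel_integrable_atLeastAtMost' continuous_intros)
  have y: "y s = x s - exp (- a * s) * x0 - (a + b) * A s" for s
    by (simp add: y_def A_def)
  \<comment> \<open>After Fubini the composed kernel is a difference of two kernels; the one with
    rate -a restores A at time t.\<close>
  have "(a + b) * (LINT s|unit_interval. kern b t s * A s)
      = (a + b) * (LINT r|unit_interval. (LINT s|unit_interval. kern b t s * kern (- a) s r) * x r)"
    unfolding A_def by (subst kern_comp_Fubini(1)[OF x t]) simp
  also have "\<dots> = (LINT r|unit_interval. ((a + b) * (LINT s|unit_interval. kern b t s * kern (- a) s r)) * x r)"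
    by (simp add: mult.assoc)
  also have "\<dots> = (LINT r|unit_interval. kern b t r * x r - kern (- a) t r * x r)"
    using t by (intro Bochner_Integration.integral_cong refl) (subst kern_resolvent, auto simp: left_diff_distrib)
  also have "\<dots> = (LINT r|unit_interval. kern b t r * x r) - A t"
    unfolding A_def by (intro Bochner_Integration.integral_diff integrable_kern_mult x t)
  finally have 1: "(a + b) * (LINT s|unit_interval. kern b t s * A s)
    = (LINT r|unit_interval. kern b t r * x r) - A t" .
  \<comment> \<open>The initial term is a kernel with starting time 0, so the resolvent equation at
    r = 0 evaluates it as well.\<close>
  have k0: "kern c u 0 = exp (c * u)" if "0 \<le> u" for c u
    using that by (simp add: kern_def)
  have "(LINT s|unit_interval. kern b t s * (exp (- a * s) * x0))
    = (LINT s|unit_interval. kern b t s * kern (- a) s 0 * x0)"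
    by (intro Bochner_Integration.integral_cong) (auto simp: k0)
  also have "\<dots> = (LINT s|unit_interval. kern b t s * kern (- a) s 0) * x0"
    by simp
  finally have "(a + b) * (LINT s|unit_interval. kern b t s * (exp (- a * s) * x0))
    = (a + b) * (LINT s|unit_interval. kern b t s * kern (- a) s 0) * x0"
    by (simp only: mult.assoc)
  also have "(a + b) * (LINT s|unit_interval. kern b t s * kern (- a) s 0) = exp (b * t) - exp (- a * t)"
    using t by (subst kern_resolvent) (auto simp: k0)
  finally have 2: "(a + b) * (LINT s|unit_interval. kern b t s * (exp (- a * s) * x0))
    = (exp (b * t) - exp (- a * t)) * x0" .
  have "(LINT s|unit_interval. kern b t s * y s)
    = (LINT s|unit_interval. kern b t s * x s - kern b t s * (exp (- a * s) * x0) - (a + b) * (kern b t s * A s))"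
    by (intro Bochner_Integration.integral_cong) (auto simp: y algebra_simps)
  also have "\<dots> = (LINT s|unit_interval. kern b t s * x s) - (LINT s|unit_interval. kern b t s * (exp (- a * s) * x0))
     - (a + b) * (LINT s|unit_interval. kern b t s * A s)"
    using integrable_kern_mult[OF x t, of b] integrable_kern_mult[OF A t, of b] integrable_kern_mult[OF E t, of b]
    by simp
  \<comment> \<open>The integral of \<open>kern b t s * x s\<close> cancels, which removes the
    unknown path from the right-hand side.\<close>
  finally have "(LINT s|unit_interval. kern b t s * y s)
    = A t - (LINT s|unit_interval. kern b t s * (exp (- a * s) * x0))" using 1 by simp
  then have "(a + b) * (LINT s|unit_interval. kern b t s * y s)
    = (a + b) * A t - (exp (b * t) - exp (- a * t)) * x0"
    using 2 by (simp add: right_diff_distrib)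
  then show "x t = exp (b * t) * x0 + (y t + (a + b) * (LINT s|unit_interval. kern b t s * y s))"
    by (simp add: y algebra_simps)
qed

text \<open>Uniformly bounded second moments over a finite parameter measure make y square
  integrable on the product space. Cauchy-Schwarz in the parameter gives the first claim, Fubini the
  second.\<close>

lemma L2_integral_process:
  fixes y :: "'b \<Rightarrow> 'a \<Rightarrow> real"
  assumes N: "finite_measure N" and M: "finite_measure M"
    and y [measurable]: "(\<lambda>(s, \<omega>). y s \<omega>) \<in> borel_measurable (N \<Otimes>\<^sub>M M)"
    and bound: "\<forall>s\<in>space N. (\<integral>\<^sup>+\<omega>. ennreal ((y s \<omega>)\<^sup>2) \<partial>M) \<le> ennreal K"
  shows "(\<lambda>\<omega>. LINT s|N. y s \<omega>) \<in> L2fun M"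
    and "\<eta> \<in> L2fun M \<Longrightarrow> (LINT \<omega>|M. \<eta> \<omega> * (LINT s|N. y s \<omega>)) = (LINT s|N. LINT \<omega>|M. \<eta> \<omega> * y s \<omega>)"
proof -
  interpret N: finite_measure N by (rule N)
  interpret M: finite_measure M by (rule M)
  interpret P: pair_sigma_finite N M ..
  let ?V = "\<lambda>\<omega>. LINT s|N. y s \<omega>"
  have [measurable]: "?V \<in> borel_measurable M" by measurable
  have fin: "(\<integral>\<^sup>+s. \<integral>\<^sup>+\<omega>. ennreal ((y s \<omega>)\<^sup>2) \<partial>M \<partial>N) < \<infinity>"
  proof -
    have "(\<integral>\<^sup>+s. \<integral>\<^sup>+\<omega>. ennreal ((y s \<omega>)\<^sup>2) \<partial>M \<partial>N) \<le> (\<integral>\<^sup>+s. ennreal K \<partial>N)"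
      by (intro nn_integral_mono bound[rule_format])
    also have "\<dots> < \<infinity>" by (simp add: ennreal_mult_less_top N.emeasure_eq_measure)
    finally show ?thesis .
  qed
  \<comment> \<open>The 1 added to the total mass keeps the factor positive even for the zero
    measure, so the bound is infinite, hence trivial, on samples whose path is not square
    integrable.\<close>
  have CS: "ennreal ((?V \<omega>)\<^sup>2) \<le> ennreal (1 + measure N (space N)) * (\<integral>\<^sup>+s. ennreal ((y s \<omega>)\<^sup>2) \<partial>N)"
    if [measurable]: "\<omega> \<in> space M" for \<omega>
  proof (cases "(\<integral>\<^sup>+s. ennreal ((y s \<omega>)\<^sup>2) \<partial>N) < \<infinity>")
    case False
    then have "(\<integral>\<^sup>+s. ennreal ((y s \<omega>)\<^sup>2) \<partial>N) = \<top>" by (simp add: less_top[symmetric])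
    moreover have "0 < 1 + measure N (space N)" using measure_nonneg[of N "space N"] by linarith
    ultimately show ?thesis by (simp add: ennreal_mult_top)
  next
    case True
    have ym: "(\<lambda>s. y s \<omega>) \<in> borel_measurable N" by measurable
    have y2: "(\<lambda>s. y s \<omega>) \<in> L2fun N" using True ym by (simp add: L2fun_iff_nn_integral)
    have "\<bar>LINT s|N. 1 * y s \<omega>\<bar> \<le> sqrt (LINT s|N. 1\<^sup>2) * sqrt (LINT s|N. (y s \<omega>)\<^sup>2)"
      by (rule Cauchy_Schwarz_integral[OF _ y2]) (simp add: L2fun_def)
    then have "\<bar>?V \<omega>\<bar>\<^sup>2 \<le> (sqrt (measure N (space N)) * sqrt (LINT s|N. (y s \<omega>)\<^sup>2))\<^sup>2"
      by (intro power_mono) auto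
    also have "\<dots> = measure N (space N) * (LINT s|N. (y s \<omega>)\<^sup>2)" by (simp add: power_mult_distrib)
    also have "\<dots> \<le> (1 + measure N (space N)) * (LINT s|N. (y s \<omega>)\<^sup>2)" by (intro mult_right_mono) auto
    finally show ?thesis
      using L2fun_square[OF y2]
      by (simp add: nn_integral_eq_integral ennreal_mult[symmetric] ennreal_leI del: ennreal_plus)
  qed
  have "(\<integral>\<^sup>+\<omega>. ennreal ((?V \<omega>)\<^sup>2) \<partial>M)
     \<le> (\<integral>\<^sup>+\<omega>. ennreal (1 + measure N (space N)) * (\<integral>\<^sup>+s. ennreal ((y s \<omega>)\<^sup>2) \<partial>N) \<partial>M)"
    by (intro nn_integral_mono CS)
  also have "\<dots> = ennreal (1 + measure N (space N)) * (\<integral>\<^sup>+\<omega>. \<integral>\<^sup>+s. ennreal ((y s \<omega>)\<^sup>2) \<partial>N \<partial>M)"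
    by (intro nn_integral_cmult) measurable
  also have "(\<integral>\<^sup>+\<omega>. \<integral>\<^sup>+s. ennreal ((y s \<omega>)\<^sup>2) \<partial>N \<partial>M) = (\<integral>\<^sup>+s. \<integral>\<^sup>+\<omega>. ennreal ((y s \<omega>)\<^sup>2) \<partial>M \<partial>N)"
    by (intro P.Fubini') measurable
  finally have "(\<integral>\<^sup>+\<omega>. ennreal ((?V \<omega>)\<^sup>2) \<partial>M) < \<infinity>"
    using fin by (simp add: ennreal_mult_less_top order.strict_trans1)
  then show "?V \<in> L2fun M" by (simp add: L2fun_iff_nn_integral)
  assume \<eta>: "\<eta> \<in> L2fun M"
  note [measurable] = L2fun_measurable[OF \<eta>]
  \<comment> \<open>Both factors are square integrable on the product space, so their product is
    integrable there and Fubini applies.\<close>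
  have "(\<lambda>p. y (fst p) (snd p)) \<in> L2fun (N \<Otimes>\<^sub>M M)"
    using fin M.nn_integral_fst[of "\<lambda>p. ennreal ((y (fst p) (snd p))\<^sup>2)" N] y
    by (simp add: L2fun_iff_nn_integral case_prod_beta')
  moreover have "(\<lambda>p. \<eta> (snd p)) \<in> L2fun (N \<Otimes>\<^sub>M M)"
  proof -
    have "(\<integral>\<^sup>+p. ennreal ((\<eta> (snd p))\<^sup>2) \<partial>(N \<Otimes>\<^sub>M M)) = (\<integral>\<^sup>+s. \<integral>\<^sup>+\<omega>. ennreal ((\<eta> \<omega>)\<^sup>2) \<partial>M \<partial>N)"
      using M.nn_integral_fst[of "\<lambda>p. ennreal ((\<eta> (snd p))\<^sup>2)" N] by simp
    also have "\<dots> < \<infinity>"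
      using \<eta> by (simp add: L2fun_iff_nn_integral ennreal_mult_less_top N.emeasure_eq_measure)
    finally show ?thesis by (simp add: L2fun_iff_nn_integral)
  qed
  ultimately have "integrable (N \<Otimes>\<^sub>M M) (\<lambda>p. \<eta> (snd p) * y (fst p) (snd p))"
    by (intro L2fun_mult)
  then have "integrable (N \<Otimes>\<^sub>M M) (\<lambda>(s, \<omega>). \<eta> \<omega> * y s \<omega>)" by (simp add: case_prod_beta')
  from P.Fubini_integral[OF this]
  show "(LINT \<omega>|M. \<eta> \<omega> * ?V \<omega>) = (LINT s|N. LINT \<omega>|M. \<eta> \<omega> * y s \<omega>)" by simp
qed

text \<open>Expanding the square leaves products of a square integrable variable with the parameter
  integral, and each of these is handled by \<open>L2_integral_process\<close>.\<close>

lemma L2_integral_second_moment: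
  fixes y :: "'b \<Rightarrow> 'a \<Rightarrow> real"
  assumes N: "finite_measure N" and M: "finite_measure M"
    and y: "(\<lambda>(s, \<omega>). y s \<omega>) \<in> borel_measurable (N \<Otimes>\<^sub>M M)"
    and bound: "\<forall>s\<in>space N. (\<integral>\<^sup>+\<omega>. ennreal ((y s \<omega>)\<^sup>2) \<partial>M) \<le> ennreal K"
    and \<zeta>: "\<zeta> \<in> L2fun M"
  shows "(LINT \<omega>|M. (\<zeta> \<omega> + (LINT s|N. y s \<omega>))\<^sup>2)
    = (LINT \<omega>|M. (\<zeta> \<omega>)\<^sup>2) + 2 * (LINT s|N. LINT \<omega>|M. \<zeta> \<omega> * y s \<omega>)
      + (LINT s|N. LINT r|N. LINT \<omega>|M. y s \<omega> * y r \<omega>)"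
proof -
  let ?V = "\<lambda>\<omega>. LINT s|N. y s \<omega>"
  note V = L2_integral_process(1)[OF N M y bound] and VI = L2_integral_process(2)[OF N M y bound]
  have yL: "y s \<in> L2fun M" if "s \<in> space N" for s
  proof -
    have "y s \<in> borel_measurable M" using measurable_compose_Pair1[OF that y] by simp
    moreover have "(\<integral>\<^sup>+\<omega>. ennreal ((y s \<omega>)\<^sup>2) \<partial>M) < \<infinity>"
      using bspec[OF bound that] by (rule order.strict_trans1) simp
    ultimately show ?thesis by (simp add: L2fun_iff_nn_integral)
  qed
  have "(LINT \<omega>|M. (\<zeta> \<omega> + ?V \<omega>)\<^sup>2) = (LINT \<omega>|M. (\<zeta> \<omega>)\<^sup>2 + 2 * (\<zeta> \<omega> * ?V \<omega>) + ?V \<omega> * ?V \<omega>)"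
    by (intro Bochner_Integration.integral_cong) (auto simp: power2_eq_square algebra_simps)
  also have "\<dots> = (LINT \<omega>|M. (\<zeta> \<omega>)\<^sup>2) + 2 * (LINT \<omega>|M. \<zeta> \<omega> * ?V \<omega>) + (LINT \<omega>|M. ?V \<omega> * ?V \<omega>)"
    using L2fun_square[OF \<zeta>] L2fun_mult[OF \<zeta> V] L2fun_mult[OF V V] by simp
  \<comment> \<open>The exchange rule is used twice: here with the integral itself as the test
    variable, then with y(s) for each s.\<close>
  also have "(LINT \<omega>|M. ?V \<omega> * ?V \<omega>) = (LINT s|N. LINT \<omega>|M. y s \<omega> * ?V \<omega>)"
    by (subst VI[OF V]) (simp add: mult.commute)
  also have "\<dots> = (LINT s|N. LINT r|N. LINT \<omega>|M. y s \<omega> * y r \<omega>)"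
    by (intro Bochner_Integration.integral_cong refl VI yL)
  finally show ?thesis by (simp add: VI[OF \<zeta>])
qed

text \<open>Formulated for any probability space and covariance \<open>C\<close>, because it is
  applied both to the residual of a coordinate and to a deterministic process on
  \<open>unit_interval\<close>.\<close>

lemma volterra_process:
  fixes y :: "real \<Rightarrow> 'a \<Rightarrow> real"
  assumes M: "prob_space M"
    and y [measurable]: "(\<lambda>(s, \<omega>). y s \<omega>) \<in> borel_measurable (unit_interval \<Otimes>\<^sub>M M)"
    and L2: "\<forall>s\<in>{0..1}. y s \<in> L2fun M"
    and cov: "\<forall>s\<in>{0..1}. \<forall>r\<in>{0..1}. (LINT \<omega>|M. y s \<omega> * y r \<omega>) = C s r"
    and C: "\<forall>s\<in>{0..1}. C s s \<le> K"
    and t: "t \<in> {0..1}"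
  shows "(\<lambda>\<omega>. LINT s|unit_interval. \<theta> * kern b t s * y s \<omega>) \<in> L2fun M"
    and "\<eta> \<in> L2fun M \<Longrightarrow> (LINT \<omega>|M. \<eta> \<omega> * (LINT s|unit_interval. \<theta> * kern b t s * y s \<omega>))
      = (LINT s|unit_interval. \<theta> * kern b t s * (LINT \<omega>|M. \<eta> \<omega> * y s \<omega>))"
    and "(LINT \<omega>|M. (y t \<omega> + (LINT s|unit_interval. \<theta> * kern b t s * y s \<omega>))\<^sup>2)
      = C t t + 2 * (LINT s|unit_interval. \<theta> * kern b t s * C t s)
        + (LINT s|unit_interval. LINT r|unit_interval. \<theta> * kern b t s * (\<theta> * kern b t r * C s r))"
proof -
  interpret M: prob_space M by (rule M)
  let ?h = "\<lambda>s \<omega>. \<theta> * kern b t s * y s \<omega>"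
  note fin = unit_interval.finite_measure_axioms M.finite_measure_axioms
  have h: "(\<lambda>(s, \<omega>). ?h s \<omega>) \<in> borel_measurable (unit_interval \<Otimes>\<^sub>M M)" by measurable
  have bound: "\<forall>s\<in>space unit_interval. (\<integral>\<^sup>+\<omega>. ennreal ((?h s \<omega>)\<^sup>2) \<partial>M) \<le> ennreal ((\<theta> * exp \<bar>b\<bar>)\<^sup>2 * K)"
  proof
    fix s assume "s \<in> space unit_interval"
    then have s: "s \<in> {0..1}" by simp
    have "(\<integral>\<^sup>+\<omega>. ennreal ((?h s \<omega>)\<^sup>2) \<partial>M) = ennreal (LINT \<omega>|M. (?h s \<omega>)\<^sup>2)"
      using L2fun_square[OF L2fun_cmult[OF L2[rule_format, OF s], of "\<theta> * kern b t s"]]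
      by (intro nn_integral_eq_integral) auto
    also have "(LINT \<omega>|M. (?h s \<omega>)\<^sup>2) = (\<theta> * kern b t s)\<^sup>2 * C s s"
      using cov[rule_format, OF s s] by (simp add: power_mult_distrib flip: power2_eq_square)
    also have "\<dots> \<le> (\<theta> * exp \<bar>b\<bar>)\<^sup>2 * K"
    proof (rule mult_mono)
      have "\<bar>\<theta>\<bar> * \<bar>kern b t s\<bar> \<le> \<bar>\<theta>\<bar> * exp \<bar>b\<bar>"
        by (intro mult_left_mono kern_bound t s) simp
      then have "\<bar>\<theta> * kern b t s\<bar> \<le> \<bar>\<theta> * exp \<bar>b\<bar>\<bar>" by (simp add: abs_mult)
      then show "(\<theta> * kern b t s)\<^sup>2 \<le> (\<theta> * exp \<bar>b\<bar>)\<^sup>2" by (rule abs_le_square_iff[THEN iffD1])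
      show "0 \<le> C s s"
        unfolding cov[rule_format, OF s s, symmetric] by (rule Bochner_Integration.integral_nonneg) simp
      show "C s s \<le> K" using C s by blast
    qed simp
    finally show "(\<integral>\<^sup>+\<omega>. ennreal ((?h s \<omega>)\<^sup>2) \<partial>M) \<le> ennreal ((\<theta> * exp \<bar>b\<bar>)\<^sup>2 * K)"
      by (simp add: ennreal_leI)
  qed
  show "(\<lambda>\<omega>. LINT s|unit_interval. ?h s \<omega>) \<in> L2fun M"
    by (rule L2_integral_process(1)[OF fin h bound])
  have pull: "(LINT \<omega>|M. \<eta> \<omega> * ?h s \<omega>) = \<theta> * kern b t s * (LINT \<omega>|M. \<eta> \<omega> * y s \<omega>)" for \<eta> s
    by (subst Bochner_Integration.integral_mult_right_zero[symmetric], intro Bochner_Integration.integral_cong) auto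
  show "(LINT \<omega>|M. \<eta> \<omega> * (LINT s|unit_interval. ?h s \<omega>))
      = (LINT s|unit_interval. \<theta> * kern b t s * (LINT \<omega>|M. \<eta> \<omega> * y s \<omega>))" if "\<eta> \<in> L2fun M"
    using L2_integral_process(2)[OF fin h bound that] by (simp only: pull)
  have hh: "(LINT \<omega>|M. ?h s \<omega> * ?h r \<omega>) = \<theta> * kern b t s * (\<theta> * kern b t r * C s r)"
    if "s \<in> {0..1}" "r \<in> {0..1}" for s r
  proof -
    have "(LINT \<omega>|M. ?h s \<omega> * ?h r \<omega>) = (LINT \<omega>|M. (\<theta> * kern b t s * (\<theta> * kern b t r)) * (y s \<omega> * y r \<omega>))"
      by (intro Bochner_Integration.integral_cong refl) (simp only: mult_ac)
    also have "\<dots> = (\<theta> * kern b t s * (\<theta> * kern b t r)) * C s r"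
      using cov that by (subst Bochner_Integration.integral_mult_right_zero) simp
    finally show ?thesis by (simp only: mult.assoc)
  qed
  have "(LINT \<omega>|M. (y t \<omega>)\<^sup>2) = C t t"
    using cov t by (simp add: power2_eq_square)
  moreover have "(LINT s|unit_interval. LINT \<omega>|M. y t \<omega> * ?h s \<omega>) = (LINT s|unit_interval. \<theta> * kern b t s * C t s)"
    unfolding pull using cov t by (intro Bochner_Integration.integral_cong refl) simp
  moreover have "(LINT s|unit_interval. LINT r|unit_interval. LINT \<omega>|M. ?h s \<omega> * ?h r \<omega>)
     = (LINT s|unit_interval. LINT r|unit_interval. \<theta> * kern b t s * (\<theta> * kern b t r * C s r))"
    by (intro Bochner_Integration.integral_cong refl hh) simp_all
  ultimately show "(LINT \<omega>|M. (y t \<omega> + (LINT s|unit_interval. ?h s \<omega>))\<^sup>2)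
      = C t t + 2 * (LINT s|unit_interval. \<theta> * kern b t s * C t s)
        + (LINT s|unit_interval. LINT r|unit_interval. \<theta> * kern b t s * (\<theta> * kern b t r * C s r))"
    using L2_integral_second_moment[OF fin h bound L2[rule_format, OF t]] by simp
qed

text \<open>
  The second moment of \<open>y(t) + \<theta> \<integral> k(t,s) y(s) ds\<close> depends on \<open>y\<close> only through its covariance.
  A process with the covariance of the stochastic convolution lives on \<open>[0,1]\<close> itself, namely
  \<open>(s, r) \<mapsto> c e\<^bsup>-a(s-r)\<^esup> 1\<^bsub>r\<le>s\<^esub>\<close>; there the resolvent equation computes the moment.
\<close>

theorem volterra_second_moment:
  fixes x y :: "real \<Rightarrow> 'a \<Rightarrow> real" and a b c :: real
  assumes M: "prob_space M"
    and y_def: "\<And>s \<omega>. y s \<omega> = x s \<omega> - exp (- a * s) * x 0 \<omega>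
      - (a + b) * (LINT r|unit_interval. kern (- a) s r * x r \<omega>)"
    and x [measurable]: "(\<lambda>(s, \<omega>). x s \<omega>) \<in> borel_measurable (unit_interval \<Otimes>\<^sub>M M)"
    and int: "AE \<omega> in M. integrable unit_interval (\<lambda>s. x s \<omega>)"
    and x0: "x 0 \<in> L2fun M"
    and L2: "\<And>s. s \<in> {0..1} \<Longrightarrow> y s \<in> L2fun M"
    and cov: "\<And>s r. s \<in> {0..1} \<Longrightarrow> r \<in> {0..1} \<Longrightarrow>
      (LINT \<omega>|M. y s \<omega> * y r \<omega>) = c\<^sup>2 * (LINT u|unit_interval. kern (- a) s u * kern (- a) r u)"
    and orth: "\<And>s. s \<in> {0..1} \<Longrightarrow> (LINT \<omega>|M. x 0 \<omega> * y s \<omega>) = 0"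
    and t: "t \<in> {0..1}"
  shows "x t \<in> L2fun M"
    and "(LINT \<omega>|M. (x t \<omega>)\<^sup>2) = exp (2 * b * t) * (LINT \<omega>|M. (x 0 \<omega>)\<^sup>2)
      + c\<^sup>2 * (LINT r|unit_interval. kern (2 * b) t r)"
proof -
  interpret M: prob_space M by (rule M)
  note [measurable] = L2fun_measurable[OF x0]
  define C where "C s r = c\<^sup>2 * (LINT u|unit_interval. kern (- a) s u * kern (- a) r u)" for s r
  define K where "K = c\<^sup>2 * (exp \<bar>a\<bar> * exp \<bar>a\<bar>)"
  have y: "(\<lambda>(s, \<omega>). y s \<omega>) \<in> borel_measurable (unit_interval \<Otimes>\<^sub>M M)"
    unfolding y_def by measurable
  have kern2: "integrable unit_interval (\<lambda>u. kern (- a) s u * kern (- a) r u)"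
    "(LINT u|unit_interval. kern (- a) s u * kern (- a) r u) \<le> exp \<bar>a\<bar> * exp \<bar>a\<bar>"
    if "s \<in> {0..1}" "r \<in> {0..1}" for s r
  proof -
    have b: "\<bar>kern (- a) s u * kern (- a) r u\<bar> \<le> exp \<bar>a\<bar> * exp \<bar>a\<bar>" if "u \<in> {0..1}" for u
      unfolding abs_mult
      using mult_mono[OF kern_bound[OF \<open>s \<in> _\<close> that, of "- a"] kern_bound[OF \<open>r \<in> _\<close> that, of "- a"]] by simp
    show i: "integrable unit_interval (\<lambda>u. kern (- a) s u * kern (- a) r u)"
      by (rule unit_interval.integrable_const_bound[where B = "exp \<bar>a\<bar> * exp \<bar>a\<bar>"]) (use b in auto)
    show "(LINT u|unit_interval. kern (- a) s u * kern (- a) r u) \<le> exp \<bar>a\<bar> * exp \<bar>a\<bar>"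
      by (rule unit_interval.integral_le_const[OF i]) (rule AE_I2, rule order_trans[OF abs_ge_self b], simp)
  qed
  have C: "\<forall>s\<in>{0..1}. C s s \<le> K"
  proof
    fix s :: real assume s: "s \<in> {0..1}"
    show "C s s \<le> K"
      unfolding C_def K_def by (rule mult_left_mono[OF kern2(2)[OF s s]]) simp
  qed
  have covC: "\<forall>s\<in>{0..1}. \<forall>r\<in>{0..1}. (LINT \<omega>|M. y s \<omega> * y r \<omega>) = C s r"
    unfolding C_def by (intro ballI cov)
  have L2': "\<forall>s\<in>{0..1}. y s \<in> L2fun M" using L2 by blast
  define V where "V \<omega> = (LINT s|unit_interval. (a + b) * kern b t s * y s \<omega>)" for \<omega>
  note V = volterra_process[OF M y L2' covC C t, where \<theta> = "a + b" and b = b, folded V_def]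
  have x_eq: "AE \<omega> in M. x t \<omega> = exp (b * t) * x 0 \<omega> + (y t \<omega> + V \<omega>)"
    using int
  proof eventually_elim
    case (elim \<omega>)
    have "V \<omega> = (a + b) * (LINT s|unit_interval. kern b t s * y s \<omega>)"
      unfolding V_def by (simp add: mult.assoc)
    then show ?case
      using volterra_solution[OF elim t, of b "x 0 \<omega>" a] by (simp add: y_def)
  qed
  have xt [measurable]: "x t \<in> borel_measurable M"
    using measurable_compose_Pair1[OF _ x, of t] t by simp
  have S: "(\<lambda>\<omega>. y t \<omega> + V \<omega>) \<in> L2fun M"
    by (intro L2fun_add L2 t V)
  have E: "(\<lambda>\<omega>. exp (b * t) * x 0 \<omega>) \<in> L2fun M" by (intro L2fun_cmult x0)
  show "x t \<in> L2fun M"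
    by (rule L2fun_cong_AE[OF x_eq L2fun_add[OF E S] xt])
  have xV: "(LINT \<omega>|M. x 0 \<omega> * (y t \<omega> + V \<omega>)) = 0"
  proof -
    have "(LINT \<omega>|M. x 0 \<omega> * (y t \<omega> + V \<omega>)) = (LINT \<omega>|M. x 0 \<omega> * y t \<omega>) + (LINT \<omega>|M. x 0 \<omega> * V \<omega>)"
      using L2fun_mult[OF x0 L2[OF t]] L2fun_mult[OF x0 V(1)] by (simp add: distrib_left)
    also have "\<dots> = (LINT s|unit_interval. 0)"
      unfolding V(2)[OF x0] orth[OF t] add_0 using orth by (intro Bochner_Integration.integral_cong) auto
    finally show ?thesis by simp
  qed
  have "(LINT \<omega>|M. (x t \<omega>)\<^sup>2) = (LINT \<omega>|M. (exp (b * t) * x 0 \<omega> + (y t \<omega> + V \<omega>))\<^sup>2)"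
    using x_eq by (intro integral_cong_AE) (use E S in \<open>auto dest: L2fun_measurable\<close>)
  also have "\<dots> = (LINT \<omega>|M. (exp (b * t))\<^sup>2 * (x 0 \<omega>)\<^sup>2 + 2 * exp (b * t) * (x 0 \<omega> * (y t \<omega> + V \<omega>)) + (y t \<omega> + V \<omega>)\<^sup>2)"
    by (intro Bochner_Integration.integral_cong) (auto simp: power2_eq_square algebra_simps)
  also have "\<dots> = (exp (b * t))\<^sup>2 * (LINT \<omega>|M. (x 0 \<omega>)\<^sup>2) + 2 * exp (b * t) * (LINT \<omega>|M. x 0 \<omega> * (y t \<omega> + V \<omega>))
      + (LINT \<omega>|M. (y t \<omega> + V \<omega>)\<^sup>2)"
    using L2fun_square[OF x0] L2fun_mult[OF x0 S] L2fun_square[OF S] by simp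
  also have "(exp (b * t))\<^sup>2 = exp (2 * b * t)"
    by (simp add: power2_eq_square exp_add[symmetric])
  finally have main: "(LINT \<omega>|M. (x t \<omega>)\<^sup>2) = exp (2 * b * t) * (LINT \<omega>|M. (x 0 \<omega>)\<^sup>2) + (LINT \<omega>|M. (y t \<omega> + V \<omega>)\<^sup>2)"
    by (simp add: xV)
  define z where "z s u = c * kern (- a) s u" for s u
  have zm: "(\<lambda>(s, u). z s u) \<in> borel_measurable (unit_interval \<Otimes>\<^sub>M unit_interval)"
    unfolding z_def by measurable
  have zL2: "\<forall>s\<in>{0..1}. z s \<in> L2fun unit_interval"
  proof
    fix s :: real assume s: "s \<in> {0..1}"
    show "z s \<in> L2fun unit_interval"
      using kern2(1)[OF s s] unfolding z_def L2fun_def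
      by (simp add: power_mult_distrib power2_eq_square[of "kern _ _ _"])
  qed
  have zcov: "\<forall>s\<in>{0..1}. \<forall>r\<in>{0..1}. (LINT u|unit_interval. z s u * z r u) = C s r"
    unfolding z_def C_def
    by (subst Bochner_Integration.integral_mult_right_zero[symmetric], intro ballI Bochner_Integration.integral_cong)
      (auto simp: power2_eq_square)
  note z = volterra_process[OF prob_space_unit_interval zm zL2 zcov C t, where \<theta> = "a + b" and b = b]
  \<comment> \<open>Both second moments equal the same expression in \<open>C\<close>, so the random
    one may be replaced by an explicit integral over u.\<close>
  have "(LINT \<omega>|M. (y t \<omega> + V \<omega>)\<^sup>2) = (LINT u|unit_interval. (z t u + (LINT s|unit_interval. (a + b) * kern b t s * z s u))\<^sup>2)"
    unfolding V(3) z(3) ..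
  also have "\<dots> = (LINT u|unit_interval. c\<^sup>2 * kern (2 * b) t u)"
  proof (intro Bochner_Integration.integral_cong refl)
    fix u assume "u \<in> space unit_interval"
    then have u: "u \<in> {0..1}" by simp
    \<comment> \<open>For the comparison process the resolvent equation collapses the sum to c times
      \<open>kern b t u\<close>, whose square doubles the rate.\<close>
    have "(LINT s|unit_interval. (a + b) * kern b t s * z s u) = (LINT s|unit_interval. c * ((a + b) * (kern b t s * kern (- a) s u)))"
      by (intro Bochner_Integration.integral_cong) (auto simp: z_def)
    also have "\<dots> = c * ((a + b) * (LINT s|unit_interval. kern b t s * kern (- a) s u))" by simp
    also have "\<dots> = c * (kern b t u - kern (- a) t u)" using kern_resolvent[OF u t, of a b] by simp
    finally have "z t u + (LINT s|unit_interval. (a + b) * kern b t s * z s u) = c * kern b t u"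
      by (simp add: z_def right_diff_distrib)
    moreover have "(kern b t u)\<^sup>2 = kern (2 * b) t u"
      by (simp add: kern_def power2_eq_square exp_add[symmetric])
    ultimately show "(z t u + (LINT s|unit_interval. (a + b) * kern b t s * z s u))\<^sup>2 = c\<^sup>2 * kern (2 * b) t u"
      by (simp add: power_mult_distrib)
  qed
  finally show "(LINT \<omega>|M. (x t \<omega>)\<^sup>2) = exp (2 * b * t) * (LINT \<omega>|M. (x 0 \<omega>)\<^sup>2)
      + c\<^sup>2 * (LINT r|unit_interval. kern (2 * b) t r)"
    using main by simp
qed

section \<open>Coordinates of the mild solution\<close>

lemma mild_solutionD:
  assumes "mild_solution M F w \<kappa> \<eta> \<alpha> \<nu> \<theta>\<^sub>0 \<sigma> X"
  shows "t \<in> {0..1} \<Longrightarrow> X t \<in> borel_measurable (F t)"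
    and "(\<lambda>(t, \<omega>). X t \<omega>) \<in> borel_measurable (restrict_space borel {0..1} \<Otimes>\<^sub>M M)"
    and "t \<in> {0..1} \<Longrightarrow> \<exists>Z. has_WQ_integral M \<kappa> \<eta> \<alpha> w t (\<lambda>s. dirichlet_semigroup \<kappa> \<eta> (\<nu> * (t - s))) Z \<and>
        (AE \<omega> in M.
           set_integrable lborel {0..t} (\<lambda>s. dirichlet_semigroup \<kappa> \<eta> (\<nu> * (t - s)) (X s \<omega>)) \<and>
           X t \<omega> = dirichlet_semigroup \<kappa> \<eta> (\<nu> * t) (X 0 \<omega>)
             + \<theta>\<^sub>0 *\<^sub>R (LINT s:{0..t}|lborel. dirichlet_semigroup \<kappa> \<eta> (\<nu> * (t - s)) (X s \<omega>))
             + \<sigma> *\<^sub>R Z \<omega>)"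
proof -
  note conjs = assms[unfolded mild_solution_def]
  show "t \<in> {0..1} \<Longrightarrow> X t \<in> borel_measurable (F t)"
    by (rule conjs[THEN conjunct1, THEN bspec])
  show "(\<lambda>(t, \<omega>). X t \<omega>) \<in> borel_measurable (restrict_space borel {0..1} \<Otimes>\<^sub>M M)"
    by (rule conjs[THEN conjunct2, THEN conjunct1])
  show "t \<in> {0..1} \<Longrightarrow> \<exists>Z. has_WQ_integral M \<kappa> \<eta> \<alpha> w t (\<lambda>s. dirichlet_semigroup \<kappa> \<eta> (\<nu> * (t - s))) Z \<and>
        (AE \<omega> in M.
           set_integrable lborel {0..t} (\<lambda>s. dirichlet_semigroup \<kappa> \<eta> (\<nu> * (t - s)) (X s \<omega>)) \<and>
           X t \<omega> = dirichlet_semigroup \<kappa> \<eta> (\<nu> * t) (X 0 \<omega>)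
             + \<theta>\<^sub>0 *\<^sub>R (LINT s:{0..t}|lborel. dirichlet_semigroup \<kappa> \<eta> (\<nu> * (t - s)) (X s \<omega>))
             + \<sigma> *\<^sub>R Z \<omega>)"
    by (rule conjs[THEN conjunct2, THEN conjunct2, THEN bspec])
qed

lemma has_WQ_integralD:
  assumes "has_WQ_integral M \<kappa> \<eta> \<alpha> w t \<Phi> Z"
  obtains J where "Z \<in> borel_measurable M"
    and "\<forall>l\<in>modes. has_wiener_integral M (w l) t (\<lambda>s. \<Phi> s (e_vec \<kappa> \<eta> l)) (J l)"
    and "((\<lambda>L. \<integral>\<^sup>+\<omega>. ennreal ((norm (Z \<omega> - (\<Sum>l\<in>L. mu l powr (- \<alpha> / 2) *\<^sub>R J l \<omega>)))\<^sup>2) \<partial>M)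
           \<longlongrightarrow> 0) (finite_subsets_at_top modes)"
  using assms unfolding has_WQ_integral_def by (elim conjE exE)

lemma H_inner_measurable [measurable (raw)]:
  assumes "f \<in> borel_measurable M"
  shows "(\<lambda>x. H_inner \<kappa> \<eta> (f x) v) \<in> borel_measurable M"
  by (rule measurable_compose[OF assms])
    (intro borel_measurable_continuous_onI linear_continuous_on bounded_linear_H_inner)

text \<open>The semigroup acts diagonally, so for k \<noteq> l the integrand of the l-th coordinate
  of J(k) vanishes, and by the isometry so does its integral almost surely. Only the summand k = l
  contributes to the coordinate of the limit Z.\<close>

lemma WQ_integral_coordinate:
  assumes basis: "stochastic_basis M F"
    and bm: "\<And>l. l \<in> modes \<Longrightarrow> brownian_motion M F (w l)"
    and nu: "0 < \<nu>" and l: "l \<in> modes"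
    and Z: "has_WQ_integral M \<kappa> \<eta> \<alpha> w t (\<lambda>s. dirichlet_semigroup \<kappa> \<eta> (\<nu> * (t - s))) Z"
  shows "\<exists>I. has_wiener_integral M (w l) t
      (\<lambda>s. H_inner \<kappa> \<eta> (dirichlet_semigroup \<kappa> \<eta> (\<nu> * (t - s)) (e_vec \<kappa> \<eta> l)) (e_vec \<kappa> \<eta> l)) I
    \<and> (AE \<omega> in M. H_inner \<kappa> \<eta> (Z \<omega>) (e_vec \<kappa> \<eta> l) = mu l powr (- \<alpha> / 2) * I \<omega>)"
proof -
  interpret prob_space M by (rule stochastic_basisD(1)[OF basis])
  obtain J where Zm [measurable]: "Z \<in> borel_measurable M"
    and J: "\<forall>l\<in>modes. has_wiener_integral M (w l) t
      (\<lambda>s. dirichlet_semigroup \<kappa> \<eta> (\<nu> * (t - s)) (e_vec \<kappa> \<eta> l)) (J l)"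
    and lim: "((\<lambda>L. \<integral>\<^sup>+\<omega>. ennreal ((norm (Z \<omega> - (\<Sum>l\<in>L. mu l powr (- \<alpha> / 2) *\<^sub>R J l \<omega>)))\<^sup>2) \<partial>M)
           \<longlongrightarrow> 0) (finite_subsets_at_top modes)"
    by (rule has_WQ_integralD[OF Z])
  define h where "h u = H_inner \<kappa> \<eta> u (e_vec \<kappa> \<eta> l)" for u
  have h: "bounded_linear h" unfolding h_def by (rule bounded_linear_H_inner)
  note h_lin = linear_diff[OF bounded_linear.linear[OF h]] linear_add[OF bounded_linear.linear[OF h]]
    linear_sum[OF bounded_linear.linear[OF h]]
    linear_scale[OF bounded_linear.linear[OF h]]
  obtain K where K: "\<And>x. norm (h x) \<le> norm x * K"
    using bounded_linear.bounded[OF h] by metis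
  have I: "has_wiener_integral M (w k) t
      (\<lambda>s. h (dirichlet_semigroup \<kappa> \<eta> (\<nu> * (t - s)) (e_vec \<kappa> \<eta> k))) (\<lambda>\<omega>. h (J k \<omega>))" if k: "k \<in> modes" for k
    by (rule has_wiener_integral_bounded_linear[OF h bspec[OF J k] brownian_measurable[OF basis bm[OF k]]])
  have zero: "AE \<omega> in M. h (J k \<omega>) = 0" if k: "k \<in> modes" "k \<noteq> l" for k
  proof -
    note Ik = I[OF k(1)]
    have "expectation (\<lambda>\<omega>. h (J k \<omega>) * h (J k \<omega>)) = (LINT r::real|lborel. 0)"
      unfolding wiener_isometry[OF basis bm[OF k(1)] Ik Ik]
      using nu k l by (intro Bochner_Integration.integral_cong refl)
        (auto simp: h_def H_inner_dirichlet_semigroup H_inner_e_vec indicator_def)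
    then have "expectation (\<lambda>\<omega>. (h (J k \<omega>))\<^sup>2) = 0" by (simp add: power2_eq_square)
    then have "AE \<omega> in M. (h (J k \<omega>))\<^sup>2 = 0"
      using L2fun_square[OF wiener_integral_L2[OF basis bm[OF k(1)] Ik]]
      by (subst (asm) integral_nonneg_eq_0_iff_AE) auto
    then show ?thesis by simp
  qed
  \<comment> \<open>The defect is independent of the finite index set L; it is shown to be 0 by
    bounding its second moment through every L containing l.\<close>
  define D where "D \<omega> = h (Z \<omega>) - mu l powr (- \<alpha> / 2) * h (J l \<omega>)" for \<omega>
  have Jm: "(\<lambda>\<omega>. h (J l \<omega>)) \<in> borel_measurable M"
    by (rule wiener_integral_measurable(1)[OF basis bm[OF l] I[OF l]])
  have [measurable]: "D \<in> borel_measurable M"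
    unfolding D_def using Jm by (auto simp: h_def)
  have bound: "(\<integral>\<^sup>+\<omega>. ennreal ((D \<omega>)\<^sup>2) \<partial>M)
      \<le> ennreal (K\<^sup>2) * (\<integral>\<^sup>+\<omega>. ennreal ((norm (Z \<omega> - (\<Sum>k\<in>L. mu k powr (- \<alpha> / 2) *\<^sub>R J k \<omega>)))\<^sup>2) \<partial>M)"
    if L: "finite L" "{l} \<subseteq> L" "L \<subseteq> modes" for L
  proof -
    have [measurable]: "J k \<in> borel_measurable M" if "k \<in> L" for k
      by (rule has_wiener_integral_measurable[OF bspec[OF J]]) (use L that in blast)
    \<comment> \<open>A finite L involves only finitely many exceptional null sets.\<close>
    have "AE \<omega> in M. \<forall>k\<in>L - {l}. h (J k \<omega>) = 0"
      using L zero by (intro AE_finite_allI) auto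
    then have "AE \<omega> in M. ennreal ((D \<omega>)\<^sup>2)
        \<le> ennreal (K\<^sup>2) * ennreal ((norm (Z \<omega> - (\<Sum>k\<in>L. mu k powr (- \<alpha> / 2) *\<^sub>R J k \<omega>)))\<^sup>2)"
    proof eventually_elim
      case (elim \<omega>)
      have "D \<omega> = h (Z \<omega> - (\<Sum>k\<in>L. mu k powr (- \<alpha> / 2) *\<^sub>R J k \<omega>))"
        using L elim by (simp add: D_def h_lin sum.remove[of L l])
      then have "norm (D \<omega>) \<le> norm (Z \<omega> - (\<Sum>k\<in>L. mu k powr (- \<alpha> / 2) *\<^sub>R J k \<omega>)) * K"
        using K by simp
      then have "(norm (D \<omega>))\<^sup>2 \<le> (norm (Z \<omega> - (\<Sum>k\<in>L. mu k powr (- \<alpha> / 2) *\<^sub>R J k \<omega>)) * K)\<^sup>2"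
        by (intro power_mono) auto
      then show ?case
        by (simp add: ennreal_mult[symmetric] power_mult_distrib mult.commute)
    qed
    then have "(\<integral>\<^sup>+\<omega>. ennreal ((D \<omega>)\<^sup>2) \<partial>M)
       \<le> (\<integral>\<^sup>+\<omega>. ennreal (K\<^sup>2) * ennreal ((norm (Z \<omega> - (\<Sum>k\<in>L. mu k powr (- \<alpha> / 2) *\<^sub>R J k \<omega>)))\<^sup>2) \<partial>M)"
      by (rule nn_integral_mono_AE)
    also have "\<dots> = ennreal (K\<^sup>2) * (\<integral>\<^sup>+\<omega>. ennreal ((norm (Z \<omega> - (\<Sum>k\<in>L. mu k powr (- \<alpha> / 2) *\<^sub>R J k \<omega>)))\<^sup>2) \<partial>M)"
      by (rule nn_integral_cmult) measurable
    finally show ?thesis .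
  qed
  have "(\<integral>\<^sup>+\<omega>. ennreal ((D \<omega>)\<^sup>2) \<partial>M) \<le> ennreal (K\<^sup>2) * 0"
  proof (rule tendsto_lowerbound)
    show "((\<lambda>L. ennreal (K\<^sup>2) * (\<integral>\<^sup>+\<omega>. ennreal ((norm (Z \<omega> - (\<Sum>k\<in>L. mu k powr (- \<alpha> / 2) *\<^sub>R J k \<omega>)))\<^sup>2) \<partial>M))
      \<longlongrightarrow> ennreal (K\<^sup>2) * 0) (finite_subsets_at_top modes)"
      by (rule ennreal_tendsto_cmult[OF _ lim]) simp
    show "\<forall>\<^sub>F L in finite_subsets_at_top modes. (\<integral>\<^sup>+\<omega>. ennreal ((D \<omega>)\<^sup>2) \<partial>M)
      \<le> ennreal (K\<^sup>2) * (\<integral>\<^sup>+\<omega>. ennreal ((norm (Z \<omega> - (\<Sum>k\<in>L. mu k powr (- \<alpha> / 2) *\<^sub>R J k \<omega>)))\<^sup>2) \<partial>M)"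
      unfolding eventually_finite_subsets_at_top using l bound
      by (intro exI[of _ "{l}"]) auto
  qed simp
  then have "(\<integral>\<^sup>+\<omega>. ennreal ((D \<omega>)\<^sup>2) \<partial>M) = 0" by simp
  then have "AE \<omega> in M. D \<omega> = 0" by (subst (asm) nn_integral_0_iff_AE) auto
  then have "AE \<omega> in M. h (Z \<omega>) = mu l powr (- \<alpha> / 2) * h (J l \<omega>)"
    by eventually_elim (simp add: D_def)
  then show ?thesis using I[OF l] unfolding h_def by blast
qed

text \<open>The cutoff in \<open>kern\<close> takes over the role of the upper limit t, so integrals
  for different t share one measure.\<close>

lemma indicator_kern:
  assumes "t \<in> {0..1}"
  shows "indicator {0..t} s *\<^sub>R (exp (- (t - s) * a) * z) = indicator {0..1} s *\<^sub>R (kern (- a) t s * z)"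
proof -
  have "- (t - s) * a = - a * (t - s)" by (simp add: algebra_simps)
  then show ?thesis using assms by (auto simp only: indicator_def kern_def) auto
qed

lemma integral_kern_restrict:
  assumes "t \<in> {0..1}"
  shows "(LINT s:{0..t}|lborel. exp (- (t - s) * a) * f s) = (LINT s|unit_interval. kern (- a) t s * f s)"
  unfolding integral_unit_interval set_lebesgue_integral_def
  by (simp only: indicator_kern[OF assms])

lemma coord_measurable:
  assumes mild: "mild_solution M F w \<kappa> \<eta> \<alpha> \<nu> \<theta>\<^sub>0 \<sigma> X"
  shows "(\<lambda>(s, \<omega>). H_inner \<kappa> \<eta> (X s \<omega>) (e_vec \<kappa> \<eta> l)) \<in> borel_measurable (unit_interval \<Otimes>\<^sub>M M)"
proof -
  have "sets unit_interval = sets (restrict_space borel {0..1})"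
    unfolding unit_interval_def by (intro sets_restrict_space_cong) simp
  then have "borel_measurable (unit_interval \<Otimes>\<^sub>M M) = (borel_measurable (restrict_space borel {0..1} \<Otimes>\<^sub>M M) :: (real \<times> _ \<Rightarrow> L2D) set)"
    by (intro measurable_cong_sets sets_pair_measure_cong) auto
  then have "(\<lambda>(t, \<omega>). X t \<omega>) \<in> borel_measurable (unit_interval \<Otimes>\<^sub>M M)"
    using mild_solutionD(2)[OF mild] by simp
  from H_inner_measurable[OF this] show ?thesis by (simp add: case_prod_beta')
qed

section \<open>Summation over the modes\<close>

text \<open>The origin of \<open>f1\<close>: the time average of the decay of an initial second
  moment. This form covers x = 0 and makes sign and bounds immediate.\<close>

lemma integral_exp_eq_f1: "(LINT t|unit_interval. exp (- x * t)) = f1 x"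
proof (cases "x = 0")
  case False
  have "(LINT t|unit_interval. exp (- x * t)) = - exp (- x * 1) / x - (- exp (- x * 0) / x)"
    by (rule integral_kern_aux[where g = "\<lambda>t. exp (- x * t)"])
      (use False in \<open>auto intro!: derivative_eq_intros continuous_intros\<close>)
  then show ?thesis using False by (simp add: f1_def diff_divide_distrib)
qed (use unit_interval.prob_space in \<open>simp add: f1_def\<close>)

lemma integral_kern_eq:
  assumes t: "t \<in> {0..1}"
  shows "(LINT r|unit_interval. kern (- x) t r) = (if x = 0 then t else (1 - exp (- x * t)) / x)"
proof (cases "x = 0")
  case True
  have "(LINT r|unit_interval. kern 0 t r) = t - 0"
    by (rule integral_kern_aux[where g = "\<lambda>_. 1" and G = "\<lambda>s. s"])
      (use t in \<open>auto simp: kern_def\<close>)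
  then show ?thesis using True by simp
next
  case False
  have "(LINT r|unit_interval. kern (- x) t r) = exp (- x * (t - t)) / x - exp (- x * (t - 0)) / x"
    by (rule integral_kern_aux[where g = "\<lambda>r. exp (- x * (t - r))" and G = "\<lambda>r. exp (- x * (t - r)) / x"])
      (use t False in \<open>auto intro!: derivative_eq_intros continuous_intros simp: kern_def\<close>)
  then show ?thesis using False by (simp add: diff_divide_distrib)
qed

text \<open>The origin of \<open>f2\<close>: exp(-x(t - r)) integrated over the triangle 0 \<le> r
  \<le> t \<le> 1, whose area is the value 1/2 at x = 0.\<close>

lemma integral_kern_eq_f2: "(LINT t|unit_interval. LINT r|unit_interval. kern (- x) t r) = f2 x"
proof -
  define I where "I t = (LINT r|unit_interval. kern (- x) t r)" for t
  have I: "I t = (if x = 0 then t else (1 - exp (- x * t)) / x)" if "t \<in> {0..1}" for t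
    unfolding I_def by (rule integral_kern_eq[OF that])
  have "(LINT t|unit_interval. I t) = f2 x"
  proof (cases "x = 0")
    case True
    have "(LINT t|unit_interval. I t) = 1\<^sup>2 / 2 - 0\<^sup>2 / 2"
      by (rule integral_kern_aux[where g = "\<lambda>t. t" and G = "\<lambda>t. t\<^sup>2 / 2"])
        (use True in \<open>auto intro!: derivative_eq_intros continuous_intros simp: I\<close>)
    then show ?thesis using True by (simp add: f2_def)
  next
    case False
    have "(LINT t|unit_interval. I t)
      = (1 / x + exp (- x * 1) / x\<^sup>2) - (0 / x + exp (- x * 0) / x\<^sup>2)"
      by (rule integral_kern_aux[where g = "\<lambda>t. (1 - exp (- x * t)) / x" and G = "\<lambda>t. t / x + exp (- x * t) / x\<^sup>2"])
        (use False in \<open>auto intro!: derivative_eq_intros continuous_intros simp: I power2_eq_square diff_divide_distrib\<close>)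
    also have "\<dots> = f2 x" using False by (simp add: f2_def field_simps power2_eq_square)
    finally show ?thesis .
  qed
  then show ?thesis by (simp only: I_def)
qed

section \<open>Sign and size of \<open>f1\<close> and \<open>f2\<close>\<close>

lemma f1_nonneg: "0 \<le> f1 x"
  unfolding integral_exp_eq_f1[symmetric] by (rule Bochner_Integration.integral_nonneg) simp

text \<open>The strict inequality ln z < z - 1 at z = exp(-x). It keeps every weight positive even
  where the initial coordinate vanishes.\<close>

lemma f2_pos: "0 < f2 x"
proof (cases "x = 0")
  case False
  have "ln (exp (- x)) \<noteq> exp (- x) - 1"
    using ln_eq_minus_one[of "exp (- x)"] False by auto
  moreover have "ln (exp (- x)) \<le> exp (- x) - 1" by (rule ln_le_minus_one) simp
  ultimately show ?thesis using False by (simp add: f2_def)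
qed (simp add: f2_def)

lemma integrable_exp_unit_interval: "integrable unit_interval (\<lambda>t. exp (- x * t))"
  unfolding integrable_unit_interval by (intro borel_integrable_atLeastAtMost' continuous_intros)

lemma integrable_kern: "t \<in> {0..1} \<Longrightarrow> integrable unit_interval (\<lambda>r. kern c t r)"
  using integrable_kern_mult[of "\<lambda>_. 1"] by simp

lemma integrable_integral_kern: "integrable unit_interval (\<lambda>t. LINT r|unit_interval. kern c t r)"
  using kern_comp_Fubini(2)[of "\<lambda>_. 1" 0] by simp

text \<open>The argument is negative for modes with \<nu> times the eigenvalue below
  \<open>\<theta>\<^sub>0\<close>; the bound is uniform over such modes once K bounds their growth
  rates.\<close>

lemma f1_le: 
  assumes K: "0 \<le> K" "- x \<le> K"
  shows "f1 x \<le> exp K"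
  unfolding integral_exp_eq_f1[symmetric]
proof (rule unit_interval.integral_le_const[OF integrable_exp_unit_interval], rule AE_I2)
  fix t assume "t \<in> space unit_interval"
  then have "- x * t \<le> K * t" "K * t \<le> K * 1"
    by (intro mult_right_mono mult_left_mono K; simp)+
  then show "exp (- x * t) \<le> exp K" by simp
qed

lemma kern_le:
  assumes "0 \<le> K" "c \<le> K" "t \<in> {0..1}" "r \<in> {0..1}"
  shows "kern c t r \<le> exp K"
proof (cases "r \<le> t")
  case True
  then have "c * (t - r) \<le> K * (t - r)" "K * (t - r) \<le> K * 1"
    using assms(3,4) by (intro mult_right_mono mult_left_mono assms(1,2); simp)+
  then show ?thesis by (simp add: kern_def)
qed (simp add: kern_def)

lemma f2_le:
  assumes K: "0 \<le> K" "- x \<le> K"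
  shows "f2 x \<le> exp K"
  unfolding integral_kern_eq_f2[symmetric]
proof (rule unit_interval.integral_le_const[OF integrable_integral_kern], rule AE_I2)
  fix t assume "t \<in> space unit_interval"
  then have t: "t \<in> {0..1}" by simp
  show "(LINT r|unit_interval. kern (- x) t r) \<le> exp K"
    by (rule unit_interval.integral_le_const[OF integrable_kern[OF t]], rule AE_I2)
      (use kern_le[OF K t] in auto)
qed

text \<open>Because exp(-x) \<le> 1. This decay supplies the extra factor 1/mu on which convergence
  of the spectral sums rests.\<close>

lemma f2_le_inverse: "0 < x \<Longrightarrow> f2 x \<le> 1 / x"
  by (simp add: f2_def field_simps power2_eq_square)

section \<open>Lattice sums of eigenvalues\<close>

lemma mu_ge_1: "l \<in> modes \<Longrightarrow> 1 \<le> mu l"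
proof -
  assume "l \<in> modes"
  then have "1 \<le> real (fst l)" by (auto simp: modes_def)
  then have "1 \<le> (real (fst l))\<^sup>2 + (real (snd l))\<^sup>2" by (simp add: add_increasing2)
  moreover have "1 \<le> pi\<^sup>2" using pi_ge_two by simp
  ultimately show ?thesis unfolding mu_def using mult_mono[of 1 "pi\<^sup>2" 1] by simp
qed

lemma infinite_modes: "infinite modes"
  unfolding modes_def by (simp add: finite_cartesian_product_iff infinite_Ici)

text \<open>By 2xy \<le> x^2 + y^2 the eigenvalue dominates the product of the two indices, so the
  sum is bounded by a product of two convergent one-dimensional series.\<close>

lemma summable_mu_powr:
  assumes "1 < p"
  shows "(\<lambda>l. mu l powr (- p)) summable_on modes"
proof -
  have "(\<lambda>n. real n powr (- p)) summable_on UNIV"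
    using assms by (subst summable_on_UNIV_nonneg_real_iff) (simp_all add: summable_real_powr_iff)
  then have 1: "(\<lambda>n. real n powr (- p)) summable_on {1..}"
    by (rule summable_on_subset_banach) simp
  have "(\<lambda>l. real (fst l) powr (- p) * real (snd l) powr (- p)) summable_on modes"
    unfolding modes_def
  proof (rule summable_on_SigmaI)
    show "((\<lambda>n. real (fst (m, n)) powr (- p) * real (snd (m, n)) powr (- p))
       has_sum real m powr (- p) * (\<Sum>\<^sub>\<infinity>n\<in>{1..}. real n powr (- p))) {1..}" for m :: nat
      using has_sum_cmult_right[OF has_sum_infsum[OF 1], of "real m powr (- p)"] by simp
    show "(\<lambda>m. real m powr (- p) * (\<Sum>\<^sub>\<infinity>n\<in>{1..}. real n powr (- p))) summable_on {1..}"
      by (rule summable_on_cmult_left[OF 1])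
  qed simp
  then show ?thesis
  proof (rule summable_on_comparison_test)
    fix l assume l: "l \<in> modes"
    define x y where "x = real (fst l)" and "y = real (snd l)"
    have xy: "1 \<le> x" "1 \<le> y" using l by (auto simp: modes_def x_def y_def)
    have "2 * x * y \<le> x\<^sup>2 + y\<^sup>2" by (rule sum_squares_bound)
    moreover have "0 < x * y" using xy by (intro mult_pos_pos) auto
    ultimately have "x * y \<le> x\<^sup>2 + y\<^sup>2" by linarith
    also have "\<dots> \<le> pi\<^sup>2 * (x\<^sup>2 + y\<^sup>2)"
      using mult_right_mono[of 1 "pi\<^sup>2" "x\<^sup>2 + y\<^sup>2"] pi_ge_two by simp
    finally have "x * y \<le> mu l" by (simp add: mu_def x_def y_def)
    then have "mu l powr (- p) \<le> (x * y) powr (- p)"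
      using assms \<open>0 < x * y\<close> by (intro powr_mono2') auto
    then show "mu l powr (- p) \<le> real (fst l) powr (- p) * real (snd l) powr (- p)"
      using xy by (simp add: powr_mult x_def y_def)
  qed simp
qed

section \<open>Unordered sums with values in \<open>ennreal\<close>\<close>

lemma infsum_ennreal_real:
  assumes "f summable_on A" and "\<And>x. x \<in> A \<Longrightarrow> 0 \<le> f x"
  shows "(\<Sum>\<^sub>\<infinity>x\<in>A. ennreal (f x)) = ennreal (infsum f A)"
proof -
  have "(\<Sum>\<^sub>\<infinity>x\<in>A. ennreal (f x)) = (SUP F\<in>{F. finite F \<and> F \<subseteq> A}. \<Sum>x\<in>F. ennreal (f x))"
    by (rule nonneg_infsum_complete) simp
  also have "\<dots> = (SUP F\<in>{F. finite F \<and> F \<subseteq> A}. ennreal (sum f F))"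
    using assms(2) by (intro SUP_cong refl sum_ennreal) auto
  also have "\<dots> = ennreal (infsum f A)"
    by (rule infsum_nonneg_is_SUPREMUM_ennreal[OF assms, symmetric])
  finally show ?thesis .
qed

lemma finite_sum_le_infsum_ennreal:
  fixes f :: "'i \<Rightarrow> ennreal"
  assumes "finite F" "F \<subseteq> A"
  shows "sum f F \<le> infsum f A"
proof -
  have "infsum f A = (SUP F\<in>{F. finite F \<and> F \<subseteq> A}. sum f F)"
    by (rule nonneg_infsum_complete) simp
  then show ?thesis using assms by (auto intro: SUP_upper)
qed

lemma summable_on_ennreal_finite:
  fixes f :: "'i \<Rightarrow> real"
  assumes fin: "(\<Sum>\<^sub>\<infinity>x\<in>A. ennreal (f x)) < \<infinity>" and nonneg: "\<And>x. x \<in> A \<Longrightarrow> 0 \<le> f x"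
  shows "f summable_on A"
proof (rule nonneg_bdd_above_summable_on)
  have "sum f F \<le> enn2real (\<Sum>\<^sub>\<infinity>x\<in>A. ennreal (f x))" if "finite F" "F \<subseteq> A" for F
  proof -
    have "ennreal (sum f F) = (\<Sum>x\<in>F. ennreal (f x))"
      using that nonneg by (intro sum_ennreal[symmetric]) auto
    also have "\<dots> \<le> (\<Sum>\<^sub>\<infinity>x\<in>A. ennreal (f x))"
      by (rule finite_sum_le_infsum_ennreal[OF that])
    also have "\<dots> = ennreal (enn2real (\<Sum>\<^sub>\<infinity>x\<in>A. ennreal (f x)))"
      using fin by (simp add: less_top)
    finally show ?thesis by (simp add: ennreal_le_iff)
  qed
  then show "bdd_above (sum f ` {F. F \<subseteq> A \<and> finite F})"
    by (auto intro!: bdd_aboveI)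
qed (use nonneg in auto)

text \<open>An enumeration turns the unordered sum into an ordinary series, to which monotone
  convergence applies in \<open>nn_integral_infsum\<close>.\<close>

lemma infsum_countable_ennreal:
  fixes f :: "'i \<Rightarrow> ennreal"
  assumes "countable A" "infinite A"
  shows "infsum f A = (\<Sum>n. f (from_nat_into A n))"
proof -
  have "infsum f A = (\<Sum>\<^sub>\<infinity>n. f (from_nat_into A n))"
    using bij_betw_from_nat_into[OF assms] by (rule infsum_reindex_bij_betw[symmetric])
  also have "\<dots> = (\<Sum>n. f (from_nat_into A n))"
    by (rule sums_unique, rule has_sum_imp_sums, rule has_sum_infsum, rule nonneg_summable_on_complete) simp
  finally show ?thesis .
qed

lemma nn_integral_infsum:
  fixes f :: "'i \<Rightarrow> 'a \<Rightarrow> ennreal"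
  assumes A: "countable A" "infinite A" and f: "\<And>l. l \<in> A \<Longrightarrow> f l \<in> borel_measurable M"
  shows "(\<integral>\<^sup>+x. (\<Sum>\<^sub>\<infinity>l\<in>A. f l x) \<partial>M) = (\<Sum>\<^sub>\<infinity>l\<in>A. \<integral>\<^sup>+x. f l x \<partial>M)"
proof -
  have "A \<noteq> {}" using A by auto
  then show ?thesis
    unfolding infsum_countable_ennreal[OF A]
    by (intro nn_integral_suminf f from_nat_into)
qed

section \<open>Log-convexity of Dirichlet sums\<close>

text \<open>After division by the geometric mean z, the inequality ln u \<le> u - 1 is applied at
  x/z and y/z. The weighted logarithms add up to 0, and x \<noteq> y prevents both quotients from
  being 1.\<close>

lemma weighted_am_gm_strict:
  fixes x y \<theta> :: real
  assumes "0 < x" "0 < y" "x \<noteq> y" "0 < \<theta>" "\<theta> < 1"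
  shows "x powr (1 - \<theta>) * y powr \<theta> < (1 - \<theta>) * x + \<theta> * y"
proof -
  define z where "z = x powr (1 - \<theta>) * y powr \<theta>"
  have z: "0 < z" using assms by (simp add: z_def)
  have ln_z: "ln z = (1 - \<theta>) * ln x + \<theta> * ln y"
    using assms by (simp add: z_def ln_mult ln_powr)
  have "ln (x / z) \<le> x / z - 1" "ln (y / z) \<le> y / z - 1"
    using assms z by (intro ln_le_minus_one; simp)+
  moreover have "ln (x / z) \<noteq> x / z - 1 \<or> ln (y / z) \<noteq> y / z - 1"
    using ln_eq_minus_one[of "x / z"] ln_eq_minus_one[of "y / z"] assms z by auto
  ultimately have "(1 - \<theta>) * ln (x / z) + \<theta> * ln (y / z) < (1 - \<theta>) * (x / z - 1) + \<theta> * (y / z - 1)"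
    using assms by (smt (verit, best) mult_le_cancel_left_pos mult_less_cancel_left_pos)
  moreover have "(1 - \<theta>) * ln (x / z) + \<theta> * ln (y / z) = 0"
    using assms z ln_z by (simp add: ln_div algebra_simps)
  moreover have "(1 - \<theta>) * (x / z - 1) + \<theta> * (y / z - 1) = ((1 - \<theta>) * x + \<theta> * y) / z - 1"
    using z by (simp add: field_simps)
  ultimately have "1 < ((1 - \<theta>) * x + \<theta> * y) / z" by simp
  then have "z < (1 - \<theta>) * x + \<theta> * y" using z by (simp only: less_divide_eq_1_pos)
  then show ?thesis by (simp only: z_def)
qed

text \<open>A general Dirichlet series with base \<open>m l\<close>. Taking \<open>m l\<close> as mu
  to the power \<alpha> absorbs \<alpha>, so that s becomes \<beta> + 1.\<close>

definition dirichlet_sum :: "'i set \<Rightarrow> ('i \<Rightarrow> real) \<Rightarrow> ('i \<Rightarrow> real) \<Rightarrow> real \<Rightarrow> real" where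
  "dirichlet_sum A c m s = (\<Sum>\<^sub>\<infinity>l\<in>A. c l * m l powr (- s))"

context
  fixes A :: "'i set" and c m :: "'i \<Rightarrow> real" and i j :: 'i
  assumes c_pos: "\<And>l. l \<in> A \<Longrightarrow> 0 < c l" and m_pos: "\<And>l. l \<in> A \<Longrightarrow> 0 < m l"
    and ij: "i \<in> A" "j \<in> A" "m i \<noteq> m j"
    and summable: "\<And>s. 0 < s \<Longrightarrow> (\<lambda>l. c l * m l powr (- s)) summable_on A"
begin

lemma dirichlet_sum_pos:
  assumes "0 < s"
  shows "0 < dirichlet_sum A c m s"
proof -
  have "0 < (\<Sum>l\<in>{i}. c l * m l powr (- s))" using c_pos[OF ij(1)] m_pos[OF ij(1)] by simp
  also have "\<dots> \<le> dirichlet_sum A c m s"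
    unfolding dirichlet_sum_def using c_pos ij
    by (intro finite_sum_le_infsum summable assms) (auto intro!: mult_nonneg_nonneg less_imp_le[OF c_pos])
  finally show ?thesis .
qed

text \<open>Hoelder's inequality with its equality case: the termwise weighted mean inequality is
  summed for normalised series, and it is strict in at least one term because m takes two different
  values.\<close>

lemma dirichlet_sum_strictly_log_convex:
  assumes p: "0 < p" and q: "p < q" and \<theta>: "0 < \<theta>" "\<theta> < 1"
  shows "ln (dirichlet_sum A c m ((1 - \<theta>) * p + \<theta> * q))
    < (1 - \<theta>) * ln (dirichlet_sum A c m p) + \<theta> * ln (dirichlet_sum A c m q)"
proof -
  let ?S = "dirichlet_sum A c m" and ?r = "(1 - \<theta>) * p + \<theta> * q"
  have r: "0 < ?r" using p q \<theta> by (intro add_pos_pos mult_pos_pos) auto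
  have S: "0 < ?S p" "0 < ?S q" "0 < ?S ?r" using p q r by (auto intro!: dirichlet_sum_pos)
  \<comment> \<open>Both x and y sum to 1, so their weighted mean does too; z is the term at the
    intermediate exponent, scaled to be their weighted geometric mean.\<close>
  define x where "x l = c l * m l powr (- p) / ?S p" for l
  define y where "y l = c l * m l powr (- q) / ?S q" for l
  define z where "z l = c l * m l powr (- ?r) / (?S p powr (1 - \<theta>) * ?S q powr \<theta>)" for l
  have xy: "0 < x l" "0 < y l" if "l \<in> A" for l
    using c_pos[OF that] m_pos[OF that] S by (auto simp: x_def y_def)
  have z: "z l = x l powr (1 - \<theta>) * y l powr \<theta>" if "l \<in> A" for l
  proof -
    have cl: "0 < c l" and ml: "0 < m l" using c_pos[OF that] m_pos[OF that] by auto
    have "c l powr (1 - \<theta>) * c l powr \<theta> = c l"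
      using cl by (simp add: powr_add[symmetric])
    moreover have "m l powr (- p * (1 - \<theta>)) * m l powr (- q * \<theta>) = m l powr (- ?r)"
      by (simp add: powr_add[symmetric] algebra_simps)
    ultimately have num: "(c l powr (1 - \<theta>) * m l powr (- p * (1 - \<theta>))) * (c l powr \<theta> * m l powr (- q * \<theta>)) = c l * m l powr (- ?r)"
      by (metis mult.assoc mult.left_commute)
    show ?thesis
      using cl ml S num by (simp add: x_def y_def z_def powr_divide powr_mult powr_powr)
  qed
  have le: "z l \<le> (1 - \<theta>) * x l + \<theta> * y l" if "l \<in> A" for l
  proof (cases "x l = y l")
    case True
    then show ?thesis using xy[OF that] by (simp add: z[OF that] powr_add[symmetric] algebra_simps)
  next
    case False
    then show ?thesis using weighted_am_gm_strict[OF xy[OF that] _ \<theta>] by (simp add: z[OF that])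
  qed
  \<comment> \<open>Equality at l pins \<open>m l powr (q - p)\<close> to a constant independent of
    l, which cannot hold at both i and j.\<close>
  have ratio: "x l = y l \<Longrightarrow> m l powr (q - p) = ?S p / ?S q" if "l \<in> A" for l
  proof -
    assume "x l = y l"
    then have "m l powr (- p) * ?S q = m l powr (- q) * ?S p"
      using c_pos[OF that] S by (simp add: x_def y_def field_simps)
    then have "m l powr q * (m l powr (- p) * ?S q) = m l powr q * (m l powr (- q) * ?S p)" by simp
    then have "m l powr (q - p) * ?S q = ?S p"
      using m_pos[OF that] by (simp add: mult.assoc[symmetric] powr_add[symmetric])
    then show ?thesis using S by (simp add: field_simps)
  qed
  have "\<exists>l\<in>A. x l \<noteq> y l"
  proof (rule ccontr)
    assume "\<not> (\<exists>l\<in>A. x l \<noteq> y l)"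
    then have "m i powr (q - p) = m j powr (q - p)" using ratio ij by metis
    then have "(q - p) * ln (m i) = (q - p) * ln (m j)"
      using m_pos ij by (metis ln_powr less_irrefl)
    then show False using q m_pos ij by simp
  qed
  then obtain k where k: "k \<in> A" "x k \<noteq> y k" by blast
  have sx: "x summable_on A" and sy: "y summable_on A" and sz: "z summable_on A"
    unfolding x_def y_def z_def divide_inverse
    by (rule summable_on_cmult_left, rule summable, use p q r in linarith)+
  have ix: "infsum x A = 1" and iy: "infsum y A = 1"
    using S unfolding x_def y_def divide_inverse
    by (subst infsum_cmult_left'; simp add: dirichlet_sum_def[symmetric])+
  have iz: "infsum z A = ?S ?r / (?S p powr (1 - \<theta>) * ?S q powr \<theta>)"
    unfolding z_def divide_inverse
    by (subst infsum_cmult_left') (simp add: dirichlet_sum_def)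
  have comb: "(\<lambda>l. (1 - \<theta>) * x l + \<theta> * y l) summable_on A"
    by (intro summable_on_add summable_on_cmult_right sx sy)
  have "infsum z A < infsum (\<lambda>l. (1 - \<theta>) * x l + \<theta> * y l) A"
  proof (rule has_sum_strict_mono)
    show "(z has_sum infsum z A) A" by (rule has_sum_infsum[OF sz])
    show "((\<lambda>l. (1 - \<theta>) * x l + \<theta> * y l) has_sum infsum (\<lambda>l. (1 - \<theta>) * x l + \<theta> * y l) A) A"
      by (rule has_sum_infsum[OF comb])
    show "z k < (1 - \<theta>) * x k + \<theta> * y k"
      unfolding z[OF k(1)] by (rule weighted_am_gm_strict[OF xy[OF k(1)] k(2) \<theta>])
  qed (use le k in auto)
  also have "\<dots> = (1 - \<theta>) * infsum x A + \<theta> * infsum y A"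
    by (simp add: infsum_add infsum_cmult_right' summable_on_cmult_right sx sy)
  finally have "?S ?r < ?S p powr (1 - \<theta>) * ?S q powr \<theta>"
    using S by (simp add: ix iy iz field_simps)
  then have "ln (?S ?r) < ln (?S p powr (1 - \<theta>) * ?S q powr \<theta>)"
    using S by (subst ln_less_cancel_iff) auto
  then show ?thesis using S by (simp add: ln_mult ln_powr)
qed

text \<open>
  Both \<open>t\<close> and \<open>2s\<close> are convex combinations of \<open>s\<close> and \<open>2t\<close>, so strict convexity of
  \<open>g = ln S\<close> gives \<open>2 g(t) + g(2s) < 2 g(s) + g(2t)\<close>.
\<close>

lemma dirichlet_sum_ratio_strict_antimono:
  assumes s: "0 < s" and t: "s < t"
  shows "dirichlet_sum A c m t / sqrt (dirichlet_sum A c m (2 * t))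
    < dirichlet_sum A c m s / sqrt (dirichlet_sum A c m (2 * s))"
proof -
  let ?S = "dirichlet_sum A c m"
  \<comment> \<open>a and b are the positions of t and 2s on the segment from s to 2t.\<close>
  define a where "a = (t - s) / (2 * t - s)"
  define b where "b = s / (2 * t - s)"
  have d: "0 < 2 * t - s" using s t by simp
  have ab: "0 < a" "a < 1" "0 < b" "b < 1" using s t d by (auto simp: a_def b_def)
  have eq: "a * (2 * t - s) = t - s" "b * (2 * t - s) = s" using d by (auto simp: a_def b_def)
  have pt: "(1 - a) * s + a * (2 * t) = t" "(1 - b) * s + b * (2 * t) = 2 * s"
  proof -
    show "(1 - a) * s + a * (2 * t) = t" "(1 - b) * s + b * (2 * t) = 2 * s"
      using eq by (simp_all add: algebra_simps)
  qed
  \<comment> \<open>The relation 2a + b = 1 makes the combination of the two convexity bounds come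
    out as exactly 2 g(s) + g(2t).\<close>
  have "(2 * a + b) * (2 * t - s) = 1 * (2 * t - s)"
    using eq by (simp only: distrib_right mult.assoc) simp
  then have sum: "2 * a + b = 1" using d by (simp only: mult_cancel_right) simp
  have "ln (?S t) < (1 - a) * ln (?S s) + a * ln (?S (2 * t))"
    using dirichlet_sum_strictly_log_convex[of s "2 * t" a] s t ab by (simp add: pt)
  moreover have "ln (?S (2 * s)) < (1 - b) * ln (?S s) + b * ln (?S (2 * t))"
    using dirichlet_sum_strictly_log_convex[of s "2 * t" b] s t ab by (simp add: pt)
  moreover have "2 * ((1 - a) * ln (?S s) + a * ln (?S (2 * t))) + ((1 - b) * ln (?S s) + b * ln (?S (2 * t)))
      = (3 - (2 * a + b)) * ln (?S s) + (2 * a + b) * ln (?S (2 * t))"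
    by (simp add: algebra_simps)
  ultimately have "2 * ln (?S t) + ln (?S (2 * s)) < 2 * ln (?S s) + ln (?S (2 * t))"
    by (simp add: sum)
  moreover have "0 < ?S s" "0 < ?S t" "0 < ?S (2 * s)" "0 < ?S (2 * t)"
    using s t by (auto intro!: dirichlet_sum_pos)
  ultimately have "ln (?S t / sqrt (?S (2 * t))) < ln (?S s / sqrt (?S (2 * s)))"
    by (simp add: ln_div ln_sqrt)
  then show ?thesis
    using \<open>0 < ?S s\<close> \<open>0 < ?S t\<close> \<open>0 < ?S (2 * s)\<close> \<open>0 < ?S (2 * t)\<close> by (subst (asm) ln_less_cancel_iff) auto
qed

end

lemma dirichlet_sum_mu:
  "(\<Sum>\<^sub>\<infinity>l\<in>modes. c l * mu l powr (- \<alpha> * s)) = dirichlet_sum modes c (\<lambda>l. mu l powr \<alpha>) s"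
  by (simp add: dirichlet_sum_def powr_powr)

section \<open>Moments of the solution\<close>

context
  fixes \<alpha> \<kappa> \<eta> \<nu> \<theta>\<^sub>0 \<sigma> :: real
    and M :: "'w measure" and F :: "real \<Rightarrow> 'w measure"
    and w :: "nat \<times> nat \<Rightarrow> real \<Rightarrow> 'w \<Rightarrow> real"
    and X :: "real \<Rightarrow> 'w \<Rightarrow> L2D"
  assumes nu: "0 < \<nu>"
    and basis: "stochastic_basis M F"
    and bm: "\<And>l. l \<in> modes \<Longrightarrow> brownian_motion M F (w l)"
    and mild: "mild_solution M F w \<kappa> \<eta> \<alpha> \<nu> \<theta>\<^sub>0 \<sigma> X"
begin

abbreviation (input) coord :: "nat \<times> nat \<Rightarrow> real \<Rightarrow> 'w \<Rightarrow> real" where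
  "coord l t \<omega> \<equiv> H_inner \<kappa> \<eta> (X t \<omega>) (e_vec \<kappa> \<eta> l)"

text \<open>The mild equation paired with one eigenfunction. The integrability clause is kept in the
  conclusion because it is the source of integrable coordinate paths.\<close>

lemma coord_equation:
  assumes l: "l \<in> modes" and t: "t \<in> {0..1}"
  shows "\<exists>I. has_wiener_integral M (w l) t
      (\<lambda>s. H_inner \<kappa> \<eta> (dirichlet_semigroup \<kappa> \<eta> (\<nu> * (t - s)) (e_vec \<kappa> \<eta> l)) (e_vec \<kappa> \<eta> l)) I
    \<and> (AE \<omega> in M. integrable unit_interval (\<lambda>s. kern (- (\<nu> * lam \<kappa> \<eta> l)) t s * coord l s \<omega>) \<and>
        coord l t \<omega> - exp (- (\<nu> * lam \<kappa> \<eta> l) * t) * coord l 0 \<omega>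
          - \<theta>\<^sub>0 * (LINT s|unit_interval. kern (- (\<nu> * lam \<kappa> \<eta> l)) t s * coord l s \<omega>)
        = \<sigma> * mu l powr (- \<alpha> / 2) * I \<omega>)"
proof -
  define a where "a = \<nu> * lam \<kappa> \<eta> l"
  let ?h = "\<lambda>u. H_inner \<kappa> \<eta> u (e_vec \<kappa> \<eta> l)"
  let ?S = "\<lambda>s. dirichlet_semigroup \<kappa> \<eta> (\<nu> * (t - s))"
  have h: "bounded_linear ?h" by (rule bounded_linear_H_inner)
  note h_lin = linear_add[OF bounded_linear.linear[OF h]] linear_scale[OF bounded_linear.linear[OF h]]
  have hS: "?h (?S s u) = exp (- (t - s) * a) * ?h u" if "s \<in> {0..t}" for s u
    using H_inner_dirichlet_semigroup[of "\<nu> * (t - s)" l \<kappa> \<eta> u] nu l that by (simp add: a_def algebra_simps)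
  obtain Z where Z: "has_WQ_integral M \<kappa> \<eta> \<alpha> w t ?S Z"
    and eq: "AE \<omega> in M. set_integrable lborel {0..t} (\<lambda>s. ?S s (X s \<omega>)) \<and>
           X t \<omega> = dirichlet_semigroup \<kappa> \<eta> (\<nu> * t) (X 0 \<omega>)
             + \<theta>\<^sub>0 *\<^sub>R (LINT s:{0..t}|lborel. ?S s (X s \<omega>)) + \<sigma> *\<^sub>R Z \<omega>"
    using mild_solutionD(3)[OF mild t] by blast
  obtain I where I: "has_wiener_integral M (w l) t (\<lambda>s. ?h (?S s (e_vec \<kappa> \<eta> l))) I"
    and ZI: "AE \<omega> in M. ?h (Z \<omega>) = mu l powr (- \<alpha> / 2) * I \<omega>"
    using WQ_integral_coordinate[OF basis bm nu l Z] by blast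
  have "AE \<omega> in M. integrable unit_interval (\<lambda>s. kern (- a) t s * coord l s \<omega>) \<and>
        coord l t \<omega> - exp (- a * t) * coord l 0 \<omega>
          - \<theta>\<^sub>0 * (LINT s|unit_interval. kern (- a) t s * coord l s \<omega>)
        = \<sigma> * mu l powr (- \<alpha> / 2) * I \<omega>"
    using eq ZI
  proof eventually_elim
    case (elim \<omega>)
    then have int: "integrable lborel (\<lambda>s. indicator {0..t} s *\<^sub>R ?S s (X s \<omega>))"
      by (simp add: set_integrable_def)
    have pw: "?h (indicator {0..t} s *\<^sub>R ?S s (X s \<omega>)) = indicator {0..t} s *\<^sub>R (exp (- (t - s) * a) * coord l s \<omega>)" for s
      using hS[of s "X s \<omega>"] by (auto simp: h_lin indicator_def linear_0[OF bounded_linear.linear[OF h]])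
    \<comment> \<open>The functional commutes with the Bochner integral thanks to the integrability
      that is part of the mild equation.\<close>
    have "?h (LINT s:{0..t}|lborel. ?S s (X s \<omega>)) = (LINT s:{0..t}|lborel. exp (- (t - s) * a) * coord l s \<omega>)"
      unfolding set_lebesgue_integral_def
      using integral_bounded_linear[OF h int] by (simp only: pw)
    also have "\<dots> = (LINT s|unit_interval. kern (- a) t s * coord l s \<omega>)"
      by (rule integral_kern_restrict[OF t])
    finally have hI: "?h (LINT s:{0..t}|lborel. ?S s (X s \<omega>)) = (LINT s|unit_interval. kern (- a) t s * coord l s \<omega>)" .
    have "integrable lborel (\<lambda>s. indicator {0..t} s *\<^sub>R (exp (- (t - s) * a) * coord l s \<omega>))"
      using integrable_bounded_linear[OF h int] by (simp only: pw)
    moreover have "(\<lambda>s. indicator {0..t} s *\<^sub>R (exp (- (t - s) * a) * coord l s \<omega>))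
      = (\<lambda>s. indicator {0..1} s *\<^sub>R (kern (- a) t s * coord l s \<omega>))"
      by (simp only: indicator_kern[OF t])
    ultimately have 1: "integrable unit_interval (\<lambda>s. kern (- a) t s * coord l s \<omega>)"
      by (simp add: integrable_unit_interval set_integrable_def)
    have "coord l t \<omega> = ?h (dirichlet_semigroup \<kappa> \<eta> (\<nu> * t) (X 0 \<omega>)) 
       + \<theta>\<^sub>0 * ?h (LINT s:{0..t}|lborel. ?S s (X s \<omega>)) + \<sigma> * ?h (Z \<omega>)"
      using elim by (simp add: h_lin)
    also have "?h (dirichlet_semigroup \<kappa> \<eta> (\<nu> * t) (X 0 \<omega>)) = exp (- a * t) * coord l 0 \<omega>"
      using hS[of 0 "X 0 \<omega>"] t by (simp add: mult.commute)
    finally show ?case using 1 hI elim by simp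
  qed
  then show ?thesis using I unfolding a_def by blast
qed

text \<open>Verifies the hypotheses of \<open>volterra_second_moment\<close> for one coordinate: the
  isometry gives the covariance of the residual, and F(0)-measurability of the initial coordinate
  gives the orthogonality.\<close>

theorem coord_second_moment:
  assumes l: "l \<in> modes" and t: "t \<in> {0..1}" and x0: "coord l 0 \<in> L2fun M"
  defines "b \<equiv> \<theta>\<^sub>0 - \<nu> * lam \<kappa> \<eta> l"
  shows "coord l t \<in> L2fun M"
    and "(LINT \<omega>|M. (coord l t \<omega>)\<^sup>2) = exp (2 * b * t) * (LINT \<omega>|M. (coord l 0 \<omega>)\<^sup>2)
      + \<sigma>\<^sup>2 * mu l powr (- \<alpha>) * (LINT r|unit_interval. kern (2 * b) t r)"
proof -
  define a where "a = \<nu> * lam \<kappa> \<eta> l"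
  define c where "c = \<sigma> * mu l powr (- \<alpha> / 2)"
  have ab: "a + b = \<theta>\<^sub>0" by (simp add: a_def b_def)
  interpret prob_space M by (rule stochastic_basisD(1)[OF basis])
  define y where "y s \<omega> = coord l s \<omega> - exp (- a * s) * coord l 0 \<omega>
    - (a + b) * (LINT r|unit_interval. kern (- a) s r * coord l r \<omega>)" for s \<omega>
  note x [measurable] = coord_measurable[OF mild, of l]
  have y_joint [measurable]: "(\<lambda>(s, \<omega>). y s \<omega>) \<in> borel_measurable (unit_interval \<Otimes>\<^sub>M M)"
    using L2fun_measurable[OF x0] unfolding y_def by measurable
  let ?\<phi> = "\<lambda>t s. H_inner \<kappa> \<eta> (dirichlet_semigroup \<kappa> \<eta> (\<nu> * (t - s)) (e_vec \<kappa> \<eta> l)) (e_vec \<kappa> \<eta> l)"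
  \<comment> \<open>The null set on which y(s) and c I(s) differ may depend on s. This is harmless,
    since the moments needed involve fixed times or fixed pairs of times.\<close>
  have "\<forall>s\<in>{0..1}. \<exists>I. has_wiener_integral M (w l) s (?\<phi> s) I \<and> (AE \<omega> in M. y s \<omega> = c * I \<omega>)"
  proof
    fix s :: real assume s: "s \<in> {0..1}"
    obtain I where "has_wiener_integral M (w l) s (?\<phi> s) I"
      and eq: "AE \<omega> in M. integrable unit_interval (\<lambda>r. kern (- (\<nu> * lam \<kappa> \<eta> l)) s r * coord l r \<omega>) \<and>
        coord l s \<omega> - exp (- (\<nu> * lam \<kappa> \<eta> l) * s) * coord l 0 \<omega>
          - \<theta>\<^sub>0 * (LINT r|unit_interval. kern (- (\<nu> * lam \<kappa> \<eta> l)) s r * coord l r \<omega>)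
        = \<sigma> * mu l powr (- \<alpha> / 2) * I \<omega>"
      using coord_equation[OF l s] by blast
    moreover have "AE \<omega> in M. y s \<omega> = c * I \<omega>"
      using eq by eventually_elim (simp add: y_def ab, simp add: a_def c_def)
    ultimately show "\<exists>I. has_wiener_integral M (w l) s (?\<phi> s) I \<and> (AE \<omega> in M. y s \<omega> = c * I \<omega>)" by blast
  qed
  then obtain I where I: "\<And>s. s \<in> {0..1} \<Longrightarrow> has_wiener_integral M (w l) s (?\<phi> s) (I s)"
    and yI: "\<And>s. s \<in> {0..1} \<Longrightarrow> AE \<omega> in M. y s \<omega> = c * I s \<omega>"
    by metis
  have IL2: "I s \<in> L2fun M" if "s \<in> {0..1}" for s
    by (rule wiener_integral_L2[OF basis bm[OF l] I[OF that]])
  have ym [measurable]: "y s \<in> borel_measurable M" if "s \<in> {0..1}" for s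
    using measurable_compose_Pair1[OF _ y_joint, of s] that by simp
  have yL2: "y s \<in> L2fun M" if "s \<in> {0..1}" for s
    by (rule L2fun_cong_AE[OF yI[OF that] L2fun_cmult[OF IL2[OF that]] ym[OF that]])
  have cov: "(LINT \<omega>|M. y s \<omega> * y r \<omega>) = c\<^sup>2 * (LINT u|unit_interval. kern (- a) s u * kern (- a) r u)"
    if s: "s \<in> {0..1}" and r: "r \<in> {0..1}" for s r
  proof -
    have "AE \<omega> in M. y s \<omega> * y r \<omega> = c\<^sup>2 * (I s \<omega> * I r \<omega>)"
      using yI[OF s] yI[OF r] by eventually_elim (simp add: power2_eq_square)
    then have "(LINT \<omega>|M. y s \<omega> * y r \<omega>) = (LINT \<omega>|M. c\<^sup>2 * (I s \<omega> * I r \<omega>))"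
      using ym[OF s] ym[OF r] L2fun_measurable[OF IL2[OF s]] L2fun_measurable[OF IL2[OF r]]
      by (intro integral_cong_AE) auto
    also have "\<dots> = c\<^sup>2 * (LINT u|lborel. (indicator {0..s} u * ?\<phi> s u) * (indicator {0..r} u * ?\<phi> r u))"
      by (simp add: wiener_isometry[OF basis bm[OF l] I[OF s] I[OF r]])
    also have "(LINT u|lborel. (indicator {0..s} u * ?\<phi> s u) * (indicator {0..r} u * ?\<phi> r u))
      = (LINT u|unit_interval. kern (- a) s u * kern (- a) r u)"
      unfolding integral_unit_interval set_lebesgue_integral_def
    proof (intro Bochner_Integration.integral_cong refl)
      fix u :: real
      have \<phi>: "indicator {0..s} u * ?\<phi> s u = indicator {0..1} u * kern (- a) s u" if "s \<in> {0..1}" for s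
        using that nu l by (auto simp: indicator_def kern_def H_inner_dirichlet_semigroup H_inner_e_vec a_def algebra_simps)
      show "(indicator {0..s} u * ?\<phi> s u) * (indicator {0..r} u * ?\<phi> r u) = indicator {0..1} u *\<^sub>R (kern (- a) s u * kern (- a) r u)"
        unfolding \<phi>[OF s] \<phi>[OF r] by (auto simp: indicator_def)
    qed
    finally show ?thesis .
  qed
  have x0F: "coord l 0 \<in> borel_measurable (F 0)"
    by (intro H_inner_measurable mild_solutionD(1)[OF mild]) simp
  have orth: "(LINT \<omega>|M. coord l 0 \<omega> * y s \<omega>) = 0" if s: "s \<in> {0..1}" for s
  proof -
    have "AE \<omega> in M. coord l 0 \<omega> * y s \<omega> = c * (coord l 0 \<omega> * I s \<omega>)"
      using yI[OF s] by eventually_elim simp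
    then have "(LINT \<omega>|M. coord l 0 \<omega> * y s \<omega>) = (LINT \<omega>|M. c * (coord l 0 \<omega> * I s \<omega>))"
      using ym[OF s] L2fun_measurable[OF IL2[OF s]] L2fun_measurable[OF x0]
      by (intro integral_cong_AE) auto
    also have "\<dots> = c * (LINT \<omega>|M. coord l 0 \<omega> * I s \<omega>)" by simp
    also have "(LINT \<omega>|M. coord l 0 \<omega> * I s \<omega>) = 0"
      by (rule wiener_integral_orthogonal_initial[OF basis bm[OF l] I[OF s] x0F x0])
    finally show ?thesis by simp
  qed
  \<comment> \<open>A single null set suffices: at time 1 the kernel is nowhere 0 on {0..1}, and
    multiplying by \<open>kern a 1 s\<close> undoes it.\<close>
  have int: "AE \<omega> in M. integrable unit_interval (\<lambda>s. coord l s \<omega>)"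
  proof -
    obtain I where "AE \<omega> in M. integrable unit_interval (\<lambda>s. kern (- a) 1 s * coord l s \<omega>) \<and>
        coord l 1 \<omega> - exp (- a * 1) * coord l 0 \<omega>
          - \<theta>\<^sub>0 * (LINT s|unit_interval. kern (- a) 1 s * coord l s \<omega>)
        = \<sigma> * mu l powr (- \<alpha> / 2) * I \<omega>"
      using coord_equation[OF l, of 1] unfolding a_def by auto
    then show ?thesis
    proof eventually_elim
      case (elim \<omega>)
      have "integrable unit_interval (\<lambda>s. kern a 1 s * (kern (- a) 1 s * coord l s \<omega>))"
        by (rule integrable_kern_mult[OF conjunct1[OF elim]]) simp
      moreover have "integrable unit_interval (\<lambda>s. kern a 1 s * (kern (- a) 1 s * coord l s \<omega>))
          = integrable unit_interval (\<lambda>s. coord l s \<omega>)"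
        by (intro Bochner_Integration.integrable_cong refl)
          (simp add: kern_def mult.assoc[symmetric] exp_add[symmetric])
      ultimately show ?case by (rule rev_iffD1)
    qed
  qed
  have c2: "c\<^sup>2 = \<sigma>\<^sup>2 * mu l powr (- \<alpha>)"
    by (simp add: c_def power_mult_distrib power2_eq_square powr_add[symmetric])
  note moment = volterra_second_moment[OF prob_space_axioms y_def x int x0 yL2 cov orth t]
  show "coord l t \<in> L2fun M" by (rule moment)
  show "(LINT \<omega>|M. (coord l t \<omega>)\<^sup>2) = exp (2 * b * t) * (LINT \<omega>|M. (coord l 0 \<omega>)\<^sup>2)
      + \<sigma>\<^sup>2 * mu l powr (- \<alpha>) * (LINT r|unit_interval. kern (2 * b) t r)"
    unfolding c2[symmetric] by (rule moment)
qed

context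
  assumes alpha: "0 < \<alpha>" and sigma: "0 < \<sigma>"
    and init: "(\<integral>\<^sup>+\<omega>. L2_norm_sq \<kappa> \<eta> \<alpha> (-1) (X 0 \<omega>) \<partial>M) < \<infinity>"
begin

abbreviation (input) weight :: "nat \<times> nat \<Rightarrow> real" where
  "weight l \<equiv> f_mode M \<kappa> \<eta> \<alpha> \<sigma> (X 0) l (2 * (\<nu> * lam \<kappa> \<eta> l - \<theta>\<^sub>0))"

text \<open>At index -1 the norm weight is mu to the power +\<alpha>, and Tonelli turns the finite
  mean norm into this series. Each of its terms is then finite, which gives square integrability of
  every coordinate.\<close>

lemma initial_coord:
  shows "l \<in> modes \<Longrightarrow> coord l 0 \<in> L2fun M"
    and "(\<lambda>l. mu l powr \<alpha> * (LINT \<omega>|M. (coord l 0 \<omega>)\<^sup>2)) summable_on modes"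
proof -
  have m [measurable]: "coord l 0 \<in> borel_measurable M" for l
    by (intro H_inner_measurable
      measurable_from_subalg[OF stochastic_basisD(2)[OF basis order_refl] mild_solutionD(1)[OF mild]]) simp
  have "(\<integral>\<^sup>+\<omega>. L2_norm_sq \<kappa> \<eta> \<alpha> (-1) (X 0 \<omega>) \<partial>M)
      = (\<Sum>\<^sub>\<infinity>l\<in>modes. \<integral>\<^sup>+\<omega>. ennreal (mu l powr (- \<alpha> * (-1)) * (coord l 0 \<omega>)\<^sup>2) \<partial>M)"
    unfolding L2_norm_sq_def by (intro nn_integral_infsum countableI_type infinite_modes) measurable
  also have "\<dots> = (\<Sum>\<^sub>\<infinity>l\<in>modes. ennreal (mu l powr \<alpha>) * (\<integral>\<^sup>+\<omega>. ennreal ((coord l 0 \<omega>)\<^sup>2) \<partial>M))"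
    by (simp add: ennreal_mult nn_integral_cmult)
  finally have fin: "(\<Sum>\<^sub>\<infinity>l\<in>modes. ennreal (mu l powr \<alpha>) * (\<integral>\<^sup>+\<omega>. ennreal ((coord l 0 \<omega>)\<^sup>2) \<partial>M)) < \<infinity>"
    using init by simp
  have L2: "coord l 0 \<in> L2fun M" if l: "l \<in> modes" for l
  proof -
    have "(\<Sum>l\<in>{l}. ennreal (mu l powr \<alpha>) * (\<integral>\<^sup>+\<omega>. ennreal ((coord l 0 \<omega>)\<^sup>2) \<partial>M)) < \<infinity>"
      by (rule order.strict_trans1[OF finite_sum_le_infsum_ennreal fin]) (use l in auto)
    then have "(\<integral>\<^sup>+\<omega>. ennreal ((coord l 0 \<omega>)\<^sup>2) \<partial>M) < \<infinity>"
      using mu_pos[OF l] by (auto simp: ennreal_mult_less_top)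
    then show ?thesis using m by (simp add: L2fun_iff_nn_integral)
  qed
  then show "l \<in> modes \<Longrightarrow> coord l 0 \<in> L2fun M" .
  show "(\<lambda>l. mu l powr \<alpha> * (LINT \<omega>|M. (coord l 0 \<omega>)\<^sup>2)) summable_on modes"
  proof (rule summable_on_ennreal_finite)
    have "ennreal (mu l powr \<alpha> * (LINT \<omega>|M. (coord l 0 \<omega>)\<^sup>2))
        = ennreal (mu l powr \<alpha>) * (\<integral>\<^sup>+\<omega>. ennreal ((coord l 0 \<omega>)\<^sup>2) \<partial>M)" if "l \<in> modes" for l
      using L2fun_square[OF L2[OF that]] by (simp add: nn_integral_eq_integral ennreal_mult)
    then show "(\<Sum>\<^sub>\<infinity>l\<in>modes. ennreal (mu l powr \<alpha> * (LINT \<omega>|M. (coord l 0 \<omega>)\<^sup>2))) < \<infinity>"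
      using fin by (simp cong: infsum_cong)
  qed simp
qed

lemma weight_pos:
  assumes "l \<in> modes"
  shows "0 < weight l"
  unfolding f_mode_def using sigma f2_pos mu_pos[OF assms]
  by (intro add_nonneg_pos mult_nonneg_nonneg mult_pos_pos f1_nonneg Bochner_Integration.integral_nonneg) auto

text \<open>The initial part is dominated by the series of \<open>initial_coord\<close>, since
  \<open>f1\<close> is bounded and the power of mu is at most 1. The noise part is dominated by the
  lattice sum with exponent 1 + \<alpha> s.\<close>

lemma weight_summable:
  assumes s: "0 < s"
  shows "(\<lambda>l. weight l * mu l powr (- \<alpha> * s)) summable_on modes"
proof -
  \<comment> \<open>With this K the argument x of \<open>f2\<close> is at least 2 \<nu> mu - K. In C
    the summand 1/\<nu> serves the modes with K \<le> \<nu> mu, where x \<ge> \<nu> mu; the other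
    serves the remaining ones, where \<open>f2\<close> is at most exp K and K/(\<nu> mu) exceeds
    1.\<close>
  define K where "K = 2 * \<bar>\<theta>\<^sub>0\<bar>"
  define C where "C = 1 / \<nu> + exp K * K / \<nu>"
  have K: "0 \<le> K" by (simp add: K_def)
  have as: "0 < \<alpha> * s" using alpha s by simp
  define G where "G l = exp K * (mu l powr \<alpha> * (LINT \<omega>|M. (coord l 0 \<omega>)\<^sup>2)) + \<sigma>\<^sup>2 * C * mu l powr (- (1 + \<alpha> * s))" for l
  have "G summable_on modes"
    unfolding G_def
    by (intro summable_on_add summable_on_cmult_right initial_coord(2) summable_mu_powr) (use as in simp)
  then show ?thesis
  proof (rule summable_on_comparison_test)
    fix l assume l: "l \<in> modes"
    define x where "x = 2 * (\<nu> * lam \<kappa> \<eta> l - \<theta>\<^sub>0)"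
    have mu: "1 \<le> mu l" by (rule mu_ge_1[OF l])
    have "\<nu> * mu l \<le> \<nu> * lam \<kappa> \<eta> l" using nu by (intro mult_left_mono) (simp_all add: lam_def)
    then have x: "2 * (\<nu> * mu l) - K \<le> x" by (simp add: x_def K_def)
    moreover have "0 < \<nu> * mu l" using nu mu by simp
    ultimately have xK: "- x \<le> K" by linarith
    have "f2 x \<le> C / mu l"
    proof (cases "K \<le> \<nu> * mu l")
      case True
      then have "\<nu> * mu l \<le> x" using x by linarith
      then have "f2 x \<le> 1 / (\<nu> * mu l)"
        using \<open>0 < \<nu> * mu l\<close> f2_le_inverse[of x] by (smt (verit) frac_le)
      also have "\<dots> \<le> C / mu l"
        using mu nu K by (simp add: C_def add_divide_distrib divide_divide_eq_left)
      finally show ?thesis .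
    next
      case False
      then have "1 \<le> K / (\<nu> * mu l)" using \<open>0 < \<nu> * mu l\<close> by simp
      then have "exp K * 1 \<le> exp K * (K / (\<nu> * mu l))" by (intro mult_left_mono) auto
      then have "f2 x \<le> exp K * (K / (\<nu> * mu l))" using f2_le[OF K xK] by simp
      also have "\<dots> \<le> C / mu l"
        using mu nu K by (simp add: C_def add_divide_distrib divide_divide_eq_left)
      finally show ?thesis .
    qed
    then have "\<sigma>\<^sup>2 * f2 x * mu l powr (- \<alpha> * s) \<le> \<sigma>\<^sup>2 * (C / mu l) * mu l powr (- \<alpha> * s)"
      by (intro mult_right_mono mult_left_mono) auto
    also have "\<dots> = \<sigma>\<^sup>2 * C * mu l powr (- (1 + \<alpha> * s))"
      using mu by (simp add: powr_diff powr_minus field_simps powr_add)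
    finally have 2: "\<sigma>\<^sup>2 * f2 x * mu l powr (- \<alpha> * s) \<le> \<sigma>\<^sup>2 * C * mu l powr (- (1 + \<alpha> * s))" .
    define m where "m = mu l powr \<alpha> * (LINT \<omega>|M. (coord l 0 \<omega>)\<^sup>2)"
    have m: "0 \<le> m" by (simp add: m_def)
    have "mu l powr (- \<alpha> * s) \<le> mu l powr 0" using as mu by (intro powr_mono) auto
    then have "mu l powr (- \<alpha> * s) \<le> 1" using mu by simp
    then have "m * f1 x * mu l powr (- \<alpha> * s) \<le> m * exp K * 1"
      using m f1_le[OF K xK] f1_nonneg[of x] by (intro mult_mono) auto
    then have "m * f1 x * mu l powr (- \<alpha> * s) \<le> exp K * m" by (simp add: mult.commute)
    then show "weight l * mu l powr (- \<alpha> * s) \<le> G l"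
      using 2 unfolding G_def f_mode_def x_def[symmetric] m_def[symmetric] distrib_right by linarith
    show "0 \<le> weight l * mu l powr (- \<alpha> * s)"
      using weight_pos[OF l] by simp
  qed
qed

text \<open>Averaging the second moment over time produces \<open>f1\<close> and \<open>f2\<close>
  at -2b. Pulling out the power with exponent -\<alpha>(\<beta> + 1) leaves mu to the power \<alpha>
  on the initial part and nothing on the noise part, which is \<open>f_mode\<close>.\<close>

lemma mean_coord:
  assumes l: "l \<in> modes"
  shows "(\<integral>\<^sup>+t. \<integral>\<^sup>+\<omega>. ennreal (mu l powr (- \<alpha> * \<beta>) * (coord l t \<omega>)\<^sup>2) \<partial>M \<partial>unit_interval)
    = ennreal (weight l * mu l powr (- \<alpha> * (\<beta> + 1)))"
proof -
  define b where "b = \<theta>\<^sub>0 - \<nu> * lam \<kappa> \<eta> l"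
  define m where "m = (LINT \<omega>|M. (coord l 0 \<omega>)\<^sup>2)"
  define g where "g t = exp (2 * b * t) * m + \<sigma>\<^sup>2 * mu l powr (- \<alpha>) * (LINT r|unit_interval. kern (2 * b) t r)" for t
  have mu: "0 < mu l" by (rule mu_pos[OF l])
  have "(\<integral>\<^sup>+\<omega>. ennreal (mu l powr (- \<alpha> * \<beta>) * (coord l t \<omega>)\<^sup>2) \<partial>M) = ennreal (mu l powr (- \<alpha> * \<beta>) * g t)"
    if "t \<in> space unit_interval" for t
  proof -
    have t: "t \<in> {0..1}" using that by simp
    note moment = coord_second_moment[OF l t initial_coord(1)[OF l]]
    have "(LINT \<omega>|M. mu l powr (- \<alpha> * \<beta>) * (coord l t \<omega>)\<^sup>2) = mu l powr (- \<alpha> * \<beta>) * g t"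
      by (simp add: moment(2) g_def b_def m_def)
    then show ?thesis
      using L2fun_square[OF moment(1)] by (subst nn_integral_eq_integral) auto
  qed
  then have "(\<integral>\<^sup>+t. \<integral>\<^sup>+\<omega>. ennreal (mu l powr (- \<alpha> * \<beta>) * (coord l t \<omega>)\<^sup>2) \<partial>M \<partial>unit_interval)
     = (\<integral>\<^sup>+t. ennreal (mu l powr (- \<alpha> * \<beta>) * g t) \<partial>unit_interval)"
    by (rule nn_integral_cong)
  also have "\<dots> = ennreal (LINT t|unit_interval. mu l powr (- \<alpha> * \<beta>) * g t)"
  proof (rule nn_integral_eq_integral)
    show "integrable unit_interval (\<lambda>t. mu l powr (- \<alpha> * \<beta>) * g t)"
      using integrable_exp_unit_interval[of "- 2 * b"] integrable_integral_kern[of "2 * b"]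
      by (simp add: g_def)
    show "AE t in unit_interval. 0 \<le> mu l powr (- \<alpha> * \<beta>) * g t"
      unfolding g_def m_def
      by (intro AE_I2 mult_nonneg_nonneg add_nonneg_nonneg Bochner_Integration.integral_nonneg) (auto simp: kern_def)
  qed
  also have "(LINT t|unit_interval. mu l powr (- \<alpha> * \<beta>) * g t)
    = mu l powr (- \<alpha> * \<beta>) * (f1 (- 2 * b) * m + \<sigma>\<^sup>2 * mu l powr (- \<alpha>) * f2 (- 2 * b))"
    unfolding g_def
    using integrable_exp_unit_interval[of "- 2 * b"] integrable_integral_kern[of "2 * b"]
      integral_exp_eq_f1[of "- 2 * b"] integral_kern_eq_f2[of "- 2 * b"]
    by simp
  also have "\<dots> = weight l * mu l powr (- \<alpha> * (\<beta> + 1))"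
  proof -
    have 1: "mu l powr (- \<alpha> * \<beta>) = mu l powr \<alpha> * mu l powr (- \<alpha> * (\<beta> + 1))"
      by (simp add: powr_add[symmetric] algebra_simps)
    have 2: "mu l powr (- \<alpha> * \<beta>) * mu l powr (- \<alpha>) = mu l powr (- \<alpha> * (\<beta> + 1))"
      by (simp add: powr_add[symmetric] algebra_simps)
    have x: "2 * (\<nu> * lam \<kappa> \<eta> l - \<theta>\<^sub>0) = - 2 * b" by (simp add: b_def)
    have "mu l powr (- \<alpha> * \<beta>) * (f1 (- 2 * b) * m + \<sigma>\<^sup>2 * mu l powr (- \<alpha>) * f2 (- 2 * b))
      = mu l powr (- \<alpha> * \<beta>) * (m * f1 (- 2 * b)) + (mu l powr (- \<alpha> * \<beta>) * mu l powr (- \<alpha>)) * (\<sigma>\<^sup>2 * f2 (- 2 * b))"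
      by (simp only: distrib_left mult_ac)
    also have "\<dots> = (mu l powr \<alpha> * mu l powr (- \<alpha> * (\<beta> + 1))) * (m * f1 (- 2 * b))
        + mu l powr (- \<alpha> * (\<beta> + 1)) * (\<sigma>\<^sup>2 * f2 (- 2 * b))"
      unfolding 2 unfolding 1 ..
    finally show ?thesis
      unfolding f_mode_def x m_def[symmetric] by (simp only: distrib_right distrib_left mult_ac)
  qed
  finally show ?thesis .
qed

text \<open>Tonelli moves both expectation and time integral inside the sum over modes; \<beta> > -1
  makes the resulting series finite.\<close>

lemma mean_eq_infsum:
  assumes "-1 < \<beta>"
  shows "mean_L2_norm_sq M \<kappa> \<eta> \<alpha> X \<beta> = ennreal (\<Sum>\<^sub>\<infinity>l\<in>modes. weight l * mu l powr (- \<alpha> * (\<beta> + 1)))"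
proof -
  interpret prob_space M by (rule stochastic_basisD(1)[OF basis])
  have joint: "(\<lambda>(t, \<omega>). ennreal (mu l powr (- \<alpha> * \<beta>) * (coord l t \<omega>)\<^sup>2)) \<in> borel_measurable (unit_interval \<Otimes>\<^sub>M M)" for l
  proof -
    note [measurable] = coord_measurable[OF mild, of l]
    show ?thesis by measurable
  qed
  have slice: "(\<lambda>\<omega>. ennreal (mu l powr (- \<alpha> * \<beta>) * (coord l t \<omega>)\<^sup>2)) \<in> borel_measurable M"
    if "t \<in> space unit_interval" for l t
    using measurable_compose_Pair1[OF that joint[of l]] by (simp only: prod.case)
  have "mean_L2_norm_sq M \<kappa> \<eta> \<alpha> X \<beta> = (\<integral>\<^sup>+t. \<integral>\<^sup>+\<omega>. L2_norm_sq \<kappa> \<eta> \<alpha> \<beta> (X t \<omega>) \<partial>M \<partial>unit_interval)"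
    unfolding mean_L2_norm_sq_def unit_interval_def by (subst nn_integral_restrict_space) auto
  also have "\<dots> = (\<integral>\<^sup>+t. (\<Sum>\<^sub>\<infinity>l\<in>modes. \<integral>\<^sup>+\<omega>. ennreal (mu l powr (- \<alpha> * \<beta>) * (coord l t \<omega>)\<^sup>2) \<partial>M) \<partial>unit_interval)"
    unfolding L2_norm_sq_def
    by (intro nn_integral_cong nn_integral_infsum countableI_type infinite_modes slice)
  also have "\<dots> = (\<Sum>\<^sub>\<infinity>l\<in>modes. \<integral>\<^sup>+t. \<integral>\<^sup>+\<omega>. ennreal (mu l powr (- \<alpha> * \<beta>) * (coord l t \<omega>)\<^sup>2) \<partial>M \<partial>unit_interval)"
    using joint by (intro nn_integral_infsum countableI_type infinite_modes borel_measurable_nn_integral)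
  also have "\<dots> = (\<Sum>\<^sub>\<infinity>l\<in>modes. ennreal (weight l * mu l powr (- \<alpha> * (\<beta> + 1))))"
    by (intro infsum_cong mean_coord)
  also have "\<dots> = ennreal (\<Sum>\<^sub>\<infinity>l\<in>modes. weight l * mu l powr (- \<alpha> * (\<beta> + 1)))"
    using assms by (intro infsum_ennreal_real weight_summable mult_nonneg_nonneg less_imp_le[OF weight_pos]) auto
  finally show ?thesis .
qed

abbreviation (input) spectral_sum :: "real \<Rightarrow> real" where
  "spectral_sum \<equiv> dirichlet_sum modes weight (\<lambda>l. mu l powr \<alpha>)"

text \<open>Two modes with different eigenvalues, the source of strictness in the
  log-convexity.\<close>

lemma mu_values: "(1, 1) \<in> modes" "(1, 2) \<in> modes" "mu (1, 1) powr \<alpha> \<noteq> mu (1, 2) powr \<alpha>"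
proof -
  show "(1, 1) \<in> modes" "(1, 2) \<in> modes" by (auto simp: modes_def)
  have "mu (1, 1) powr \<alpha> < mu (1, 2) powr \<alpha>"
    using alpha by (intro powr_less_mono2) (auto simp: mu_def)
  then show "mu (1, 1) powr \<alpha> \<noteq> mu (1, 2) powr \<alpha>" by simp
qed

lemma weight_summable':
  "0 < s \<Longrightarrow> (\<lambda>l. weight l * (mu l powr \<alpha>) powr (- s)) summable_on modes"
  using weight_summable[of s] by (simp add: powr_powr)

lemma mu_powr_pos: "l \<in> modes \<Longrightarrow> 0 < mu l powr \<alpha>"
  using mu_pos[of l] by simp

lemma spectral_sum_pos: "0 < s \<Longrightarrow> 0 < spectral_sum s"
  by (rule dirichlet_sum_pos[OF weight_pos mu_powr_pos mu_values weight_summable'])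

lemma mean_eq:
  assumes "-1 < \<beta>"
  shows "mean_L2_norm_sq M \<kappa> \<eta> \<alpha> X \<beta> = ennreal (spectral_sum (\<beta> + 1))" and "0 < spectral_sum (\<beta> + 1)"
  using mean_eq_infsum[OF assms] spectral_sum_pos[of "\<beta> + 1"] assms by (simp_all only: dirichlet_sum_mu)

text \<open>The shift by one turns the index 2\<beta> + 1 of the denominator into twice the exponent
  of the numerator.\<close>

lemma R_ratio_eq:
  assumes "-1 < \<beta>"
  shows "R_ratio M \<kappa> \<eta> \<alpha> X \<beta> = spectral_sum (\<beta> + 1) / sqrt (spectral_sum (2 * (\<beta> + 1)))"
proof -
  have "-1 < 2 * \<beta> + 1" "2 * \<beta> + 1 + 1 = 2 * (\<beta> + 1)" using assms by auto
  then show ?thesis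
    unfolding R_ratio_def using mean_eq[OF assms] mean_eq[of "2 * \<beta> + 1"]
    by (simp only: enn2real_ennreal less_imp_le)
qed

lemma mean_pos_finite:
  assumes "-1 < \<beta>"
  shows "0 < mean_L2_norm_sq M \<kappa> \<eta> \<alpha> X \<beta>" and "mean_L2_norm_sq M \<kappa> \<eta> \<alpha> X \<beta> < \<infinity>"
proof -
  have "0 < ennreal x \<and> ennreal x < \<infinity>" if "0 < x" for x using that by simp
  from this[OF mean_eq(2)[OF assms]]
  show "0 < mean_L2_norm_sq M \<kappa> \<eta> \<alpha> X \<beta>" "mean_L2_norm_sq M \<kappa> \<eta> \<alpha> X \<beta> < \<infinity>"
    unfolding mean_eq(1)[OF assms] by blast+
qed

lemma R_ratio_antimono: "strict_antimono_on {-1<..} (R_ratio M \<kappa> \<eta> \<alpha> X)"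
proof (rule monotone_onI)
  fix \<beta> \<gamma> :: real assume "\<beta> \<in> {-1<..}" "\<gamma> \<in> {-1<..}" "\<beta> < \<gamma>"
  then show "R_ratio M \<kappa> \<eta> \<alpha> X \<gamma> < R_ratio M \<kappa> \<eta> \<alpha> X \<beta>"
    using dirichlet_sum_ratio_strict_antimono[OF weight_pos mu_powr_pos mu_values weight_summable', of "\<beta> + 1" "\<gamma> + 1"]
    by (simp add: R_ratio_eq)
qed

end

end

text \<open>The formula for the ratio is accompanied by positivity, finiteness and summability
  because \<open>enn2real\<close> sends infinity to 0, division by 0 yields 0 and
  \<open>infsum\<close> is 0 on families that are not summable; these clauses exclude that the
  identity holds through default values.\<close>

theorem proposition2p3:
  fixes \<alpha> \<kappa> \<eta> \<nu> \<theta>\<^sub>0 \<sigma> :: real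
    and M :: "'w measure" and F :: "real \<Rightarrow> 'w measure"
    and w :: "nat \<times> nat \<Rightarrow> real \<Rightarrow> 'w \<Rightarrow> real"
    and X :: "real \<Rightarrow> 'w \<Rightarrow> L2D"
  assumes "0 < \<alpha>" and "0 < \<nu>" and "\<nu> < 1" and "0 < \<sigma>"
    and "stochastic_basis M F"
    and "\<And>l. l \<in> modes \<Longrightarrow> brownian_motion M F (w l)"
    and "prob_space.indep_vars M (\<lambda>_. \<Pi>\<^sub>M t\<in>{0..}. borel) (\<lambda>l \<omega>. \<lambda>t\<in>{0..}. w l t \<omega>) modes"
    and "prob_space.indep_set M (sets (vimage_algebra (space M) (X 0) borel))
           (sets (vimage_algebra (space M) (\<lambda>\<omega>. \<lambda>l\<in>modes. \<lambda>t\<in>{0..}. w l t \<omega>)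
             (\<Pi>\<^sub>M l\<in>modes. \<Pi>\<^sub>M t\<in>{0..}. borel)))"
    and "mild_solution M F w \<kappa> \<eta> \<alpha> \<nu> \<theta>\<^sub>0 \<sigma> X"
    and "(\<integral>\<^sup>+\<omega>. L2_norm_sq \<kappa> \<eta> \<alpha> (-1) (X 0 \<omega>) \<partial>M) < \<infinity>"
  shows "(\<forall>\<beta> > -1.
      0 < mean_L2_norm_sq M \<kappa> \<eta> \<alpha> X \<beta> \<and> mean_L2_norm_sq M \<kappa> \<eta> \<alpha> X \<beta> < \<infinity> \<and>
      0 < mean_L2_norm_sq M \<kappa> \<eta> \<alpha> X (2 * \<beta> + 1) \<and> mean_L2_norm_sq M \<kappa> \<eta> \<alpha> X (2 * \<beta> + 1) < \<infinity> \<and>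
      (\<lambda>l. f_mode M \<kappa> \<eta> \<alpha> \<sigma> (X 0) l (2 * (\<nu> * lam \<kappa> \<eta> l - \<theta>\<^sub>0)) * mu l powr (- \<alpha> * (\<beta> + 1)))
        summable_on modes \<and>
      (\<lambda>l. f_mode M \<kappa> \<eta> \<alpha> \<sigma> (X 0) l (2 * (\<nu> * lam \<kappa> \<eta> l - \<theta>\<^sub>0)) * mu l powr (- 2 * \<alpha> * (\<beta> + 1)))
        summable_on modes \<and>
      R_ratio M \<kappa> \<eta> \<alpha> X \<beta> =
        (\<Sum>\<^sub>\<infinity>l\<in>modes. f_mode M \<kappa> \<eta> \<alpha> \<sigma> (X 0) l (2 * (\<nu> * lam \<kappa> \<eta> l - \<theta>\<^sub>0))
            * mu l powr (- \<alpha> * (\<beta> + 1)))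
        / sqrt (\<Sum>\<^sub>\<infinity>l\<in>modes. f_mode M \<kappa> \<eta> \<alpha> \<sigma> (X 0) l (2 * (\<nu> * lam \<kappa> \<eta> l - \<theta>\<^sub>0))
            * mu l powr (- 2 * \<alpha> * (\<beta> + 1))))
    \<and> strict_antimono_on {-1<..1 / \<alpha> - 1} (R_ratio M \<kappa> \<eta> \<alpha> X)"
proof (intro conjI allI impI)
  note hyps = assms(2,5,6,9,1,4,10)
  fix \<beta> :: real assume \<beta>: "-1 < \<beta>"
  have \<beta>': "-1 < 2 * \<beta> + 1" and pos: "0 < \<beta> + 1" "0 < 2 * (\<beta> + 1)" using \<beta> by auto
  have e: "- 2 * \<alpha> * (\<beta> + 1) = - \<alpha> * (2 * (\<beta> + 1))" by simp
  show "0 < mean_L2_norm_sq M \<kappa> \<eta> \<alpha> X \<beta>"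
    by (rule mean_pos_finite(1)[OF hyps \<beta>])
  show "mean_L2_norm_sq M \<kappa> \<eta> \<alpha> X \<beta> < \<infinity>"
    by (rule mean_pos_finite(2)[OF hyps \<beta>])
  show "0 < mean_L2_norm_sq M \<kappa> \<eta> \<alpha> X (2 * \<beta> + 1)"
    by (rule mean_pos_finite(1)[OF hyps \<beta>'])
  show "mean_L2_norm_sq M \<kappa> \<eta> \<alpha> X (2 * \<beta> + 1) < \<infinity>"
    by (rule mean_pos_finite(2)[OF hyps \<beta>'])
  show "(\<lambda>l. f_mode M \<kappa> \<eta> \<alpha> \<sigma> (X 0) l (2 * (\<nu> * lam \<kappa> \<eta> l - \<theta>\<^sub>0)) * mu l powr (- \<alpha> * (\<beta> + 1))) summable_on modes"
    by (rule weight_summable[OF hyps pos(1)])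
  show "(\<lambda>l. f_mode M \<kappa> \<eta> \<alpha> \<sigma> (X 0) l (2 * (\<nu> * lam \<kappa> \<eta> l - \<theta>\<^sub>0)) * mu l powr (- 2 * \<alpha> * (\<beta> + 1))) summable_on modes"
    unfolding e by (rule weight_summable[OF hyps pos(2)])
  show "R_ratio M \<kappa> \<eta> \<alpha> X \<beta> =
        (\<Sum>\<^sub>\<infinity>l\<in>modes. f_mode M \<kappa> \<eta> \<alpha> \<sigma> (X 0) l (2 * (\<nu> * lam \<kappa> \<eta> l - \<theta>\<^sub>0))
            * mu l powr (- \<alpha> * (\<beta> + 1)))
        / sqrt (\<Sum>\<^sub>\<infinity>l\<in>modes. f_mode M \<kappa> \<eta> \<alpha> \<sigma> (X 0) l (2 * (\<nu> * lam \<kappa> \<eta> l - \<theta>\<^sub>0))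
            * mu l powr (- 2 * \<alpha> * (\<beta> + 1)))"
    unfolding e dirichlet_sum_mu by (rule R_ratio_eq[OF hyps \<beta>])
next
  show "strict_antimono_on {-1<..1 / \<alpha> - 1} (R_ratio M \<kappa> \<eta> \<alpha> X)"
    by (rule monotone_on_subset[OF R_ratio_antimono[OF assms(2,5,6,9,1,4,10)]]) auto
qed

end
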